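(* Let $G=(V,E,\sigma)$ be a finite plane network with vertex set $V$, edge set $E$ and edge-weights $\sigma\in\mathbb{R}^E_{>0}$. Let $\mathcal{C}$ be a Jordan curve that encircles $G$ in the closed outer face of $G$, let $S_1,S_2$ be two disjoint arcs of $\mathcal{C}$, and assume that $A=S_1\cap V$ and $B=S_2\cap V$ are nonempty. Let $\Gamma(A,B)$ be the family of all paths in $G$ from $A$ to $B$, and assume it is nonempty. Then there is a unique subfamily $\Gamma\subset\Gamma(A,B)$ such that (i) $\Gamma$ is a family of non-crossing paths; (ii) $\Gamma$ supports a probability mass function (pmf) $\mu$ that is optimal for $\mathrm{Mod}_{2,\sigma}(\Gamma(A,B))$; (iii) $\Gamma$ is a minimal subfamily for the $(2,\sigma)$-modulus of $\Gamma(A,B)$. In particular, $\mu$ is the unique pmf supported on $\Gamma$ that satisfies (ii). Moreover, $\Gamma$ and $\mu$ can be computed using the output of the Non-crossing Minimal Subfamily Algorithm: $\Gamma$ is the path family output by the algorithm and $\mu(\gamma)=m(\gamma)/\sum_{\gamma'\in\Gamma}m(\gamma')$, where $m\in\mathbb{R}^{\Gamma}_{>0}$ are the weights output by the algorithm.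
   Context: Networks and paths. A finite network is a finite graph without self-loops (multiple edges allowed) with edge weights $\sigma:E\to(0,\infty)$. It is plane if it is embedded in the plane with no edges crossing. A path is a sequence of edges $(x_{k-1}x_k)_{k=1}^n$ with $x_0,\dots,x_n$ all distinct; a path from $A$ to $B$ has $x_0\in A$, $x_n\in B$ and no other vertices in $A\cup B$. Modulus. For a family $\Gamma$ of paths, a density $\rho:E\to[0,\infty)$ is admissible if $\ell_\rho(\gamma):=\sum_{e\in\gamma}\rho(e)\ge 1$ for all $\gamma\in\Gamma$, and $\mathrm{Mod}_{2,\sigma}(\Gamma):=\inf\sum_{e\in E}\sigma(e)\rho(e)^2$ over admissible $\rho$. The unique minimizer $\rho^*$ is the extremal density. A subfamily $\tilde\Gamma\subset\Gamma$ is a minimal subfamily for $\Gamma$ if $\mathrm{Mod}_{2,\sigma}(\tilde\Gamma)=\mathrm{Mod}_{2,\sigma}(\Gamma)$ and $\mathrm{Mod}_{2,\sigma}(\tilde\Gamma\setminus\{\gamma\})<\mathrm{Mod}_{2,\sigma}(\Gamma)$ for every $\gamma\in\tilde\Gamma$. Optimal pmf. $\mathcal{P}(\Gamma)$ is the set of pmfs on $\Gamma$. A pmf $\mu\in\mathcal{P}(\Gamma)$ is optimal for $\mathrm{Mod}_{2,\sigma}(\Gamma)$ if it minimizes $\sum_{e\in E}\sigma(e)^{-1}\big(\mathbb{P}_\mu(e\in\underline\gamma)\big)^2$ over $\mathcal{P}(\Gamma)$, where $\underline\gamma$ is a random path with law $\mu$. A pmf on a subfamily is regarded as a pmf on $\Gamma$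 by extending it by zero. Non-crossing paths. Let $F$ be a conformal map from the interior of $\mathcal{C}$ onto a rectangle $(0,L)\times(0,1)$, extended to the boundary, taking $S_1$ to $\{0\}\times[0,1]$ and $S_2$ to $\{L\}\times[0,1]$. For a path $\gamma$ from $A$ to $B$, $F(\gamma)$ splits the strip $\{z:\mathrm{Re}\,z\in[0,L]\}$ into two connected components; $U_\gamma$ is the one containing $-i$. For a subgraph $H$ and a path $\gamma$ in $H$ from $A$ to $B$, $\gamma$ is the top path in $H$ if $F(H)\subset\overline{U_\gamma}$ (isolated vertices of $H$ are disregarded). Two paths from $A$ to $B$ are non-crossing if one of them is the top path in the subgraph formed by the two paths; a family is non-crossing if every pair of its paths is non-crossing. Non-crossing Minimal Subfamily Algorithm. Input: $G$, $A$, $B$ and the extremal density $\rho^*$ for $\mathrm{Mod}_{2,\sigma}\Gamma(A,B)$. Initialize $r(e)=\sigma(e)\rho^*(e)$ for $e\in E$. Iterate: (1) remove from the graph all edges $e$ with $r(e)=0$; (2) if there is one, take the top path $\gamma$ from $A$ to $B$ in the current graph and add it to the growing family $\Gamma$; if there is none, terminate; (3) set $m(\gamma)=\min_{e\in\gamma}r(e)$; (4) replace $r(e)$ by $r(e)-m(\gamma)$ for each $e\in\gamma$; (5) repeat. Output: the family $\Gamma$ and the positive weights $m\in\mathbb{R}^\Gamma_{>0}$.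
   Formalization: Added assumption: edges lying on paths from A to B meet the arcs S_1 and S_2 only in vertices; otherwise, e.g. for a single edge that first runs down along S_1 and then crosses to S_2, no top path exists and the algorithm outputs the empty family. *)

theory Defs
  imports
    "HOL-Complex_Analysis.Complex_Analysis"
    "HOL-Probability.Probability_Mass_Function"
    "HOL-Library.FuncSet"
    "HOL-Library.While_Combinator"
begin

section \<open>Plane networks\<close>

text \<open>
  Vertices are points of the plane and every edge \<open>e\<close> is drawn as the arc \<open>curve G e\<close>. Distinct
  edges may have the same endpoints. The parametrization of the arc plays no role as an orientation:
  an edge may be traversed in both directions. Arcs are injective, which excludes self-loops.
\<close>

record 'e network =
  verts :: "complex set"
  edges :: "'e set"
  curve :: "'e \<Rightarrow> real \<Rightarrow> complex"
  weight :: "'e \<Rightarrow> real"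

definition ends :: "'e network \<Rightarrow> 'e \<Rightarrow> complex set" where
  "ends G e = {pathstart (curve G e), pathfinish (curve G e)}"

definition finite_plane_network :: "'e network \<Rightarrow> bool" where
  "finite_plane_network G \<longleftrightarrow>
     finite (verts G) \<and> finite (edges G) \<and>
     (\<forall>e\<in>edges G. arc (curve G e) \<and> path_image (curve G e) \<inter> verts G = ends G e) \<and>
     (\<forall>e\<in>edges G. \<forall>e'\<in>edges G. e \<noteq> e' \<longrightarrow>
        path_image (curve G e) \<inter> path_image (curve G e') \<subseteq> verts G) \<and>
     (\<forall>e\<in>edges G. 0 < weight G e)"

text \<open>The point set drawn by a set of edges (so isolated vertices are disregarded).\<close>

definition edge_trace :: "'e network \<Rightarrow> 'e set \<Rightarrow> complex set" where
  "edge_trace G H = (\<Union>e\<in>H. path_image (curve G e))"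

definition drawing :: "'e network \<Rightarrow> complex set" where
  "drawing G = verts G \<union> edge_trace G (edges G)"

text \<open>
  A path is a list of edges; \<open>xs\<close> is its list of vertices. For disjoint \<open>A\<close>, \<open>B\<close> the
  vertex list is determined by the edge list of a path from \<open>A\<close> to \<open>B\<close>.
\<close>

definition path_via :: "'e network \<Rightarrow> complex list \<Rightarrow> 'e list \<Rightarrow> bool" where
  "path_via G xs \<gamma> \<longleftrightarrow>
     length xs = Suc (length \<gamma>) \<and> distinct xs \<and> set xs \<subseteq> verts G \<and> set \<gamma> \<subseteq> edges G \<and>
     (\<forall>k<length \<gamma>. ends G (\<gamma> ! k) = {xs ! k, xs ! Suc k})"

definition paths_between :: "'e network \<Rightarrow> complex set \<Rightarrow> complex set \<Rightarrow> 'e list set" where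
  "paths_between G A B =
     {\<gamma>. \<exists>xs. path_via G xs \<gamma> \<and> hd xs \<in> A \<and> last xs \<in> B \<and>
           set xs \<inter> (A \<union> B) = {hd xs, last xs}}"

section \<open>Modulus and optimal pmfs\<close>

definition admissible :: "'e network \<Rightarrow> 'e list set \<Rightarrow> ('e \<Rightarrow> real) set" where
  "admissible G \<Gamma> = {\<rho> \<in> edges G \<rightarrow>\<^sub>E {0..}. \<forall>\<gamma>\<in>\<Gamma>. (\<Sum>e\<in>set \<gamma>. \<rho> e) \<ge> 1}"

definition energy :: "'e network \<Rightarrow> ('e \<Rightarrow> real) \<Rightarrow> real" where
  "energy G \<rho> = (\<Sum>e\<in>edges G. weight G e * (\<rho> e)\<^sup>2)"

definition Mod2 :: "'e network \<Rightarrow> 'e list set \<Rightarrow> real" where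
  "Mod2 G \<Gamma> = (INF \<rho>\<in>admissible G \<Gamma>. energy G \<rho>)"

definition extremal_density :: "'e network \<Rightarrow> 'e list set \<Rightarrow> 'e \<Rightarrow> real" where
  "extremal_density G \<Gamma> = (THE \<rho>. \<rho> \<in> admissible G \<Gamma> \<and> energy G \<rho> = Mod2 G \<Gamma>)"

definition minimal_subfamily :: "'e network \<Rightarrow> 'e list set \<Rightarrow> 'e list set \<Rightarrow> bool" where
  "minimal_subfamily G \<Gamma> \<Gamma>' \<longleftrightarrow>
     \<Gamma>' \<subseteq> \<Gamma> \<and> Mod2 G \<Gamma>' = Mod2 G \<Gamma> \<and> (\<forall>\<gamma>\<in>\<Gamma>'. Mod2 G (\<Gamma>' - {\<gamma>}) < Mod2 G \<Gamma>)"

text \<open>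
  A pmf on a family is a pmf on the type of all edge lists that vanishes outside the family, so
  that extension by zero from a subfamily is implicit.
\<close>

definition pmfs_on :: "'a set \<Rightarrow> 'a pmf set" where
  "pmfs_on \<Gamma> = {\<mu>. set_pmf \<mu> \<subseteq> \<Gamma>}"

definition expected_usage_energy :: "'e network \<Rightarrow> 'e list pmf \<Rightarrow> real" where
  "expected_usage_energy G \<mu> =
     (\<Sum>e\<in>edges G. inverse (weight G e) * (measure_pmf.prob \<mu> {\<gamma>. e \<in> set \<gamma>})\<^sup>2)"

definition optimal_pmf :: "'e network \<Rightarrow> 'e list set \<Rightarrow> 'e list pmf \<Rightarrow> bool" where
  "optimal_pmf G \<Gamma> \<mu> \<longleftrightarrow>
     \<mu> \<in> pmfs_on \<Gamma> \<and>
     (\<forall>\<nu>\<in>pmfs_on \<Gamma>. expected_usage_energy G \<mu> \<le> expected_usage_energy G \<nu>)"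

section \<open>The rectangle picture and non-crossing paths\<close>

definition jordan_curve :: "complex set \<Rightarrow> bool" where
  "jordan_curve C \<longleftrightarrow> (\<exists>c. simple_path c \<and> pathfinish c = pathstart c \<and> path_image c = C)"

definition is_arc :: "complex set \<Rightarrow> bool" where
  "is_arc S \<longleftrightarrow> (\<exists>s. arc s \<and> path_image s = S)"

text \<open>
  The closed outer face is the closure of the unbounded component of the complement of the
  drawing. The drawing may touch the curve.
\<close>

definition encircles :: "complex set \<Rightarrow> 'e network \<Rightarrow> bool" where
  "encircles C G \<longleftrightarrow> drawing G \<subseteq> inside C \<union> C \<and> C \<subseteq> closure (outside (drawing G))"

text \<open>
  \<open>F\<close> is a conformal map of the interior of \<open>C\<close> onto \<open>(0,L) \<times> (0,1)\<close> together with its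
  (Caratheodory) extension to the boundary.
\<close>

definition rectangle_map ::
    "complex set \<Rightarrow> complex set \<Rightarrow> complex set \<Rightarrow> real \<Rightarrow> (complex \<Rightarrow> complex) \<Rightarrow> bool" where
  "rectangle_map C S1 S2 L F \<longleftrightarrow>
     0 < L \<and>
     F holomorphic_on inside C \<and>
     bij_betw F (inside C) (box 0 (Complex L 1)) \<and>
     (\<exists>F'. homeomorphism (inside C \<union> C) (cbox 0 (Complex L 1)) F F') \<and>
     F ` S1 = closed_segment 0 \<i> \<and>
     F ` S2 = closed_segment (Complex L 0) (Complex L 1)"

text \<open>
  That a path splits the strip into two components with the path as their common boundary
  presupposes that the path meets the arcs \<open>S1\<close> and \<open>S2\<close> only in its end vertices: an edge touching
  \<open>S1\<close> in an interior point cuts off a further component, and an edge that starts by running down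
  along \<open>S1\<close> is not in the closure of the lower component.
\<close>

definition strip :: "real \<Rightarrow> complex set" where
  "strip L = {z. 0 \<le> Re z \<and> Re z \<le> L}"

definition lower_component ::
    "'e network \<Rightarrow> real \<Rightarrow> (complex \<Rightarrow> complex) \<Rightarrow> 'e list \<Rightarrow> complex set" where
  "lower_component G L F \<gamma> =
     connected_component_set (strip L - F ` edge_trace G (set \<gamma>)) (- \<i>)"

text \<open>Subgraphs are given by their edge sets \<open>H\<close>.\<close>

definition top_path ::
    "'e network \<Rightarrow> complex set \<Rightarrow> complex set \<Rightarrow> real \<Rightarrow> (complex \<Rightarrow> complex) \<Rightarrow>
     'e set \<Rightarrow> 'e list \<Rightarrow> bool" where
  "top_path G A B L F H \<gamma> \<longleftrightarrow>
     \<gamma> \<in> paths_between G A B \<and> set \<gamma> \<subseteq> H \<and>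
     F ` edge_trace G H \<subseteq> closure (lower_component G L F \<gamma>)"

definition non_crossing ::
    "'e network \<Rightarrow> complex set \<Rightarrow> complex set \<Rightarrow> real \<Rightarrow> (complex \<Rightarrow> complex) \<Rightarrow>
     'e list \<Rightarrow> 'e list \<Rightarrow> bool" where
  "non_crossing G A B L F \<gamma> \<gamma>' \<longleftrightarrow>
     top_path G A B L F (set \<gamma> \<union> set \<gamma>') \<gamma> \<or> top_path G A B L F (set \<gamma> \<union> set \<gamma>') \<gamma>'"

definition non_crossing_family ::
    "'e network \<Rightarrow> complex set \<Rightarrow> complex set \<Rightarrow> real \<Rightarrow> (complex \<Rightarrow> complex) \<Rightarrow>
     'e list set \<Rightarrow> bool" where
  "non_crossing_family G A B L F \<Gamma> \<longleftrightarrow>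
     (\<forall>\<gamma>\<in>\<Gamma>. \<forall>\<gamma>'\<in>\<Gamma>. non_crossing G A B L F \<gamma> \<gamma>')"

definition non_crossing_minimal_subfamily ::
    "'e network \<Rightarrow> complex set \<Rightarrow> complex set \<Rightarrow> real \<Rightarrow> (complex \<Rightarrow> complex) \<Rightarrow>
     'e list set \<Rightarrow> bool" where
  "non_crossing_minimal_subfamily G A B L F \<Gamma> \<longleftrightarrow>
     \<Gamma> \<subseteq> paths_between G A B \<and>
     non_crossing_family G A B L F \<Gamma> \<and>
     (\<exists>\<mu>\<in>pmfs_on \<Gamma>. optimal_pmf G (paths_between G A B) \<mu>) \<and>
     minimal_subfamily G (paths_between G A B) \<Gamma>"

section \<open>The Non-crossing Minimal Subfamily Algorithm\<close>

text \<open>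
  The state consists of the residual \<open>r\<close>, the family \<open>\<Gamma>\<close> and the weights \<open>m\<close> found so far
  (\<open>m\<close> is zero outside \<open>\<Gamma>\<close>). An iteration only changes \<open>r\<close> on edges of the current graph, so an edge
  that has been removed keeps \<open>r e = 0\<close> and the current graph can be read off from \<open>r\<close>.
  The value is \<open>None\<close> if the loop does not terminate.
\<close>

type_synonym 'e nms_state = "('e \<Rightarrow> real) \<times> 'e list set \<times> ('e list \<Rightarrow> real)"

definition current_graph :: "'e network \<Rightarrow> ('e \<Rightarrow> real) \<Rightarrow> 'e set" where
  "current_graph G r = {e \<in> edges G. r e \<noteq> 0}"

definition nms_continue ::
    "'e network \<Rightarrow> complex set \<Rightarrow> complex set \<Rightarrow> real \<Rightarrow> (complex \<Rightarrow> complex) \<Rightarrow>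
     'e nms_state \<Rightarrow> bool" where
  "nms_continue G A B L F = (\<lambda>(r, \<Gamma>, m). \<exists>\<gamma>. top_path G A B L F (current_graph G r) \<gamma>)"

definition nms_step ::
    "'e network \<Rightarrow> complex set \<Rightarrow> complex set \<Rightarrow> real \<Rightarrow> (complex \<Rightarrow> complex) \<Rightarrow>
     'e nms_state \<Rightarrow> 'e nms_state" where
  "nms_step G A B L F = (\<lambda>(r, \<Gamma>, m).
     let \<gamma> = (THE \<gamma>. top_path G A B L F (current_graph G r) \<gamma>);
         c = Min (r ` set \<gamma>)
     in (\<lambda>e. if e \<in> set \<gamma> then r e - c else r e, insert \<gamma> \<Gamma>, m(\<gamma> := c)))"

definition nms_algorithm ::
    "'e network \<Rightarrow> complex set \<Rightarrow> complex set \<Rightarrow> real \<Rightarrow> (complex \<Rightarrow> complex) \<Rightarrow>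
     ('e \<Rightarrow> real) \<Rightarrow> ('e list set \<times> ('e list \<Rightarrow> real)) option" where
  "nms_algorithm G A B L F \<rho> =
     map_option snd
       (while_option (nms_continue G A B L F) (nms_step G A B L F)
          (\<lambda>e. weight G e * \<rho> e, {}, \<lambda>_. 0))"

end

theory Submission
  imports Defs
begin

text \<open>
  By the theta-curve theorem a path from \<open>A\<close> to \<open>B\<close> cuts the strip into a lower and an upper
  component, and it is contained in the closure of both. Hence ``below'' is inclusion of lower
  components, a partial order whose chains are the non-crossing families, and an edge shared by two
  paths of a chain belongs to every path between them.

  For the extremal density \<open>\<rho>\<close>, the flow \<open>\<sigma>\<rho>\<close> is carried by paths of \<open>\<rho>\<close>-length 1, so it runs along
  increasing \<open>\<rho>\<close>-distance from \<open>A\<close>. Among the monotone paths in the support of such a flow, a maximal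
  one is the top path: a flow edge above it could be followed in both directions until it meets the
  path or a terminal, producing a higher monotone path. Peeling off top paths therefore decomposes
  \<open>\<sigma>\<rho>\<close> over a non-crossing family.

  Conversely, every decomposition of \<open>\<sigma>\<rho>\<close> over a non-crossing family with positive weights is the
  output of the algorithm: the top path of the family has an edge of its own, so the minimal residual
  on it is its weight. By duality the optimal pmfs are the normalised decompositions of \<open>\<sigma>\<rho>\<close>, and so
  the determinism of the algorithm yields uniqueness as well as minimality.
\<close>

section \<open>Crosscuts of a strip\<close>

text \<open>All planar topology is condensed into a few facts about lower components:
  \<open>below_iff\<close>, \<open>edges_between\<close> and \<open>edge_on_one_side\<close>. The
  first of them needs the path to be in the closure of both of its sides, so separation alone would
  not be enough. The theta-curve theorem speaks of a bounded domain, which is why the strip is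
  truncated at heights -1 and 2, outside the unit box.

  The obstacle in finding top paths is that pieces of two paths need not join to a path. Orienting
  edges by the distance from \<open>A\<close> removes it: along a directed walk levels increase
  strictly, from 0 on \<open>A\<close> to 1 on \<open>B\<close>, so every directed walk between the
  terminals is a path of length 1.

  The optimal pmf on all paths need not be unique, but its edge usage is: it is a fixed multiple of
  \<sigma>\<rho>. Any subfamily of equal modulus therefore carries a decomposition of this one flow.
  If the subfamily is a chain, its paths of positive weight are what the algorithm returns, which
  leaves no room for a smaller or a different family.\<close>

lemma three_sides:
  fixes a b s L :: real
  assumes "0 < L"
  defines "c \<equiv> linepath (Complex 0 a) (Complex 0 s) +++
                linepath (Complex 0 s) (Complex L s) +++ linepath (Complex L s) (Complex L b)"
  shows three_sides_image: "path_image c =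
           {z. (Re z = 0 \<or> Re z = L \<or> Im z = s) \<and> 0 \<le> Re z \<and> Re z \<le> L \<and>
               (Re z = 0 \<longrightarrow> Im z \<in> closed_segment a s) \<and> (Re z = L \<longrightarrow> Im z \<in> closed_segment b s)}"
    and three_sides_arc: "a \<noteq> s \<Longrightarrow> b \<noteq> s \<Longrightarrow> arc c"
proof -
  show "path_image c =
           {z. (Re z = 0 \<or> Re z = L \<or> Im z = s) \<and> 0 \<le> Re z \<and> Re z \<le> L \<and>
               (Re z = 0 \<longrightarrow> Im z \<in> closed_segment a s) \<and> (Re z = L \<longrightarrow> Im z \<in> closed_segment b s)}"
    using \<open>0 < L\<close> unfolding c_def
    by (auto simp: path_image_join closed_segment_same_Re closed_segment_same_Im
          closed_segment_eq_real_ivl split: if_splits)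
  show "arc c" if "a \<noteq> s" "b \<noteq> s"
    unfolding c_def
    apply (intro arc_join)
    using that \<open>0 < L\<close>
    by (auto simp: path_image_join closed_segment_same_Re closed_segment_same_Im complex_eq_iff)
qed

text \<open>
  One side of a crosscut \<open>g\<close> of the strip: the Jordan domain between \<open>g\<close> and a polygonal arc \<open>c\<close> running
  along the boundary of the strip, together with the closed end \<open>W\<close> of the strip behind \<open>c\<close>.
\<close>

lemma crosscut_side:
  fixes c g :: "real \<Rightarrow> complex"
  assumes g: "arc g" and c: "arc c"
    and ends: "pathstart c = pathstart g" "pathfinish c = pathfinish g"
    and cg: "path_image c \<inter> path_image g = {pathstart g, pathfinish g}"
    and W: "connected W" "closed W" "W \<inter> path_image g = {}" "W \<inter> path_image c \<noteq> {}"
  defines "V \<equiv> inside (path_image c \<union> path_image g) \<union> (path_image c - path_image g) \<union> W"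
  shows "connected V" "path_image g \<subseteq> closure V" "closed (V \<union> path_image g)" "V \<inter> path_image g = {}"
proof -
  define S where "S = inside (path_image c \<union> path_image g)"
  have "simple_path (c +++ reversepath g)"
    using g c ends cg by (auto simp: simple_path_join_loop_eq arc_simple_path simple_path_reversepath arc_reversepath)
  moreover have "pathfinish (c +++ reversepath g) = pathstart (c +++ reversepath g)"
    using ends by simp
  moreover have img: "path_image (c +++ reversepath g) = path_image c \<union> path_image g"
    using ends by (simp add: path_image_join)
  ultimately have J: "connected S" "S \<inter> (path_image c \<union> path_image g) = {}"
      "frontier S = path_image c \<union> path_image g"
    using Jordan_inside_outside[of "c +++ reversepath g"] inside_no_overlap[of "path_image c \<union> path_image g"]
    by (auto simp: S_def)
  have cl: "closure S = S \<union> path_image c \<union> path_image g"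
    using J(3) by (metis closure_Un_frontier sup_assoc)
  have V: "V = S \<union> (path_image c - path_image g) \<union> W"
    by (simp add: V_def S_def)
  have SW: "connected (S \<union> (path_image c - path_image g))"
    using J(1) by (rule connected_intermediate_closure) (auto simp: cl)
  show "connected V"
    unfolding V using W by (intro connected_Un SW) auto
  show "path_image g \<subseteq> closure V"
    using cl closure_mono[of S V] by (auto simp: V)
  have "V \<union> path_image g = closure S \<union> W"
    by (auto simp: V cl)
  then show "closed (V \<union> path_image g)"
    using W(2) by (simp add: closed_Un)
  show "V \<inter> path_image g = {}"
    using J(2) W(3) by (auto simp: V)
qed

text \<open>The lines at heights -1 and 2 cut a rectangle \<open>R\<close> out of the strip. Its
  boundary consists of two arcs \<open>c (-1)\<close> and \<open>c 2\<close> joining the ends of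
  \<open>g\<close>, and with \<open>g\<close> between them they form a theta curve. Each half of
  \<open>R\<close> gets its unbounded end back by \<open>crosscut_side\<close>; the base points lie
  in these ends.\<close>

theorem crosscut_separates_strip:
  fixes g :: "real \<Rightarrow> complex"
  defines "T \<equiv> path_image g"
  assumes g: "arc g" and "0 < L" and T: "T \<subseteq> cbox 0 (Complex L 1)"
    and left: "Re (pathstart g) = 0" "\<And>z. z \<in> T \<Longrightarrow> Re z = 0 \<Longrightarrow> z = pathstart g"
    and right: "Re (pathfinish g) = L" "\<And>z. z \<in> T \<Longrightarrow> Re z = L \<Longrightarrow> z = pathfinish g"
  defines "X \<equiv> {z. 0 \<le> Re z \<and> Re z \<le> L} - T"
  defines "D \<equiv> connected_component_set X (- \<i>)" and "U \<equiv> connected_component_set X (2 * \<i>)"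
  shows "D \<union> U = X" "D \<inter> U = {}" "closed (D \<union> T)" "closed (U \<union> T)" "T \<subseteq> closure D" "T \<subseteq> closure U"
    "- \<i> \<in> D" "2 * \<i> \<in> U"
proof -
  define a b where "a = Im (pathstart g)" and "b = Im (pathfinish g)"
  have st: "pathstart g = Complex 0 a" "pathfinish g = Complex L b"
    using left right by (simp_all add: a_def b_def complex_eq_iff)
  have hk: "Complex 0 a \<in> T" "Complex L b \<in> T"
    using st by (metis T_def pathstart_in_path_image pathfinish_in_path_image)+
  have T': "0 \<le> Re z \<and> Re z \<le> L \<and> 0 \<le> Im z \<and> Im z \<le> 1" if "z \<in> T" for z
    using T that by (auto simp: in_cbox_complex_iff)
  have ab: "0 \<le> a" "a \<le> 1" "0 \<le> b" "b \<le> 1"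
    using T'[OF hk(1)] T'[OF hk(2)] by auto
  define c where "c s = linepath (Complex 0 a) (Complex 0 s) +++
                linepath (Complex 0 s) (Complex L s) +++ linepath (Complex L s) (Complex L b)" for s
  note im = three_sides_image[OF \<open>0 < L\<close>, of a _ b, folded c_def]
  have c_ends: "pathstart (c s) = Complex 0 a" "pathfinish (c s) = Complex L b" for s
    by (simp_all add: c_def)
  have arc_c: "arc (c (-1))" "arc (c 2)"
    using three_sides_arc[OF \<open>0 < L\<close>, of a _ b, folded c_def] ab by auto
  have sides: "closed_segment a (-1) = {-1..a}" "closed_segment b (-1) = {-1..b}"
              "closed_segment a 2 = {a..2}" "closed_segment b 2 = {b..2}"
    using ab by (auto simp: closed_segment_eq_real_ivl)
  \<comment> \<open>Beyond the unit box the horizontal part of \<open>c s\<close> misses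
    \<open>T\<close>, and on the vertical sides \<open>T\<close> has only its end points.\<close>
  have cT: "path_image (c s) \<inter> T = {Complex 0 a, Complex L b}" if "s < 0 \<or> 1 < s" for s
  proof
    show "{Complex 0 a, Complex L b} \<subseteq> path_image (c s) \<inter> T"
      using hk \<open>0 < L\<close> unfolding im by auto
    show "path_image (c s) \<inter> T \<subseteq> {Complex 0 a, Complex L b}"
    proof
      fix z assume z: "z \<in> path_image (c s) \<inter> T"
      then have "Im z \<noteq> s"
        using T'[of z] that by auto
      then have "Re z = 0 \<or> Re z = L"
        using z unfolding im by blast
      then show "z \<in> {Complex 0 a, Complex L b}"
        using z left(2)[of z] right(2)[of z] st by auto
    qed
  qed
  have c12: "path_image (c (-1)) \<inter> path_image (c 2) = {Complex 0 a, Complex L b}"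
    using ab \<open>0 < L\<close> unfolding im sides by (auto simp: complex_eq_iff)
  define R where "R = cbox (Complex 0 (-1)) (Complex L 2)"
  have "path_image (c (-1)) \<union> path_image (c 2) = frontier R"
    using ab \<open>0 < L\<close> unfolding R_def frontier_cbox im sides
    by (auto simp: in_cbox_complex_iff in_box_complex_iff)
  moreover have int: "inside (frontier R) = box (Complex 0 (-1)) (Complex L 2)"
    by (simp add: R_def inside_frontier_eq_interior)
  ultimately have box: "inside (path_image (c (-1)) \<union> path_image (c 2)) = box (Complex 0 (-1)) (Complex L 2)"
    by simp
  \<comment> \<open>The theta-curve theorem asks that the middle arc enter the rectangle: some point
    of \<open>T\<close> has real part L/2.\<close>
  have "T \<inter> box (Complex 0 (-1)) (Complex L 2) \<noteq> {}"
  proof -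
    have "connected T"
      using g by (simp add: T_def connected_arc_image)
    then have "is_interval (Re ` T)"
      by (simp add: is_interval_connected_1 connected_continuous_image continuous_intros)
    moreover have "0 \<in> Re ` T" "L \<in> Re ` T"
      using hk by force+
    ultimately have "L / 2 \<in> Re ` T"
      using mem_is_interval_1_I[of "Re ` T" 0 L "L / 2"] \<open>0 < L\<close> by simp
    then obtain z where "z \<in> T" "Re z = L / 2" by force
    then have "z \<in> T \<inter> box (Complex 0 (-1)) (Complex L 2)"
      using T'[of z] \<open>0 < L\<close> by (simp add: in_box_complex_iff)
    then show ?thesis by blast
  qed
  then have theta: "inside (path_image (c (-1)) \<union> T) \<inter> inside (path_image (c 2) \<union> T) = {}"
    "inside (path_image (c (-1)) \<union> T) \<union> inside (path_image (c 2) \<union> T) \<union> (T - {Complex 0 a, Complex L b})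
      = box (Complex 0 (-1)) (Complex L 2)"
    using split_inside_simple_closed_curve[of "c (-1)" "Complex 0 a" "Complex L b" "c 2" g]
      arc_c g c_ends st cT[of "-1"] cT[of 2] c12 box \<open>0 < L\<close>
    unfolding T_def by (auto simp: arc_imp_simple_path)
  define W where "W s = {z. 0 \<le> Re z \<and> Re z \<le> L \<and> (if s < 0 then Im z \<le> s else s \<le> Im z)}" for s :: real
  have conv: "convex (W s)" "closed (W s)" for s
  proof -
    have W_eq: "W s = {z. 0 \<le> Re z} \<inter> {z. Re z \<le> L} \<inter> (if s < 0 then {z. Im z \<le> s} else {z. s \<le> Im z})"
      by (auto simp: W_def)
    show "convex (W s)" "closed (W s)"
      unfolding W_eq by (auto intro!: convex_Int convex_halfspace_Re_ge convex_halfspace_Re_le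
          convex_halfspace_Im_ge convex_halfspace_Im_le closed_Int closed_halfspace_Re_ge closed_halfspace_Re_le
          closed_halfspace_Im_ge closed_halfspace_Im_le)
  qed
  have WT: "W s \<inter> T = {}" if "s < 0 \<or> 1 < s" for s
    using T' that by (force simp: W_def)
  have corner: "Complex 0 s \<in> W s \<inter> path_image (c s)" for s
    using \<open>0 < L\<close> unfolding im by (auto simp: W_def)
  define V where "V s = inside (path_image (c s) \<union> T) \<union> (path_image (c s) - T) \<union> W s" for s
  have V: "connected (V s)" "T \<subseteq> closure (V s)" "closed (V s \<union> T)" "V s \<inter> T = {}" if "s = -1 \<or> s = 2" for s
  proof -
    have "arc (c s)" "s < 0 \<or> 1 < s"
      using that arc_c by auto
    then have "arc (c s)" "pathstart (c s) = pathstart g" "pathfinish (c s) = pathfinish g"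
      "path_image (c s) \<inter> path_image g = {pathstart g, pathfinish g}"
      "connected (W s)" "closed (W s)" "W s \<inter> path_image g = {}" "W s \<inter> path_image (c s) \<noteq> {}"
      using c_ends st cT[of s] conv[of s] WT[of s] corner[of s] convex_connected
      unfolding T_def by auto
    from crosscut_side[OF g this] show "connected (V s)" "T \<subseteq> closure (V s)" "closed (V s \<union> T)" "V s \<inter> T = {}"
      unfolding V_def T_def by blast+
  qed
  have strip: "V (-1) \<union> V 2 = X"
  proof -
    have "V s = (inside (path_image (c s) \<union> T) \<union> path_image (c s) \<union> W s) - T" if "s = -1 \<or> s = 2" for s
    proof -
      have "T \<inter> inside (path_image (c s) \<union> T) = {}"
        by (metis Int_Un_distrib2 Un_empty inf_commute inside_no_overlap)
      then show ?thesis
        using WT[of s] that unfolding V_def by auto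
    qed
    then have "V (-1) \<union> V 2 =
        (inside (path_image (c (-1)) \<union> T) \<union> inside (path_image (c 2) \<union> T) \<union> (T - {Complex 0 a, Complex L b}))
        \<union> (path_image (c (-1)) \<union> path_image (c 2)) \<union> W (-1) \<union> W 2 - T"
      by auto
    then have 1: "V (-1) \<union> V 2 = (box (Complex 0 (-1)) (Complex L 2) \<union> frontier R \<union> W (-1) \<union> W 2) - T"
      by (simp only: theta(2) \<open>path_image (c (-1)) \<union> path_image (c 2) = frontier R\<close>)
    have "box (Complex 0 (-1)) (Complex L 2) \<union> frontier R \<union> W (-1) \<union> W 2 = {z. 0 \<le> Re z \<and> Re z \<le> L}"
      using \<open>0 < L\<close> unfolding R_def frontier_cbox W_def
      by (auto simp: in_box_complex_iff in_cbox_complex_iff)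
    with 1 show ?thesis by (simp add: X_def)
  qed
  have disj: "V (-1) \<inter> V 2 = {}"
  proof -
    have I: "inside (path_image (c (-1)) \<union> T) \<subseteq> box (Complex 0 (-1)) (Complex L 2)"
         "inside (path_image (c 2) \<union> T) \<subseteq> box (Complex 0 (-1)) (Complex L 2)"
      using theta(2) by blast+
    have bc: "box (Complex 0 (-1)) (Complex L 2) \<inter> (path_image (c s) \<union> W s) = {}" if "s = -1 \<or> s = 2" for s
      using that unfolding im by (auto simp: in_box_complex_iff W_def)
    have "inside (path_image (c (-1)) \<union> T) \<inter> (path_image (c 2) \<union> W 2) = {}"
         "inside (path_image (c 2) \<union> T) \<inter> (path_image (c (-1)) \<union> W (-1)) = {}"
      using I bc[of "-1"] bc[of 2] by auto
    moreover have "(path_image (c (-1)) - T) \<inter> (path_image (c 2) - T) = {}"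
    proof -
      have "path_image (c (-1)) \<inter> path_image (c 2) \<subseteq> T"
        using c12 hk by simp
      then show ?thesis by blast
    qed
    moreover have "W (-1) \<inter> path_image (c 2) = {}" "W 2 \<inter> path_image (c (-1)) = {}" "W (-1) \<inter> W 2 = {}"
      using ab unfolding im sides by (auto simp: W_def)
    ultimately show ?thesis
      using theta(1) unfolding V_def by blast
  qed
  have mem: "- \<i> \<in> V (-1)" "2 * \<i> \<in> V 2"
    using \<open>0 < L\<close> by (auto simp: V_def W_def)
  have comp: "connected_component_set X x = V s" if "s = -1 \<or> s = 2" "x \<in> V s" for s x
  proof -
    \<comment> \<open>\<open>1 - s\<close> exchanges -1 and 2, so both components are treated at
      once.\<close>
    define s' where "s' = 1 - s"
    have s': "s' = -1 \<or> s' = 2" "V s \<union> V s' = X" "V s \<inter> V s' = {}"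
      using that strip disj by (auto simp: s'_def)
    have "V s \<subseteq> connected_component_set X x"
      using that s' V(1) by (intro connected_component_maximal) auto
    \<comment> \<open>Within \<open>X\<close> the closed sets \<open>V s \<union> T\<close> and
      \<open>V s' \<union> T\<close> are disjoint, so no connected subset of \<open>X\<close> meets
      both.\<close>
    moreover have "connected_component_set X x \<inter> V s' = {}"
    proof (rule ccontr)
      let ?K = "connected_component_set X x"
      assume "?K \<inter> V s' \<noteq> {}"
      moreover have "?K \<subseteq> X" by (rule connected_component_subset)
      moreover have "T \<inter> X = {}" by (auto simp: X_def)
      ultimately show False
        using connected_closedD[OF connected_connected_component[of X x], of "V s \<union> T" "V s' \<union> T"]
          V(3)[of s] V(3)[of s'] that s' \<open>V s \<subseteq> ?K\<close> by blast
    qed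
    ultimately show ?thesis
      using s'(2) connected_component_subset[of X x] by blast
  qed
  have "D = V (-1)" "U = V 2"
    using comp mem unfolding D_def U_def by blast+
  then show "D \<union> U = X" "D \<inter> U = {}" "closed (D \<union> T)" "closed (U \<union> T)" "T \<subseteq> closure D" "T \<subseteq> closure U"
      "- \<i> \<in> D" "2 * \<i> \<in> U"
    using V strip disj mem by auto
qed

section \<open>Modulus and optimal path distributions\<close>

abbreviation usage :: "'e list pmf \<Rightarrow> 'e \<Rightarrow> real" where
  "usage \<mu> e \<equiv> measure_pmf.prob \<mu> {\<gamma>. e \<in> set \<gamma>}"

lemma usage_eq_sum:
  assumes "finite \<Gamma>" "\<mu> \<in> pmfs_on \<Gamma>"
  shows "usage \<mu> e = (\<Sum>\<gamma>\<in>\<Gamma>. pmf \<mu> \<gamma> * of_bool (e \<in> set \<gamma>))"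
proof -
  have "usage \<mu> e = measure_pmf.prob \<mu> (\<Gamma> \<inter> {\<gamma>. e \<in> set \<gamma>})"
    using assms(2) by (intro measure_prob_cong_0) (auto simp: pmfs_on_def set_pmf_eq)
  also have "\<dots> = (\<Sum>\<gamma>\<in>\<Gamma>. pmf \<mu> \<gamma> * of_bool (e \<in> set \<gamma>))"
    using assms(1) by (simp add: measure_measure_pmf_finite sum.inter_filter of_bool_def Int_def
        if_distrib cong: if_cong)
  finally show ?thesis .
qed

lemma exists_pmf_with_weights:
  fixes f :: "'a \<Rightarrow> real"
  assumes "finite \<Gamma>" "\<And>x. 0 \<le> f x" "\<And>x. x \<notin> \<Gamma> \<Longrightarrow> f x = 0" "sum f \<Gamma> = 1"
  shows "\<exists>\<mu>\<in>pmfs_on \<Gamma>. \<forall>x. pmf \<mu> x = f x"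
proof -
  have "(\<integral>\<^sup>+x. ennreal (f x) \<partial>count_space UNIV) = (\<Sum>x\<in>\<Gamma>. ennreal (f x))"
    using assms by (intro nn_integral_count_space'[OF assms(1)]) auto
  also have "\<dots> = 1"
    using assms by (simp add: sum_ennreal)
  finally have *: "(\<integral>\<^sup>+x. ennreal (f x) \<partial>count_space UNIV) = 1" .
  have "pmf (embed_pmf f) x = f x" for x
    using pmf_embed_pmf[OF assms(2) *] .
  moreover have "embed_pmf f \<in> pmfs_on \<Gamma>"
    using set_embed_pmf[OF assms(2) *] assms(3) by (auto simp: pmfs_on_def)
  ultimately show ?thesis by blast
qed

lemma usage_pos:
  assumes "\<gamma> \<in> set_pmf \<mu>" "e \<in> set \<gamma>"
  shows "0 < usage \<mu> e"
proof -
  have "pmf \<mu> \<gamma> \<le> usage \<mu> e"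
    using assms(2) by (subst measure_pmf_single[symmetric]) (rule measure_pmf.finite_measure_mono, auto)
  then show ?thesis
    using pmf_positive[OF assms(1)] by linarith
qed

text \<open>Exchanging the order of summation: pairing a density with the load of weighted paths
  gives the weighted total of path lengths. Weak duality, tightness and the total mass of a
  decomposition all rest on it.\<close>

lemma sum_over_paths_swap:
  fixes f :: "'e \<Rightarrow> real" and m :: "'e list \<Rightarrow> real"
  assumes "finite E" "\<And>\<gamma>. \<gamma> \<in> \<Gamma> \<Longrightarrow> set \<gamma> \<subseteq> E"
  shows "(\<Sum>e\<in>E. f e * (\<Sum>\<gamma>\<in>\<Gamma>. m \<gamma> * of_bool (e \<in> set \<gamma>))) = (\<Sum>\<gamma>\<in>\<Gamma>. m \<gamma> * (\<Sum>e\<in>set \<gamma>. f e))"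
proof -
  have "(\<Sum>e\<in>E. f e * (\<Sum>\<gamma>\<in>\<Gamma>. m \<gamma> * of_bool (e \<in> set \<gamma>)))
      = (\<Sum>\<gamma>\<in>\<Gamma>. \<Sum>e\<in>E. m \<gamma> * (f e * of_bool (e \<in> set \<gamma>)))"
    by (subst sum.swap) (simp add: sum_distrib_left mult_ac)
  also have "\<dots> = (\<Sum>\<gamma>\<in>\<Gamma>. m \<gamma> * (\<Sum>e\<in>set \<gamma>. f e))"
  proof (rule sum.cong)
    fix \<gamma> assume "\<gamma> \<in> \<Gamma>"
    then have "E \<inter> {e. e \<in> set \<gamma>} = set \<gamma>"
      using assms(2) by auto
    then have "(\<Sum>e\<in>E. f e * of_bool (e \<in> set \<gamma>)) = (\<Sum>e\<in>set \<gamma>. f e)"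
      using sum.inter_restrict[OF assms(1), of f "set \<gamma>"] by (simp add: of_bool_def if_distrib cong: if_cong)
    then show "(\<Sum>e\<in>E. m \<gamma> * (f e * of_bool (e \<in> set \<gamma>))) = m \<gamma> * (\<Sum>e\<in>set \<gamma>. f e)"
      by (simp flip: sum_distrib_left)
  qed simp
  finally show ?thesis .
qed

text \<open>The setting of the duality theory, free of geometry. Empty paths are excluded because
  their length is 0, which no density can make admissible, and because they would allow an expected
  usage of 0.\<close>

locale path_family =
  fixes G :: "'e network" and P :: "'e list set"
  assumes finite_edges: "finite (edges G)"
    and weight_pos: "\<And>e. e \<in> edges G \<Longrightarrow> 0 < weight G e"
    and finite_paths: "finite P"
    and paths_edges: "\<And>\<gamma>. \<gamma> \<in> P \<Longrightarrow> set \<gamma> \<subseteq> edges G"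
    and nontrivial: "\<And>\<gamma>. \<gamma> \<in> P \<Longrightarrow> \<gamma> \<noteq> []"
begin

lemma subfamily: "\<Gamma> \<subseteq> P \<Longrightarrow> path_family G \<Gamma>"
  using path_family_axioms unfolding path_family_def by (auto intro: finite_subset)

lemma sum_usage:
  assumes "\<mu> \<in> pmfs_on P"
  shows "(\<Sum>e\<in>edges G. f e * usage \<mu> e) = (\<Sum>\<gamma>\<in>P. pmf \<mu> \<gamma> * (\<Sum>e\<in>set \<gamma>. f e))"
  using sum_over_paths_swap[OF finite_edges paths_edges, of P f "pmf \<mu>"]
  by (simp add: usage_eq_sum[OF finite_paths assms])

text \<open>A continuous function attains its minimum on the compact simplex of probability
  weights.\<close>

lemma exists_optimal_pmf:
  assumes "P \<noteq> {}"
  shows "\<exists>\<mu>. optimal_pmf G P \<mu>"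
proof -
  \<comment> \<open>Coordinates outside \<open>P\<close> are pinned to 0, so \<open>K\<close> is a
    closed part of a product of compact sets indexed by all edge lists, and Tychonoff
    applies.\<close>
  define K where "K = {m :: 'e list \<Rightarrow> real. (\<forall>\<gamma>. m \<gamma> \<in> (if \<gamma> \<in> P then {0..1} else {0})) \<and> sum m P = 1}"
  define g where "g m = (\<Sum>e\<in>edges G. inverse (weight G e) * (\<Sum>\<gamma>\<in>P. m \<gamma> * of_bool (e \<in> set \<gamma>))\<^sup>2)"
    for m :: "'e list \<Rightarrow> real"
  have "compact (Pi\<^sub>E UNIV (\<lambda>\<gamma>. if \<gamma> \<in> P then {0..1} else {0 :: real}))"
    using compactin_PiE[of "\<lambda>_. euclidean" UNIV "\<lambda>\<gamma>. if \<gamma> \<in> P then {0..1} else {0 :: real}"]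
    by (simp add: euclidean_product_topology)
  moreover have "closed {m :: 'e list \<Rightarrow> real. sum m P = 1}"
    by (intro closed_Collect_eq continuous_on_sum continuous_on_product_coordinates continuous_intros)
  ultimately have "compact (Pi\<^sub>E UNIV (\<lambda>\<gamma>. if \<gamma> \<in> P then {0..1} else {0 :: real}) \<inter> {m. sum m P = 1})"
    by (rule compact_Int_closed)
  also have "Pi\<^sub>E UNIV (\<lambda>\<gamma>. if \<gamma> \<in> P then {0..1} else {0 :: real}) \<inter> {m. sum m P = 1} = K"
    unfolding K_def PiE_UNIV_domain Pi_def by fast
  finally have "compact K" .
  moreover have "continuous_on K g"
    unfolding g_def
    by (intro continuous_intros continuous_on_subset[OF continuous_on_product_coordinates]) auto
  moreover from assms obtain \<gamma> where "\<gamma> \<in> P" by blast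
  then have "(\<lambda>\<delta>. of_bool (\<delta> = \<gamma>)) \<in> K"
    using finite_paths by (auto simp: K_def)
  ultimately obtain m where m: "m \<in> K" "\<And>m'. m' \<in> K \<Longrightarrow> g m \<le> g m'"
    using continuous_attains_inf[of K g] by blast
  have "0 \<le> m x" "x \<notin> P \<Longrightarrow> m x = 0" for x
    using m(1) by (auto simp: K_def split: if_splits)
  moreover have "sum m P = 1"
    using m(1) by (simp add: K_def)
  ultimately obtain \<mu> where \<mu>: "\<mu> \<in> pmfs_on P" "\<And>x. pmf \<mu> x = m x"
    using exists_pmf_with_weights[OF finite_paths, of m] by blast
  have energy: "expected_usage_energy G \<nu> = g (pmf \<nu>)" if "\<nu> \<in> pmfs_on P" for \<nu>
    by (simp add: expected_usage_energy_def g_def usage_eq_sum[OF finite_paths that])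
  have "pmf \<nu> \<in> K" if "\<nu> \<in> pmfs_on P" for \<nu>
    using that sum_pmf_eq_1[OF finite_paths, of \<nu>]
    by (auto simp: K_def pmfs_on_def pmf_le_1 set_pmf_eq)
  moreover have "pmf \<mu> = m"
    by (rule ext) (rule \<mu>(2))
  ultimately have "optimal_pmf G P \<mu>"
    using m(2) \<mu>(1) by (simp add: optimal_pmf_def energy)
  then show ?thesis ..
qed

section \<open>Convex duality between modulus and expected edge usage\<close>

lemma expected_usage_energy_pos:
  assumes "\<mu> \<in> pmfs_on P"
  shows "0 < expected_usage_energy G \<mu>"
proof -
  obtain \<gamma> where \<gamma>: "\<gamma> \<in> set_pmf \<mu>"
    using set_pmf_not_empty[of \<mu>] by blast
  then have "\<gamma> \<in> P"
    using assms by (auto simp: pmfs_on_def)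
  then obtain e where e: "e \<in> set \<gamma>" "e \<in> edges G"
    using nontrivial paths_edges by (metis list.set_intros(1) neq_Nil_conv subsetD)
  from usage_pos[OF \<gamma> e(1)] have "0 < inverse (weight G e) * (usage \<mu> e)\<^sup>2"
    using weight_pos[OF e(2)] by simp
  moreover have "0 \<le> inverse (weight G e) * (usage \<mu> e)\<^sup>2" if "e \<in> edges G" for e
    using weight_pos[OF that] by simp
  ultimately show ?thesis
    unfolding expected_usage_energy_def by (intro sum_pos2[OF finite_edges e(2)])
qed

text \<open>The first-order optimality condition, from moving mass \<open>t\<close> towards a single path.\<close>

lemma optimal_usage_length:
  assumes opt: "optimal_pmf G P \<mu>" and "\<delta> \<in> P"
  shows "expected_usage_energy G \<mu> \<le> (\<Sum>e\<in>set \<delta>. usage \<mu> e / weight G e)"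
proof (rule ccontr)
  define \<eta> where "\<eta> e = usage \<mu> e" for e
  define S where "S = (\<Sum>e\<in>edges G. inverse (weight G e) * (\<eta> e * of_bool (e \<in> set \<delta>)))"
  define C where "C = (\<Sum>e\<in>edges G. inverse (weight G e) * (of_bool (e \<in> set \<delta>) - \<eta> e)\<^sup>2)"
  define X where "X = expected_usage_energy G \<mu>"
  have \<mu>: "\<mu> \<in> pmfs_on P"
    using opt by (simp add: optimal_pmf_def)
  have X: "X = (\<Sum>e\<in>edges G. inverse (weight G e) * (\<eta> e)\<^sup>2)"
    by (simp add: X_def expected_usage_energy_def \<eta>_def)
  have "edges G \<inter> set \<delta> = set \<delta>"
    using paths_edges[OF \<open>\<delta> \<in> P\<close>] by auto
  then have S: "S = (\<Sum>e\<in>set \<delta>. usage \<mu> e / weight G e)"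
    using sum.inter_restrict[OF finite_edges, of "\<lambda>e. usage \<mu> e / weight G e" "set \<delta>"]
    by (simp add: S_def \<eta>_def of_bool_def if_distrib divide_inverse mult_ac cong: if_cong)
  \<comment> \<open>\<open>\<nu>\<close> is (1 - t) times \<open>\<mu>\<close> plus mass t at
    \<open>\<delta>\<close>. Its energy is X + 2t(S - X) + t^2 C, and minimality of X allows
    division by t.\<close>
  have bound: "2 * (X - S) \<le> t * C" if t: "0 < t" "t \<le> 1" for t
  proof -
    define f where "f x = (1 - t) * pmf \<mu> x + t * of_bool (x = \<delta>)" for x
    have "sum f P = 1"
      using sum_pmf_eq_1[OF finite_paths, of \<mu>] \<mu> \<open>\<delta> \<in> P\<close> finite_paths
      by (simp add: f_def sum.distrib pmfs_on_def flip: sum_distrib_left)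
    moreover have "0 \<le> f x" "x \<notin> P \<Longrightarrow> f x = 0" for x
      using t \<mu> \<open>\<delta> \<in> P\<close> by (auto simp: f_def pmfs_on_def set_pmf_eq)
    ultimately obtain \<nu> where \<nu>: "\<nu> \<in> pmfs_on P" "\<And>x. pmf \<nu> x = f x"
      using exists_pmf_with_weights[OF finite_paths, of f] by blast
    have "usage \<nu> e = (1 - t) * \<eta> e + t * of_bool (e \<in> set \<delta>)" for e
    proof -
      have "usage \<nu> e = (\<Sum>\<gamma>\<in>P. (1 - t) * (pmf \<mu> \<gamma> * of_bool (e \<in> set \<gamma>)) + t * (of_bool (\<gamma> = \<delta>) * of_bool (e \<in> set \<gamma>)))"
        by (simp add: usage_eq_sum[OF finite_paths \<nu>(1)] \<nu>(2) f_def algebra_simps)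
      also have "\<dots> = (1 - t) * \<eta> e + t * (\<Sum>\<gamma>\<in>P. of_bool (\<gamma> = \<delta>) * of_bool (e \<in> set \<gamma>))"
        by (simp add: sum.distrib \<eta>_def usage_eq_sum[OF finite_paths \<mu>] sum_distrib_left)
      also have "(\<Sum>\<gamma>\<in>P. of_bool (\<gamma> = \<delta>) * of_bool (e \<in> set \<gamma>)) = (of_bool (e \<in> set \<delta>) :: real)"
        using finite_paths \<open>\<delta> \<in> P\<close> by (subst sum.remove[of _ \<delta>]) (auto intro: sum.neutral)
      finally show ?thesis .
    qed
    note usage_\<nu> = this
    have "expected_usage_energy G \<nu> =
        (\<Sum>e\<in>edges G. inverse (weight G e) * (\<eta> e)\<^sup>2
          + 2 * t * (inverse (weight G e) * (\<eta> e * of_bool (e \<in> set \<delta>)) - inverse (weight G e) * (\<eta> e)\<^sup>2)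
          + t\<^sup>2 * (inverse (weight G e) * (of_bool (e \<in> set \<delta>) - \<eta> e)\<^sup>2))"
      unfolding expected_usage_energy_def usage_\<nu>
      by (intro sum.cong) (auto simp: power2_eq_square algebra_simps)
    also have "\<dots> = X + 2 * t * (S - X) + t\<^sup>2 * C"
      by (simp add: sum.distrib sum_subtractf X S_def C_def flip: sum_distrib_left)
    finally have "X \<le> X + 2 * t * (S - X) + t\<^sup>2 * C"
      using opt \<nu>(1) by (metis X_def optimal_pmf_def)
    then have "0 \<le> t * (2 * (S - X) + t * C)"
      by (simp add: algebra_simps power2_eq_square)
    then show ?thesis
      using t by (simp add: zero_le_mult_iff)
  qed
  assume "\<not> ?thesis"
  then have pos: "0 < X - S"
    by (simp add: X_def S)
  then have "0 < C" "X - S \<le> C"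
    using bound[of 1] by auto
  \<comment> \<open>The choice t = (X - S)/C gives 2(X - S) \<le> X - S. The case t = 1 has shown
    that this t is at most 1.\<close>
  then have "2 * (X - S) \<le> (X - S) / C * C"
    using pos by (intro bound) auto
  then show False
    using pos \<open>0 < C\<close> by simp
qed

text \<open>The density proportional to usage over weight, scaled so that
  \<open>optimal_usage_length\<close> gives every path length at least 1. It is undefined off the
  edges because admissible densities are extensional.\<close>

definition dual_density :: "'e list pmf \<Rightarrow> 'e \<Rightarrow> real" where
  "dual_density \<mu> = (\<lambda>e\<in>edges G. usage \<mu> e / (weight G e * expected_usage_energy G \<mu>))"

lemma dual_density_admissible:
  assumes opt: "optimal_pmf G P \<mu>"
  shows "dual_density \<mu> \<in> admissible G P"
proof -
  have pos: "0 < expected_usage_energy G \<mu>"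
    using opt expected_usage_energy_pos by (simp add: optimal_pmf_def)
  have "1 \<le> (\<Sum>e\<in>set \<gamma>. dual_density \<mu> e)" if "\<gamma> \<in> P" for \<gamma>
  proof -
    have "(\<Sum>e\<in>set \<gamma>. dual_density \<mu> e) = (\<Sum>e\<in>set \<gamma>. usage \<mu> e / weight G e) / expected_usage_energy G \<mu>"
      using paths_edges[OF that] unfolding sum_divide_distrib
      by (intro sum.cong) (auto simp: dual_density_def)
    then show ?thesis
      using optimal_usage_length[OF opt that] pos by simp
  qed
  moreover have "dual_density \<mu> \<in> edges G \<rightarrow>\<^sub>E {0..}"
    using weight_pos pos by (auto simp: dual_density_def less_imp_le)
  ultimately show ?thesis
    by (simp add: admissible_def)
qed

text \<open>The energy of the difference on the left-hand side gives uniqueness of the extremal density.\<close>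

lemma energy_dual_density:
  assumes opt: "optimal_pmf G P \<mu>"
  shows "energy G (dual_density \<mu>) = 1 / expected_usage_energy G \<mu>"
    and "\<rho> \<in> admissible G P \<Longrightarrow>
      1 / expected_usage_energy G \<mu> + energy G (\<lambda>e. \<rho> e - dual_density \<mu> e) \<le> energy G \<rho>"
proof -
  define X where "X = expected_usage_energy G \<mu>"
  have \<mu>: "\<mu> \<in> pmfs_on P" and pos: "0 < X"
    using opt expected_usage_energy_pos by (simp_all add: optimal_pmf_def X_def)
  have "energy G (dual_density \<mu>) = (\<Sum>e\<in>edges G. inverse (weight G e) * (usage \<mu> e)\<^sup>2) / X\<^sup>2"
    unfolding energy_def sum_divide_distrib
    using weight_pos by (intro sum.cong) (auto simp: dual_density_def X_def[symmetric] field_simps power2_eq_square)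
  also have "\<dots> = X / X\<^sup>2"
    by (simp add: X_def expected_usage_energy_def)
  finally show dual: "energy G (dual_density \<mu>) = 1 / expected_usage_energy G \<mu>"
    using pos by (simp add: X_def[symmetric] power2_eq_square)
  assume \<rho>: "\<rho> \<in> admissible G P"
  \<comment> \<open>Averaging the constraints over \<open>\<mu>\<close> shows that the weighted
    inner product of \<open>\<rho>\<close> with \<open>dual_density \<mu>\<close> is at least 1/X,
    the squared norm of the latter.\<close>
  have "1 = (\<Sum>\<gamma>\<in>P. pmf \<mu> \<gamma> * 1)"
    using sum_pmf_eq_1[OF finite_paths, of \<mu>] \<mu> by (simp add: pmfs_on_def)
  also have "\<dots> \<le> (\<Sum>\<gamma>\<in>P. pmf \<mu> \<gamma> * (\<Sum>e\<in>set \<gamma>. \<rho> e))"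
    using \<rho> by (intro sum_mono mult_left_mono) (auto simp: admissible_def)
  also have "\<dots> = (\<Sum>e\<in>edges G. \<rho> e * usage \<mu> e)"
    by (simp add: sum_usage[OF \<mu>])
  also have "\<dots> = X * (\<Sum>e\<in>edges G. weight G e * (\<rho> e * dual_density \<mu> e))"
    unfolding sum_distrib_left using pos
    by (intro sum.cong) (auto simp: dual_density_def X_def[symmetric] dest: weight_pos)
  finally have "1 / X \<le> (\<Sum>e\<in>edges G. weight G e * (\<rho> e * dual_density \<mu> e))"
    using pos by (simp add: field_simps)
  moreover have "energy G (\<lambda>e. \<rho> e - dual_density \<mu> e) =
      (\<Sum>e\<in>edges G. weight G e * (\<rho> e)\<^sup>2 - 2 * (weight G e * (\<rho> e * dual_density \<mu> e)) + weight G e * (dual_density \<mu> e)\<^sup>2)"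
    unfolding energy_def by (intro sum.cong) (auto simp: power2_eq_square algebra_simps)
  then have "energy G (\<lambda>e. \<rho> e - dual_density \<mu> e) = energy G \<rho> -
      2 * (\<Sum>e\<in>edges G. weight G e * (\<rho> e * dual_density \<mu> e)) + energy G (dual_density \<mu>)"
    by (simp add: sum.distrib sum_subtractf energy_def flip: sum_distrib_left)
  ultimately show "1 / expected_usage_energy G \<mu> + energy G (\<lambda>e. \<rho> e - dual_density \<mu> e) \<le> energy G \<rho>"
    using dual by (simp add: X_def)
qed

lemma energy_nonneg: "0 \<le> energy G \<rho>"
  unfolding energy_def using weight_pos by (intro sum_nonneg) (simp add: less_imp_le)

lemma energy_eq_0: "energy G \<rho> = 0 \<Longrightarrow> e \<in> edges G \<Longrightarrow> \<rho> e = 0"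
  using sum_nonneg_eq_0_iff[OF finite_edges, of "\<lambda>e. weight G e * (\<rho> e)\<^sup>2"] weight_pos
  unfolding energy_def by (smt (verit, best) mult_eq_0_iff mult_nonneg_nonneg zero_le_power2 power2_eq_square)

text \<open>\<open>dual_density \<mu>\<close> attains the lower bound, and a second minimiser would
  be at zero energy distance from it; positive weights make that equality on all edges.\<close>

lemma Mod2_dual:
  assumes opt: "optimal_pmf G P \<mu>"
  shows "Mod2 G P = 1 / expected_usage_energy G \<mu>"
    and "extremal_density G P = dual_density \<mu>"
proof -
  have le: "1 / expected_usage_energy G \<mu> \<le> energy G \<rho>" if "\<rho> \<in> admissible G P" for \<rho>
    using energy_dual_density(2)[OF opt that] energy_nonneg[of "\<lambda>e. \<rho> e - dual_density \<mu> e"] by linarith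
  show M: "Mod2 G P = 1 / expected_usage_energy G \<mu>"
    unfolding Mod2_def using dual_density_admissible[OF opt] energy_dual_density(1)[OF opt] le
    by (intro cInf_eq_minimum) force+
  show "extremal_density G P = dual_density \<mu>"
    unfolding extremal_density_def
  proof (rule the_equality)
    show "dual_density \<mu> \<in> admissible G P \<and> energy G (dual_density \<mu>) = Mod2 G P"
      using M dual_density_admissible[OF opt] energy_dual_density(1)[OF opt] by simp
    fix \<rho> assume \<rho>: "\<rho> \<in> admissible G P \<and> energy G \<rho> = Mod2 G P"
    then have "energy G (\<lambda>e. \<rho> e - dual_density \<mu> e) = 0"
      using energy_dual_density(2)[OF opt, of \<rho>] M energy_nonneg[of "\<lambda>e. \<rho> e - dual_density \<mu> e"] by simp
    then have "\<rho> e = dual_density \<mu> e" if "e \<in> edges G" for e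
      using energy_eq_0[OF _ that] by fastforce
    moreover have "\<rho> \<in> extensional (edges G)" "dual_density \<mu> \<in> extensional (edges G)"
      using \<rho> by (auto simp: admissible_def PiE_def dual_density_def)
    ultimately show "\<rho> = dual_density \<mu>"
      by (intro extensionalityI)
  qed
qed

lemma Mod2_pos: "P \<noteq> {} \<Longrightarrow> 0 < Mod2 G P"
  using exists_optimal_pmf Mod2_dual expected_usage_energy_pos by (fastforce simp: optimal_pmf_def)

text \<open>Since \<open>\<mu>\<close> does not occur on the right, all optimal pmfs share their
  edge usage. Optimality thus becomes a statement about decomposing one fixed flow.\<close>

lemma optimal_usage:
  assumes opt: "optimal_pmf G P \<mu>" and "e \<in> edges G"
  shows "Mod2 G P * usage \<mu> e = weight G e * extremal_density G P e"
  using Mod2_dual[OF opt] weight_pos[OF assms(2)] assms(2) by (simp add: dual_density_def)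

lemma optimal_pmf_flow:
  assumes opt: "optimal_pmf G P \<mu>" and "\<Gamma> \<subseteq> P" "\<mu> \<in> pmfs_on \<Gamma>" "e \<in> edges G"
  shows "weight G e * extremal_density G P e = (\<Sum>\<gamma>\<in>\<Gamma>. Mod2 G P * pmf \<mu> \<gamma> * of_bool (e \<in> set \<gamma>))"
proof -
  have "finite \<Gamma>"
    using assms(2) finite_paths finite_subset by blast
  then have "Mod2 G P * usage \<mu> e = (\<Sum>\<gamma>\<in>\<Gamma>. Mod2 G P * pmf \<mu> \<gamma> * of_bool (e \<in> set \<gamma>))"
    by (simp only: usage_eq_sum[OF _ assms(3)] sum_distrib_left mult.assoc)
  then show ?thesis
    by (simp only: optimal_usage[OF opt assms(4)])
qed

text \<open>Complementary slackness: the \<rho>-lengths are at least 1 and their mean under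
  \<open>\<mu>\<close> equals 1.\<close>

lemma optimal_pmf_tight:
  assumes opt: "optimal_pmf G P \<mu>" and \<gamma>: "\<gamma> \<in> set_pmf \<mu>"
  shows "(\<Sum>e\<in>set \<gamma>. extremal_density G P e) = 1"
proof -
  define \<rho> where "\<rho> = extremal_density G P"
  have \<rho>: "\<rho> \<in> admissible G P"
    using dual_density_admissible[OF opt] Mod2_dual(2)[OF opt] by (simp add: \<rho>_def)
  have \<mu>: "\<mu> \<in> pmfs_on P" and pos: "0 < expected_usage_energy G \<mu>"
    using opt expected_usage_energy_pos by (simp_all add: optimal_pmf_def)
  have "(\<Sum>\<gamma>\<in>P. pmf \<mu> \<gamma> * (\<Sum>e\<in>set \<gamma>. \<rho> e)) = (\<Sum>e\<in>edges G. \<rho> e * usage \<mu> e)"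
    by (simp add: sum_usage[OF \<mu>])
  also have "\<dots> = (\<Sum>e\<in>edges G. inverse (weight G e) * (usage \<mu> e)\<^sup>2) / expected_usage_energy G \<mu>"
    unfolding sum_divide_distrib \<rho>_def Mod2_dual(2)[OF opt]
    by (intro sum.cong) (auto simp: dual_density_def field_simps power2_eq_square)
  also have "\<dots> = (\<Sum>\<gamma>\<in>P. pmf \<mu> \<gamma>)"
    using pos sum_pmf_eq_1[OF finite_paths, of \<mu>] \<mu> by (simp add: expected_usage_energy_def pmfs_on_def)
  finally have "(\<Sum>\<gamma>\<in>P. pmf \<mu> \<gamma> * ((\<Sum>e\<in>set \<gamma>. \<rho> e) - 1)) = 0"
    by (simp add: right_diff_distrib sum_subtractf)
  moreover have "\<forall>\<gamma>\<in>P. 0 \<le> pmf \<mu> \<gamma> * ((\<Sum>e\<in>set \<gamma>. \<rho> e) - 1)"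
    using \<rho> by (auto simp: admissible_def)
  ultimately have "pmf \<mu> \<gamma> * ((\<Sum>e\<in>set \<gamma>. \<rho> e) - 1) = 0"
    using sum_nonneg_eq_0_iff[OF finite_paths, of "\<lambda>\<gamma>. pmf \<mu> \<gamma> * ((\<Sum>e\<in>set \<gamma>. \<rho> e) - 1)"] \<gamma> \<mu>
    unfolding pmfs_on_def by blast
  then show ?thesis
    using \<gamma> by (simp add: \<rho>_def set_pmf_iff)
qed

section \<open>Optimal pmfs carried by subfamilies\<close>

lemma optimal_pmf_subfamily:
  assumes "\<Gamma> \<subseteq> P" "\<mu> \<in> pmfs_on \<Gamma>" "optimal_pmf G P \<mu>"
  shows "optimal_pmf G \<Gamma> \<mu>" "Mod2 G \<Gamma> = Mod2 G P"
proof -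
  interpret \<Gamma>: path_family G \<Gamma>
    using assms(1) by (rule subfamily)
  show "optimal_pmf G \<Gamma> \<mu>"
    using assms by (auto simp: optimal_pmf_def pmfs_on_def)
  then show "Mod2 G \<Gamma> = Mod2 G P"
    using \<Gamma>.Mod2_dual(1) Mod2_dual(1)[OF assms(3)] by simp
qed

lemma Mod2_empty: "Mod2 G {} = 0"
proof -
  have "(\<lambda>e\<in>edges G. 0) \<in> admissible G {}" "energy G (\<lambda>e\<in>edges G. 0) = 0"
    by (auto simp: admissible_def energy_def)
  then show ?thesis
    unfolding Mod2_def using energy_nonneg by (intro cInf_eq_minimum) (force simp: image_iff)+
qed

text \<open>The modulus is the reciprocal of the least expected usage energy, and passing to
  \<open>\<Gamma>\<close> shrinks the set of competing pmfs. In the case of equality an optimal pmf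
  of \<open>\<Gamma>\<close> reaches the minimum over \<open>P\<close>. The empty family carries no
  pmf and is treated apart.\<close>

lemma Mod2_subfamily:
  assumes "\<Gamma> \<subseteq> P" "P \<noteq> {}"
  shows "Mod2 G \<Gamma> \<le> Mod2 G P"
    and "Mod2 G \<Gamma> = Mod2 G P \<Longrightarrow> \<exists>\<mu>\<in>pmfs_on \<Gamma>. optimal_pmf G P \<mu>"
proof -
  interpret \<Gamma>: path_family G \<Gamma>
    using assms(1) by (rule subfamily)
  obtain \<mu> where \<mu>: "optimal_pmf G P \<mu>"
    using exists_optimal_pmf[OF assms(2)] ..
  have "Mod2 G \<Gamma> \<le> Mod2 G P \<and> (Mod2 G \<Gamma> = Mod2 G P \<longrightarrow> (\<exists>\<mu>\<in>pmfs_on \<Gamma>. optimal_pmf G P \<mu>))"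
  proof (cases "\<Gamma> = {}")
    case True
    then show ?thesis
      using Mod2_empty Mod2_pos[OF assms(2)] by simp
  next
    case False
    then obtain \<nu> where \<nu>: "optimal_pmf G \<Gamma> \<nu>"
      using \<Gamma>.exists_optimal_pmf by blast
    then have "\<nu> \<in> pmfs_on \<Gamma>" "\<nu> \<in> pmfs_on P"
      using assms(1) by (auto simp: optimal_pmf_def pmfs_on_def)
    then have "expected_usage_energy G \<mu> \<le> expected_usage_energy G \<nu>"
      using \<mu> by (simp add: optimal_pmf_def)
    moreover have "0 < expected_usage_energy G \<mu>"
      using \<mu> expected_usage_energy_pos by (simp add: optimal_pmf_def)
    moreover have "optimal_pmf G P \<nu>" if "Mod2 G \<Gamma> = Mod2 G P"
      using that \<nu> \<mu> \<open>\<nu> \<in> pmfs_on P\<close> \<Gamma>.Mod2_dual(1)[OF \<nu>] Mod2_dual(1)[OF \<mu>]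
      by (simp add: optimal_pmf_def)
    ultimately show ?thesis
      using \<Gamma>.Mod2_dual(1)[OF \<nu>] Mod2_dual(1)[OF \<mu>] \<open>\<nu> \<in> pmfs_on \<Gamma>\<close>
      by (auto intro: divide_left_mono)
  qed
  then show "Mod2 G \<Gamma> \<le> Mod2 G P"
    and "Mod2 G \<Gamma> = Mod2 G P \<Longrightarrow> \<exists>\<mu>\<in>pmfs_on \<Gamma>. optimal_pmf G P \<mu>"
    by blast+
qed

text \<open>Converse to \<open>optimal_pmf_flow\<close>: the normalised weights have the usage of
  any optimal pmf, and the energy depends on the usage alone.\<close>

lemma optimal_pmf_of_decomposition:
  assumes \<Gamma>: "\<Gamma> \<subseteq> P" and "P \<noteq> {}" and m: "\<And>\<gamma>. \<gamma> \<in> \<Gamma> \<Longrightarrow> 0 \<le> m \<gamma>"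
    and tight: "\<And>\<gamma>. \<gamma> \<in> \<Gamma> \<Longrightarrow> (\<Sum>e\<in>set \<gamma>. extremal_density G P e) = 1"
    and decomp: "\<And>e. e \<in> edges G \<Longrightarrow>
      weight G e * extremal_density G P e = (\<Sum>\<gamma>\<in>\<Gamma>. m \<gamma> * of_bool (e \<in> set \<gamma>))"
  shows "\<exists>\<mu>\<in>pmfs_on \<Gamma>. optimal_pmf G P \<mu>"
proof -
  define \<rho> where "\<rho> = extremal_density G P"
  obtain \<nu> where \<nu>: "optimal_pmf G P \<nu>"
    using exists_optimal_pmf[OF assms(2)] ..
  have energy: "energy G \<rho> = Mod2 G P" and pos: "0 < Mod2 G P"
    using energy_dual_density(1)[OF \<nu>] Mod2_dual[OF \<nu>] Mod2_pos[OF assms(2)] by (simp_all add: \<rho>_def)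
  have fin: "finite \<Gamma>"
    using \<Gamma> finite_paths finite_subset by blast
  \<comment> \<open>One factor \<sigma>\<rho> in the energy of \<open>\<rho>\<close> is replaced by
    the decomposition. As all lengths are 1, what remains is the total weight, so
    \<open>Mod2 G P\<close> is the right normalisation.\<close>
  have "Mod2 G P = (\<Sum>e\<in>edges G. \<rho> e * (\<Sum>\<gamma>\<in>\<Gamma>. m \<gamma> * of_bool (e \<in> set \<gamma>)))"
    unfolding energy[symmetric] energy_def using decomp
    by (intro sum.cong) (auto simp: \<rho>_def[symmetric] power2_eq_square mult_ac simp flip: decomp)
  also have "\<dots> = (\<Sum>\<gamma>\<in>\<Gamma>. m \<gamma> * (\<Sum>e\<in>set \<gamma>. \<rho> e))"
    using \<Gamma> paths_edges by (intro sum_over_paths_swap[OF finite_edges]) auto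
  also have "\<dots> = sum m \<Gamma>"
    using tight by (simp add: \<rho>_def)
  finally have total: "sum m \<Gamma> = Mod2 G P" by simp
  define f where "f \<gamma> = (if \<gamma> \<in> \<Gamma> then m \<gamma> / Mod2 G P else 0)" for \<gamma>
  have "sum f \<Gamma> = 1"
    using total pos by (simp add: f_def flip: sum_divide_distrib)
  moreover have "0 \<le> f x" "x \<notin> \<Gamma> \<Longrightarrow> f x = 0" for x
    using m pos by (auto simp: f_def)
  ultimately obtain \<mu> where \<mu>: "\<mu> \<in> pmfs_on \<Gamma>" "\<And>x. pmf \<mu> x = f x"
    using exists_pmf_with_weights[OF fin, of f] by blast
  have "usage \<mu> e = usage \<nu> e" if "e \<in> edges G" for e
  proof -
    have "Mod2 G P * usage \<mu> e = (\<Sum>\<gamma>\<in>\<Gamma>. m \<gamma> * of_bool (e \<in> set \<gamma>))"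
      unfolding usage_eq_sum[OF fin \<mu>(1)] \<mu>(2) sum_distrib_left
      using pos by (intro sum.cong) (auto simp: f_def)
    also have "\<dots> = Mod2 G P * usage \<nu> e"
      using decomp[OF that] optimal_usage[OF \<nu> that] by simp
    finally show ?thesis
      using pos by simp
  qed
  then have "expected_usage_energy G \<mu> = expected_usage_energy G \<nu>"
    by (simp add: expected_usage_energy_def)
  then have "optimal_pmf G P \<mu>"
    using \<nu> \<mu>(1) \<Gamma> by (auto simp: optimal_pmf_def pmfs_on_def)
  then show ?thesis
    using \<mu>(1) by blast
qed

end

section \<open>Paths and walks\<close>

lemma path_via_Nil: "path_via G xs [] \<longleftrightarrow> (\<exists>x\<in>verts G. xs = [x])"
  by (auto simp: path_via_def length_Suc_conv)

lemma path_via_Cons: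
  "path_via G xs (e # \<gamma>) \<longleftrightarrow>
     (\<exists>x y ys. xs = x # y # ys \<and> x \<in> verts G \<and> x \<notin> set (y # ys) \<and> e \<in> edges G \<and>
        ends G e = {x, y} \<and> path_via G (y # ys) \<gamma>)"
proof
  assume *: "path_via G xs (e # \<gamma>)"
  then obtain x y ys where xs: "xs = x # y # ys"
    by (auto simp: path_via_def length_Suc_conv)
  have "ends G ((e # \<gamma>) ! k) = {xs ! k, xs ! Suc k}" if "k < Suc (length \<gamma>)" for k
    using * that by (auto simp: path_via_def)
  from this[of 0] this[of "Suc _"] have "ends G e = {x, y}" "\<forall>k<length \<gamma>. ends G (\<gamma> ! k) = {(y # ys) ! k, (y # ys) ! Suc k}"
    by (auto simp: xs)
  then show "\<exists>x y ys. xs = x # y # ys \<and> x \<in> verts G \<and> x \<notin> set (y # ys) \<and> e \<in> edges G \<and>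
        ends G e = {x, y} \<and> path_via G (y # ys) \<gamma>"
    using * xs by (auto simp: path_via_def)
next
  assume "\<exists>x y ys. xs = x # y # ys \<and> x \<in> verts G \<and> x \<notin> set (y # ys) \<and> e \<in> edges G \<and>
        ends G e = {x, y} \<and> path_via G (y # ys) \<gamma>"
  then show "path_via G xs (e # \<gamma>)"
    by (auto simp: path_via_def nth_Cons split: nat.split)
qed

lemma path_via_induct [consumes 1, case_names Nil Cons]:
  assumes "path_via G xs \<gamma>"
    and "\<And>x. x \<in> verts G \<Longrightarrow> Q [x] []"
    and "\<And>x y ys e \<gamma>. x \<in> verts G \<Longrightarrow> x \<notin> set (y # ys) \<Longrightarrow> e \<in> edges G \<Longrightarrow> ends G e = {x, y} \<Longrightarrow>
      path_via G (y # ys) \<gamma> \<Longrightarrow> Q (y # ys) \<gamma> \<Longrightarrow> Q (x # y # ys) (e # \<gamma>)"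
  shows "Q xs \<gamma>"
  using assms(1)
proof (induction \<gamma> arbitrary: xs)
  case Nil
  then show ?case
    using assms(2) by (auto simp: path_via_Nil)
next
  case (Cons e \<gamma>)
  then show ?case
    using assms(3) by (auto simp: path_via_Cons)
qed

lemma path_via_ends: "path_via G xs \<gamma> \<Longrightarrow> e \<in> set \<gamma> \<Longrightarrow> ends G e \<subseteq> set xs"
  by (induction rule: path_via_induct) auto

lemma path_via_distinct: "path_via G xs \<gamma> \<Longrightarrow> distinct \<gamma>"
proof (induction rule: path_via_induct)
  case (Cons x y ys e \<gamma>)
  then show ?case
    using path_via_ends[of G "y # ys" \<gamma> e] by auto
qed simp

lemma path_via_incident: "path_via G xs \<gamma> \<Longrightarrow> \<gamma> \<noteq> [] \<Longrightarrow> (\<Union>e\<in>set \<gamma>. ends G e) = set xs"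
proof (induction rule: path_via_induct)
  case (Cons x y ys e \<gamma>)
  then show ?case
    by (cases "\<gamma> = []") (auto simp: path_via_Nil)
qed simp

lemma path_via_suffix:
  assumes "path_via G (xs @ ys) \<gamma>" "ys \<noteq> []"
  shows "\<exists>\<gamma>'. path_via G ys \<gamma>' \<and> set \<gamma>' \<subseteq> set \<gamma>"
  using assms
proof (induction xs arbitrary: \<gamma>)
  case (Cons x xs)
  then obtain e \<gamma>' where "\<gamma> = e # \<gamma>'" "path_via G (xs @ ys) \<gamma>'"
    by (cases \<gamma>) (auto simp: path_via_Nil path_via_Cons append_eq_Cons_conv)
  then show ?case
    using Cons by fastforce
qed auto

text \<open>The start vertex lies on a single edge of the path, so the edge set determines the first
  edge, then the second vertex, and so on.\<close>

lemma path_via_unique: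
  assumes "path_via G xs \<gamma>" "path_via G ys \<delta>" "hd xs = hd ys" "set \<gamma> = set \<delta>"
  shows "\<gamma> = \<delta>"
  using assms
proof (induction arbitrary: ys \<delta> rule: path_via_induct)
  case (Cons x y xs e \<gamma>)
  then obtain f \<delta>' where \<delta>: "\<delta> = f # \<delta>'"
    by (cases \<delta>) auto
  with Cons.prems obtain z zs where ys: "ys = x # z # zs" "x \<notin> set (z # zs)"
    "ends G f = {x, z}" "path_via G (z # zs) \<delta>'"
    by (auto simp: path_via_Cons)
  have "\<forall>d\<in>set \<gamma>. x \<notin> ends G d"
    using path_via_ends[OF Cons.hyps(5)] Cons.hyps(2) by blast
  moreover have "f \<in> set (e # \<gamma>)"
    using Cons.prems(3) \<delta> by simp
  ultimately have "f = e"
    using ys(3) by auto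
  moreover have "y = z"
    using Cons.hyps(4) ys(3) \<open>f = e\<close> ys(2) Cons.hyps(2) by (metis doubleton_eq_iff)
  moreover have "distinct (f # \<delta>')" "distinct (e # \<gamma>)"
    using path_via_distinct[OF Cons.prems(1)] \<delta> path_via_distinct[of G "x # y # xs" "e # \<gamma>"]
      Cons.hyps by (auto simp: path_via_Cons)
  then have "set \<gamma> = set \<delta>'"
    using Cons.prems(3) \<delta> \<open>f = e\<close> by (metis distinct.simps(2) insert_ident list.simps(15))
  ultimately show ?case
    using Cons.IH[OF ys(4)] \<delta> by simp
qed simp

section \<open>Walks, which may revisit vertices, and the paths contained in them\<close>

primrec walk :: "'e network \<Rightarrow> complex \<Rightarrow> 'e list \<Rightarrow> complex \<Rightarrow> bool" where
  "walk G x [] y \<longleftrightarrow> x = y"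
| "walk G x (e # \<gamma>) y \<longleftrightarrow> e \<in> edges G \<and> (\<exists>z. ends G e = {x, z} \<and> walk G z \<gamma> y)"

lemma walk_append: "walk G x (\<gamma> @ \<delta>) y \<longleftrightarrow> (\<exists>z. walk G x \<gamma> z \<and> walk G z \<delta> y)"
  by (induction \<gamma> arbitrary: x) auto

text \<open>Loop erasure by induction from the far end: a new start vertex either lies in
  \<open>B\<close> and becomes the whole path, or already occurs and the loop before that occurrence
  is cut off, or is prepended. The first rule keeps \<open>B\<close> away from all vertices but the
  last.\<close>

lemma path_of_walk:
  assumes "walk G x \<gamma> y" "y \<in> B" "x \<in> verts G" and V: "\<forall>e\<in>edges G. ends G e \<subseteq> verts G"
  shows "\<exists>xs \<gamma>'. path_via G xs \<gamma>' \<and> hd xs = x \<and> last xs \<in> B \<and> set (butlast xs) \<inter> B = {} \<and> set \<gamma>' \<subseteq> set \<gamma>"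
  using assms(1-3)
proof (induction \<gamma> arbitrary: x)
  case Nil
  then show ?case
    by (intro exI[of _ "[x]"] exI[of _ "[]"]) (auto simp: path_via_Nil)
next
  case (Cons e \<gamma>)
  then obtain z where z: "e \<in> edges G" "ends G e = {x, z}" "walk G z \<gamma> y"
    by auto
  then have "z \<in> verts G"
    using V by auto
  from Cons.IH[OF z(3) \<open>y \<in> B\<close> this] obtain xs \<gamma>' where
    *: "path_via G xs \<gamma>'" "hd xs = z" "last xs \<in> B" "set (butlast xs) \<inter> B = {}" "set \<gamma>' \<subseteq> set \<gamma>"
    by blast
  have "xs \<noteq> []"
    using *(1) by (auto simp: path_via_def)
  then obtain ys where xs: "xs = z # ys"
    using *(2) by (cases xs) auto
  consider "x \<in> B" | "x \<in> set xs" | "x \<notin> B" "x \<notin> set xs" by blast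
  then show ?case
  proof cases
    case 1
    then show ?thesis
      using Cons.prems by (intro exI[of _ "[x]"] exI[of _ "[]"]) (auto simp: path_via_Nil)
  next
    case 2
    then obtain us vs where split: "xs = us @ x # vs"
      by (auto simp: in_set_conv_decomp)
    then obtain \<delta> where "path_via G (x # vs) \<delta>" "set \<delta> \<subseteq> set \<gamma>'"
      using path_via_suffix[of G us "x # vs" \<gamma>'] *(1) by auto
    then show ?thesis
      using * split by (intro exI[of _ "x # vs"] exI[of _ \<delta>]) (auto simp: butlast_append split: if_splits)
  next
    case 3
    then show ?thesis
      using * xs z Cons.prems
      by (intro exI[of _ "x # xs"] exI[of _ "e # \<gamma>'"]) (auto simp: path_via_Cons)
  qed
qed

text \<open>After loop erasure towards \<open>B\<close>, the part from the last visit to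
  \<open>A\<close> onwards has no inner vertex in a terminal set.\<close>

lemma paths_between_of_walk:
  assumes "walk G x \<gamma> y" "x \<in> A" "y \<in> B" and V: "\<forall>e\<in>edges G. ends G e \<subseteq> verts G"
    and AB: "A \<subseteq> verts G" "A \<inter> B = {}"
  shows "\<exists>\<gamma>'\<in>paths_between G A B. set \<gamma>' \<subseteq> set \<gamma>"
proof -
  obtain xs \<gamma>' where *: "path_via G xs \<gamma>'" "hd xs = x" "last xs \<in> B" "set (butlast xs) \<inter> B = {}" "set \<gamma>' \<subseteq> set \<gamma>"
    using path_of_walk[OF assms(1,3) _ V] \<open>x \<in> A\<close> AB by blast
  have "xs \<noteq> []"
    using *(1) by (auto simp: path_via_def)
  then have "\<exists>z\<in>set xs. z \<in> A"
    using *(2) \<open>x \<in> A\<close> by (metis list.set_sel(1))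
  then obtain us a vs where split: "xs = us @ a # vs" "a \<in> A" "\<forall>z\<in>set vs. z \<notin> A"
    using split_list_last_prop[of xs "\<lambda>z. z \<in> A"] by blast
  then obtain \<delta> where \<delta>: "path_via G (a # vs) \<delta>" "set \<delta> \<subseteq> set \<gamma>'"
    using path_via_suffix[of G us "a # vs" \<gamma>'] *(1) by auto
  have "vs \<noteq> []"
    using *(3) split AB(2) by auto
  then have vs: "set vs = insert (last vs) (set (butlast vs))"
    by (induction vs) auto
  have "last vs \<in> B"
    using *(3) split(1) \<open>vs \<noteq> []\<close> by simp
  moreover have "butlast xs = us @ a # butlast vs"
    using split(1) \<open>vs \<noteq> []\<close> by (simp add: butlast_append)
  then have "set (butlast vs) \<inter> B = {}"
    using *(4) by auto
  ultimately have "set (a # vs) \<inter> (A \<union> B) = {a, last vs}"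
    using split(2,3) AB(2) by (auto simp: vs)
  then have "\<delta> \<in> paths_between G A B"
    using \<delta>(1) split(2) \<open>last vs \<in> B\<close> \<open>vs \<noteq> []\<close> unfolding paths_between_def
    by (intro CollectI exI[of _ "a # vs"]) simp
  then show ?thesis
    using \<delta>(2) *(5) by blast
qed

section \<open>Point sets drawn by edges and paths\<close>

locale plane_network =
  fixes G :: "'e network"
  assumes plane: "finite_plane_network G"
begin

lemma finite_verts: "finite (verts G)" and finite_edges: "finite (edges G)"
  and weight_pos: "e \<in> edges G \<Longrightarrow> 0 < weight G e"
  and arc_curve: "e \<in> edges G \<Longrightarrow> arc (curve G e)"
  and curve_verts: "e \<in> edges G \<Longrightarrow> path_image (curve G e) \<inter> verts G = ends G e"
  and curves_meet: "e \<in> edges G \<Longrightarrow> e' \<in> edges G \<Longrightarrow> e \<noteq> e' \<Longrightarrow>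
        path_image (curve G e) \<inter> path_image (curve G e') \<subseteq> verts G"
  using plane by (simp_all add: finite_plane_network_def)

lemma ends_subset: "e \<in> edges G \<Longrightarrow> ends G e \<subseteq> verts G"
  by (metis curve_verts inf_le2)

lemma ends_distinct: "e \<in> edges G \<Longrightarrow> pathstart (curve G e) \<noteq> pathfinish (curve G e)"
  by (metis arc_curve arc_distinct_ends)

lemma edge_trace_verts:
  assumes "H \<subseteq> edges G"
  shows "edge_trace G H \<inter> verts G = (\<Union>e\<in>H. ends G e)"
proof -
  have "edge_trace G H \<inter> verts G = (\<Union>e\<in>H. path_image (curve G e) \<inter> verts G)"
    by (auto simp: edge_trace_def)
  also have "\<dots> = (\<Union>e\<in>H. ends G e)"
    using assms curve_verts by (intro SUP_cong) auto
  finally show ?thesis .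
qed

lemma curve_other_vertex:
  assumes "e \<in> edges G"
  obtains z where "z \<in> path_image (curve G e)" "z \<notin> verts G"
proof -
  have "infinite (path_image (curve G e))"
    using arc_curve[OF assms] ends_distinct[OF assms] connected_finite_iff_sing[of "path_image (curve G e)"]
    by (metis connected_arc_image empty_iff pathfinish_in_path_image pathstart_in_path_image singletonD)
  then show thesis
    using that finite_verts by (meson finite_subset subsetI)
qed

text \<open>A point of an edge that is not a vertex lies on no other edge, so the drawn point set
  remembers its edges. This converts topological inclusions back into inclusions of edge
  sets.\<close>

lemma edge_trace_mono_iff:
  assumes "H \<subseteq> edges G" "H' \<subseteq> edges G"
  shows "edge_trace G H \<subseteq> edge_trace G H' \<longleftrightarrow> H \<subseteq> H'"
proof
  assume *: "edge_trace G H \<subseteq> edge_trace G H'"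
  show "H \<subseteq> H'"
  proof
    fix e assume "e \<in> H"
    then obtain z where z: "z \<in> path_image (curve G e)" "z \<notin> verts G"
      using assms curve_other_vertex by blast
    then obtain e' where "e' \<in> H'" "z \<in> path_image (curve G e')"
      using * \<open>e \<in> H\<close> by (auto simp: edge_trace_def)
    moreover have "e = e'"
      using curves_meet[of e e'] calculation z assms \<open>e \<in> H\<close> by auto
    ultimately show "e \<in> H'"
      by simp
  qed
qed (auto simp: edge_trace_def)

text \<open>Every edge curve is first oriented along the path. Planarity lets the pieces meet only
  in vertices, and distinctness of the vertex list leaves just the joint \<open>y\<close>, so
  concatenation gives an arc.\<close>

lemma path_arc:
  assumes "path_via G xs \<gamma>" "\<gamma> \<noteq> []"
  shows "\<exists>g. arc g \<and> path_image g = edge_trace G (set \<gamma>) \<and> pathstart g = hd xs \<and> pathfinish g = last xs"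
  using assms
proof (induction rule: path_via_induct)
  case (Cons x y ys e \<gamma>)
  obtain h where h: "arc h" "path_image h = path_image (curve G e)" "pathstart h = x" "pathfinish h = y"
  proof (cases "pathstart (curve G e) = x")
    case True
    then have "pathfinish (curve G e) = y"
      using Cons.hyps(4) ends_distinct[OF Cons.hyps(3)] by (auto simp: ends_def doubleton_eq_iff)
    then show thesis
      using that[of "curve G e"] True arc_curve[OF Cons.hyps(3)] by simp
  next
    case False
    then have "pathfinish (curve G e) = x" "pathstart (curve G e) = y"
      using Cons.hyps(4) by (auto simp: ends_def doubleton_eq_iff)
    then show thesis
      using that[of "reversepath (curve G e)"] arc_curve[OF Cons.hyps(3)] by (simp add: arc_reversepath)
  qed
  show ?case
  proof (cases "\<gamma> = []")
    case True
    then show ?thesis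
      using h Cons.hyps(5) by (intro exI[of _ h]) (auto simp: edge_trace_def path_via_Nil)
  next
    case False
    with Cons.IH obtain g where g: "arc g" "path_image g = edge_trace G (set \<gamma>)" "pathstart g = y" "pathfinish g = last (y # ys)"
      by auto
    have \<gamma>: "set \<gamma> \<subseteq> edges G"
      using Cons.hyps(5) by (simp add: path_via_def)
    have "e \<notin> set \<gamma>"
      using path_via_ends[OF Cons.hyps(5), of e] Cons.hyps(2,4) by auto
    then have "path_image (curve G e) \<inter> path_image (curve G f) \<subseteq> verts G" if "f \<in> set \<gamma>" for f
      using curves_meet[OF Cons.hyps(3), of f] \<gamma> that by auto
    then have meet: "path_image h \<inter> path_image g \<subseteq> verts G"
      unfolding h(2) g(2) edge_trace_def by blast
    have "path_image h \<inter> verts G \<subseteq> {x, y}"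
      using curve_verts[OF Cons.hyps(3)] Cons.hyps(4) h(2) by simp
    moreover have "path_image g \<inter> verts G \<subseteq> set (y # ys)"
      unfolding g(2) edge_trace_verts[OF \<gamma>] by (intro UN_least path_via_ends[OF Cons.hyps(5)])
    ultimately have "path_image h \<inter> path_image g \<subseteq> {x, y} \<inter> set (y # ys)"
      using meet by auto
    then have "path_image h \<inter> path_image g \<subseteq> {pathstart g}"
      using Cons.hyps(2) g(3) by auto
    then have "arc (h +++ g)"
      using h g by (intro arc_join) auto
    moreover have "path_image (h +++ g) = edge_trace G (set (e # \<gamma>))"
      using h g by (simp add: path_image_join edge_trace_def)
    ultimately show ?thesis
      using h g by (intro exI[of _ "h +++ g"]) auto
  qed
qed simp

lemma finite_paths_between: "finite (paths_between G A B)"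
proof (rule finite_subset)
  show "paths_between G A B \<subseteq> {\<gamma>. set \<gamma> \<subseteq> edges G \<and> length \<gamma> \<le> card (verts G)}"
  proof safe
    fix \<gamma> assume "\<gamma> \<in> paths_between G A B"
    then obtain xs where *: "path_via G xs \<gamma>"
      by (auto simp: paths_between_def)
    then have "length xs \<le> card (verts G)" "length xs = Suc (length \<gamma>)"
      using card_mono[OF finite_verts, of "set xs"] distinct_card[of xs] by (auto simp: path_via_def)
    then show "length \<gamma> \<le> card (verts G)" by simp
    show "e \<in> edges G" if "e \<in> set \<gamma>" for e
      using * that by (auto simp: path_via_def)
  qed
qed (simp add: finite_lists_length_le finite_edges)

end

locale terminal_network = plane_network G for G :: "'e network" +
  fixes A B :: "complex set"
  assumes terminals: "A \<subseteq> verts G" "B \<subseteq> verts G" "A \<inter> B = {}"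
begin

abbreviation "P \<equiv> paths_between G A B"

lemma paths_betweenE:
  assumes "\<gamma> \<in> P"
  obtains xs where "path_via G xs \<gamma>" "hd xs \<in> A" "last xs \<in> B" "set xs \<inter> (A \<union> B) = {hd xs, last xs}"
    "\<gamma> \<noteq> []"
proof -
  obtain xs where *: "path_via G xs \<gamma>" "hd xs \<in> A" "last xs \<in> B" "set xs \<inter> (A \<union> B) = {hd xs, last xs}"
    using assms by (auto simp: paths_between_def)
  have "\<gamma> \<noteq> []"
    using * terminals(3) by (auto simp: path_via_Nil disjoint_iff)
  with * that show thesis by blast
qed

lemma paths_between_edges: "\<gamma> \<in> P \<Longrightarrow> set \<gamma> \<subseteq> edges G"
  by (auto simp: paths_between_def path_via_def)

lemma paths_between_nonempty: "\<gamma> \<in> P \<Longrightarrow> \<gamma> \<noteq> []"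
  by (erule paths_betweenE)

text \<open>The edges determine the vertices, and the only one of these in \<open>A\<close> is the
  start; from there \<open>path_via_unique\<close> applies.\<close>

lemma paths_between_eq:
  assumes "\<gamma> \<in> P" "\<delta> \<in> P" "set \<gamma> = set \<delta>"
  shows "\<gamma> = \<delta>"
proof -
  obtain xs where xs: "path_via G xs \<gamma>" "hd xs \<in> A" "last xs \<in> B" "set xs \<inter> (A \<union> B) = {hd xs, last xs}" "\<gamma> \<noteq> []"
    using assms(1) by (rule paths_betweenE)
  obtain ys where ys: "path_via G ys \<delta>" "hd ys \<in> A" "last ys \<in> B" "set ys \<inter> (A \<union> B) = {hd ys, last ys}" "\<delta> \<noteq> []"
    using assms(2) by (rule paths_betweenE)
  have "set xs = set ys"
    using path_via_incident[OF xs(1,5)] path_via_incident[OF ys(1,5)] assms(3) by simp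
  then have "{hd xs, last xs} = {hd ys, last ys}"
    using xs(4) ys(4) by simp
  then have "hd xs = hd ys"
    using xs(2) ys(3) terminals(3) by (metis disjoint_iff doubleton_eq_iff)
  then show ?thesis
    using path_via_unique[OF xs(1) ys(1)] assms(3) by simp
qed

end

section \<open>Levels and flows\<close>

locale level_network = terminal_network G A B for G :: "'e network" and A B +
  fixes \<rho> :: "'e \<Rightarrow> real"
  assumes nonneg: "e \<in> edges G \<Longrightarrow> 0 \<le> \<rho> e"
    and long: "\<gamma> \<in> P \<Longrightarrow> 1 \<le> (\<Sum>e\<in>set \<gamma>. \<rho> e)"
begin

text \<open>
  The \<open>\<rho>\<close>-distance from \<open>A\<close>, capped at 1 so that it makes sense at vertices not reachable from \<open>A\<close>.
\<close>

definition level :: "complex \<Rightarrow> real" where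
  "level v = Inf (insert 1 {sum_list (map \<rho> \<gamma>) |x \<gamma>. x \<in> A \<and> walk G x \<gamma> v})"

lemma walk_length_nonneg: "walk G x \<gamma> y \<Longrightarrow> 0 \<le> sum_list (map \<rho> \<gamma>)"
  using nonneg by (induction \<gamma> arbitrary: x) (auto intro!: add_nonneg_nonneg)

lemma level_bdd: "bdd_below (insert 1 {sum_list (map \<rho> \<gamma>) |x \<gamma>. x \<in> A \<and> walk G x \<gamma> v})"
  using walk_length_nonneg by (intro bdd_belowI[of _ 0]) auto

lemma level_le_1: "level v \<le> 1"
  unfolding level_def by (rule cInf_lower[OF _ level_bdd]) simp

lemma level_nonneg: "0 \<le> level v"
  unfolding level_def by (rule cInf_greatest) (auto dest: walk_length_nonneg)

lemma level_le_walk: "x \<in> A \<Longrightarrow> walk G x \<gamma> v \<Longrightarrow> level v \<le> sum_list (map \<rho> \<gamma>)"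
  unfolding level_def by (rule cInf_lower[OF _ level_bdd]) blast

lemma level_A: "v \<in> A \<Longrightarrow> level v = 0"
  using level_le_walk[of v "[]" v] level_nonneg[of v] by simp

text \<open>Any walk from \<open>A\<close> to a vertex of \<open>B\<close> contains a path of
  \<open>P\<close>, which has length at least 1, and the cap gives the other bound.\<close>

lemma level_B:
  assumes "v \<in> B"
  shows "level v = 1"
proof -
  have "1 \<le> sum_list (map \<rho> \<gamma>)" if x: "x \<in> A" "walk G x \<gamma> v" for x \<gamma>
  proof -
    have edges: "set \<gamma> \<subseteq> edges G"
      using x(2) by (induction \<gamma> arbitrary: x) auto
    obtain \<gamma>' where "\<gamma>' \<in> P" "set \<gamma>' \<subseteq> set \<gamma>"
      using paths_between_of_walk[OF x(2,1) assms] ends_subset terminals by blast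
    then have "1 \<le> (\<Sum>e\<in>set \<gamma>'. \<rho> e)"
      using long by blast
    also have "\<dots> \<le> (\<Sum>e\<in>set \<gamma>. \<rho> e)"
      using \<open>set \<gamma>' \<subseteq> set \<gamma>\<close> edges nonneg by (intro sum_mono2) auto
    also have "\<dots> \<le> sum_list (map \<rho> \<gamma>)"
      using edges nonneg by (induction \<gamma>) (auto simp: sum.insert_if intro: add_increasing)
    finally show ?thesis .
  qed
  then have "1 \<le> level v"
    unfolding level_def by (intro cInf_greatest) auto
  with level_le_1[of v] show ?thesis by simp
qed

lemma level_edge:
  assumes "e \<in> edges G" "ends G e = {u, v}"
  shows "level v \<le> level u + \<rho> e"
proof -
  have "level v - \<rho> e \<le> level u"
    unfolding level_def[of u]
  proof (rule cInf_greatest)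
    fix s assume "s \<in> insert 1 {sum_list (map \<rho> \<gamma>) |x \<gamma>. x \<in> A \<and> walk G x \<gamma> u}"
    then consider "s = 1" | x \<gamma> where "x \<in> A" "walk G x \<gamma> u" "s = sum_list (map \<rho> \<gamma>)"
      by blast
    then show "level v - \<rho> e \<le> s"
    proof cases
      case 1
      then show ?thesis
        using level_le_1[of v] nonneg[OF assms(1)] by linarith
    next
      case 2
      then have "walk G x (\<gamma> @ [e]) v"
        using assms by (auto simp: walk_append)
      from level_le_walk[OF \<open>x \<in> A\<close> this] show ?thesis
        using 2 by simp
    qed
  qed simp
  then show ?thesis by simp
qed

text \<open>The edges that can carry extremal flow, oriented towards increasing level.\<close>

definition directed :: "'e \<Rightarrow> complex \<Rightarrow> complex \<Rightarrow> bool" where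
  "directed e u v \<longleftrightarrow> e \<in> edges G \<and> ends G e = {u, v} \<and> 0 < \<rho> e \<and> level v = level u + \<rho> e"

lemma directed_unique: "directed e u v \<Longrightarrow> directed e u' v' \<Longrightarrow> u' = u \<and> v' = v"
  by (auto simp: directed_def doubleton_eq_iff)

lemma directed_verts: "directed e u v \<Longrightarrow> u \<in> verts G \<and> v \<in> verts G"
  using ends_subset[of e] by (auto simp: directed_def)

primrec dwalk :: "complex \<Rightarrow> 'e list \<Rightarrow> complex \<Rightarrow> bool" where
  "dwalk x [] y \<longleftrightarrow> x = y"
| "dwalk x (e # \<gamma>) y \<longleftrightarrow> (\<exists>z. directed e x z \<and> dwalk z \<gamma> y)"

lemma dwalk_append: "dwalk x (\<gamma> @ \<delta>) y \<longleftrightarrow> (\<exists>z. dwalk x \<gamma> z \<and> dwalk z \<delta> y)"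
  by (induction \<gamma> arbitrary: x) auto

text \<open>Levels increase strictly along directed edges, so no vertex can recur. The level bounds
  are recorded for \<open>dwalk_in_paths\<close>.\<close>

lemma dwalk_path:
  assumes "dwalk x \<gamma> y" "x \<in> verts G"
  shows "\<exists>xs. path_via G xs \<gamma> \<and> hd xs = x \<and> last xs = y \<and>
           (\<forall>z\<in>set xs. (z = x \<or> level x < level z) \<and> (z = y \<or> level z < level y))"
  using assms
proof (induction \<gamma> arbitrary: x)
  case Nil
  then show ?case
    by (intro exI[of _ "[x]"]) (auto simp: path_via_Nil)
next
  case (Cons e \<gamma>)
  then obtain z where z: "directed e x z" "dwalk z \<gamma> y"
    by auto
  with Cons.IH[OF z(2)] obtain xs where xs: "path_via G xs \<gamma>" "hd xs = z" "last xs = y"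
    "\<forall>w\<in>set xs. (w = z \<or> level z < level w) \<and> (w = y \<or> level w < level y)"
    using directed_verts by blast
  have "xs \<noteq> []"
    using xs(1) by (auto simp: path_via_def)
  then obtain ys where ys: "xs = z # ys"
    using xs(2) by (cases xs) auto
  have less: "level x < level z"
    using z(1) by (simp add: directed_def)
  then have above: "level x < level w" if "w \<in> set xs" for w
    using xs(4) that by fastforce
  moreover have "y \<in> set xs"
    using xs(3) \<open>xs \<noteq> []\<close> by force
  ultimately have "\<forall>w\<in>set (x # xs). (w = x \<or> level x < level w) \<and> (w = y \<or> level w < level y)"
    using xs(4) by auto
  moreover have "x \<notin> set xs"
    using above by blast
  then have "path_via G (x # xs) (e # \<gamma>)"
    using xs(1) z(1) Cons.prems(2) by (simp add: ys path_via_Cons directed_def)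
  moreover have "last (x # xs) = y"
    using xs(3) \<open>xs \<noteq> []\<close> by simp
  ultimately show ?case
    by (metis list.sel(1))
qed

text \<open>Inner vertices have levels strictly between 0 and 1, the levels of \<open>A\<close> and
  \<open>B\<close>. Hence directed pieces can be joined without checking for repeated or terminal
  vertices.\<close>

lemma dwalk_in_paths:
  assumes "dwalk x \<gamma> y" "x \<in> A" "y \<in> B"
  shows "\<gamma> \<in> P"
proof -
  obtain xs where xs: "path_via G xs \<gamma>" "hd xs = x" "last xs = y"
    "\<forall>z\<in>set xs. (z = x \<or> level x < level z) \<and> (z = y \<or> level z < level y)"
    using dwalk_path[OF assms(1)] assms(2) terminals(1) by blast
  have "xs \<noteq> []"
    using xs(1) by (auto simp: path_via_def)
  then have "x \<in> set xs" "y \<in> set xs"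
    using xs(2,3) by auto
  moreover have "z \<notin> A" "z \<notin> B" if "z \<in> set xs" "z \<noteq> x" "z \<noteq> y" for z
    using xs(4) that level_A level_B assms(2,3) by fastforce+
  ultimately have "set xs \<inter> (A \<union> B) = {x, y}"
    using assms(2,3) by blast
  then show ?thesis
    using xs assms(2,3) unfolding paths_between_def by blast
qed

lemma dwalk_distinct: "dwalk x \<gamma> y \<Longrightarrow> x \<in> verts G \<Longrightarrow> distinct \<gamma>"
  using dwalk_path path_via_distinct by blast

lemma dwalk_length: "dwalk x \<gamma> y \<Longrightarrow> sum_list (map \<rho> \<gamma>) = level y - level x"
  by (induction \<gamma> arbitrary: x) (auto simp: directed_def)

lemma dwalk_tight:
  assumes "dwalk x \<gamma> y" "x \<in> A" "y \<in> B"
  shows "(\<Sum>e\<in>set \<gamma>. \<rho> e) = 1"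
  using dwalk_length[OF assms(1)] dwalk_distinct[OF assms(1)] level_A[OF assms(2)] level_B[OF assms(3)]
    terminals(1) assms(2) by (auto simp: sum_list_distinct_conv_sum_set)

text \<open>The rise of \<open>level\<close> along an edge is at most its \<rho>-length. After
  summation, equality over the path forces equality, hence direction, at each edge.\<close>

lemma path_level:
  assumes "path_via G xs \<gamma>" "\<forall>e\<in>set \<gamma>. 0 < \<rho> e"
  shows "level (last xs) \<le> level (hd xs) + sum_list (map \<rho> \<gamma>) \<and>
    (level (last xs) = level (hd xs) + sum_list (map \<rho> \<gamma>) \<longrightarrow> dwalk (hd xs) \<gamma> (last xs))"
  using assms
proof (induction rule: path_via_induct)
  case (Cons x y ys e \<gamma>)
  then have IH: "level (last (y # ys)) \<le> level y + sum_list (map \<rho> \<gamma>)"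
    "level (last (y # ys)) = level y + sum_list (map \<rho> \<gamma>) \<longrightarrow> dwalk y \<gamma> (last (y # ys))"
    by simp_all
  moreover have "level y \<le> level x + \<rho> e"
    using level_edge Cons.hyps by blast
  moreover have "0 < \<rho> e"
    using Cons.prems by simp
  ultimately show ?case
    using Cons.hyps(3,4) by (auto simp: directed_def)
qed simp

lemma tight_dwalk:
  assumes "\<gamma> \<in> P" "\<forall>e\<in>set \<gamma>. 0 < \<rho> e" "(\<Sum>e\<in>set \<gamma>. \<rho> e) = 1"
  shows "\<exists>x\<in>A. \<exists>y\<in>B. dwalk x \<gamma> y"
proof -
  obtain xs where xs: "path_via G xs \<gamma>" "hd xs \<in> A" "last xs \<in> B"
    using assms(1) by (rule paths_betweenE)
  have "sum_list (map \<rho> \<gamma>) = 1"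
    using assms(3) path_via_distinct[OF xs(1)] by (simp add: sum_list_distinct_conv_sum_set)
  then have "dwalk (hd xs) \<gamma> (last xs)"
    using path_level[OF xs(1) assms(2)] level_A[OF xs(2)] level_B[OF xs(3)] by simp
  then show ?thesis
    using xs by blast
qed

lemma dwalk_predecessor:
  assumes "dwalk x \<gamma> y" "e \<in> set \<gamma>" "directed e u v" "u \<noteq> x"
  shows "\<exists>e'\<in>set \<gamma>. \<exists>w. directed e' w u"
  using assms
proof (induction \<gamma> arbitrary: x)
  case (Cons f \<gamma>)
  then obtain z where z: "directed f x z" "dwalk z \<gamma> y"
    by auto
  have "e \<in> set \<gamma>"
    using Cons.prems directed_unique z(1) by force
  then show ?case
    using Cons.IH[OF z(2)] Cons.prems z(1) by (cases "u = z") auto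
qed simp

lemma dwalk_successor:
  assumes "dwalk x \<gamma> y" "e \<in> set \<gamma>" "directed e u v" "v \<noteq> y"
  shows "\<exists>e'\<in>set \<gamma>. \<exists>w. directed e' v w"
  using assms
proof (induction \<gamma> arbitrary: x)
  case (Cons f \<gamma>)
  then obtain z where z: "directed f x z" "dwalk z \<gamma> y"
    by auto
  show ?case
  proof (cases "e \<in> set \<gamma>")
    case True
    then show ?thesis
      using Cons.IH[OF z(2)] Cons.prems by auto
  next
    case False
    then have "z = v"
      using Cons.prems directed_unique z(1) by force
    then obtain g \<delta> where "\<gamma> = g # \<delta>"
      using z(2) Cons.prems(4) by (cases \<gamma>) auto
    then show ?thesis
      using z(2) \<open>z = v\<close> by auto
  qed
qed simp

lemma dwalk_directed: "dwalk x \<gamma> y \<Longrightarrow> e \<in> set \<gamma> \<Longrightarrow> \<exists>u v. directed e u v"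
  by (induction \<gamma> arbitrary: x) auto

text \<open>The recursion ends because each further edge lowers the number of vertices at a higher
  level.\<close>

lemma extend_forward:
  assumes "e \<in> K" "directed e u v"
    and K: "\<And>e u v. e \<in> K \<Longrightarrow> directed e u v \<Longrightarrow> v \<notin> B \<Longrightarrow> \<exists>e'\<in>K. \<exists>w. directed e' v w"
  shows "\<exists>\<gamma>. \<exists>y\<in>B. dwalk v \<gamma> y \<and> set \<gamma> \<subseteq> K"
  using assms(1,2)
proof (induction "card {w \<in> verts G. level v < level w}" arbitrary: e u v rule: less_induct)
  case less
  show ?case
  proof (cases "v \<in> B")
    case True
    then show ?thesis
      by (intro exI[of _ "[]"]) auto
  next
    case False
    then obtain f w where f: "f \<in> K" "directed f v w"
      using K less.prems by blast
    then have "level v < level w" "w \<in> verts G"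
      using directed_verts by (auto simp: directed_def)
    then have "card {z \<in> verts G. level w < level z} < card {z \<in> verts G. level v < level z}"
      using finite_verts by (intro psubset_card_mono) auto
    from less.hyps[OF this f] obtain \<gamma> y where "y \<in> B" "dwalk w \<gamma> y" "set \<gamma> \<subseteq> K"
      by blast
    then show ?thesis
      using f by (intro exI[of _ "f # \<gamma>"]) auto
  qed
qed

lemma extend_backward:
  assumes "e \<in> K" "directed e u v"
    and K: "\<And>e u v. e \<in> K \<Longrightarrow> directed e u v \<Longrightarrow> u \<notin> A \<Longrightarrow> \<exists>e'\<in>K. \<exists>w. directed e' w u"
  shows "\<exists>\<gamma>. \<exists>x\<in>A. dwalk x \<gamma> u \<and> set \<gamma> \<subseteq> K"
  using assms(1,2)
proof (induction "card {w \<in> verts G. level w < level u}" arbitrary: e u v rule: less_induct)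
  case less
  show ?case
  proof (cases "u \<in> A")
    case True
    then show ?thesis
      by (intro exI[of _ "[]"]) auto
  next
    case False
    then obtain f w where f: "f \<in> K" "directed f w u"
      using K less.prems by blast
    then have "level w < level u" "w \<in> verts G"
      using directed_verts by (auto simp: directed_def)
    then have "card {z \<in> verts G. level z < level w} < card {z \<in> verts G. level z < level u}"
      using finite_verts by (intro psubset_card_mono) auto
    from less.hyps[OF this f] obtain \<gamma> x where "x \<in> A" "dwalk x \<gamma> w" "set \<gamma> \<subseteq> K"
      by blast
    then show ?thesis
      using f by (intro exI[of _ "\<gamma> @ [f]"]) (auto simp: dwalk_append)
  qed
qed

text \<open>\<open>K\<close> stays abstract for two applications: the whole support of a flow, and
  the part of it on or above a given path.\<close>

lemma extend_to_path:
  assumes "e \<in> K" "directed e u v"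
    and "\<And>e u v. e \<in> K \<Longrightarrow> directed e u v \<Longrightarrow> u \<notin> A \<Longrightarrow> \<exists>e'\<in>K. \<exists>w. directed e' w u"
    and "\<And>e u v. e \<in> K \<Longrightarrow> directed e u v \<Longrightarrow> v \<notin> B \<Longrightarrow> \<exists>e'\<in>K. \<exists>w. directed e' v w"
  shows "\<exists>\<gamma>. \<exists>x\<in>A. \<exists>y\<in>B. dwalk x \<gamma> y \<and> e \<in> set \<gamma> \<and> set \<gamma> \<subseteq> K"
proof -
  have "\<exists>\<gamma>. \<exists>x\<in>A. dwalk x \<gamma> u \<and> set \<gamma> \<subseteq> K"
    by (rule extend_backward[OF assms(1,2)]) (rule assms(3))
  moreover have "\<exists>\<delta>. \<exists>y\<in>B. dwalk v \<delta> y \<and> set \<delta> \<subseteq> K"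
    by (rule extend_forward[OF assms(1,2)]) (rule assms(4))
  ultimately obtain \<gamma> x \<delta> y where "x \<in> A" "dwalk x \<gamma> u" "set \<gamma> \<subseteq> K" "y \<in> B" "dwalk v \<delta> y" "set \<delta> \<subseteq> K"
    by blast
  then show ?thesis
    using assms(1,2) by (intro exI[of _ "\<gamma> @ e # \<delta>"]) (auto simp: dwalk_append)
qed

section \<open>Flows conserved away from the terminals\<close>

definition incidence :: "'e \<Rightarrow> complex \<Rightarrow> real" where
  "incidence e v = of_bool (\<exists>u. directed e u v) - of_bool (\<exists>u. directed e v u)"

text \<open>The sum is the net inflow at \<open>v\<close>, as \<open>incidence\<close> is 1 at the
  head of an edge and -1 at its tail. Edges without a direction have incidence 0 and are required to
  carry no flow.\<close>

definition flow :: "('e \<Rightarrow> real) \<Rightarrow> bool" where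
  "flow r \<longleftrightarrow> (\<forall>e\<in>edges G. 0 \<le> r e \<and> (r e \<noteq> 0 \<longrightarrow> (\<exists>u v. directed e u v))) \<and>
     (\<forall>v\<in>verts G - A - B. (\<Sum>e\<in>edges G. r e * incidence e v) = 0)"

lemma incidence_directed:
  assumes "directed e u v"
  shows "incidence e w = of_bool (w = v) - of_bool (w = u)"
proof -
  have "(\<exists>z. directed e z w) \<longleftrightarrow> w = v" "(\<exists>z. directed e w z) \<longleftrightarrow> w = u"
    using assms directed_unique by blast+
  then show ?thesis
    by (simp add: incidence_def)
qed

lemma dwalk_incidence: "dwalk x \<gamma> y \<Longrightarrow> (\<Sum>e\<leftarrow>\<gamma>. incidence e v) = of_bool (v = y) - of_bool (v = x)"
  by (induction \<gamma> arbitrary: x) (auto simp: incidence_directed)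

lemma dwalk_conserved:
  assumes "dwalk x \<gamma> y" "x \<in> A" "y \<in> B" "v \<in> verts G - A - B"
  shows "(\<Sum>e\<in>set \<gamma>. incidence e v) = 0"
  using dwalk_incidence[OF assms(1), of v] dwalk_distinct[OF assms(1)] assms terminals(1)
  by (auto simp: sum_list_distinct_conv_sum_set)

lemma sum_edges_of_bool:
  assumes "set \<gamma> \<subseteq> edges G"
  shows "(\<Sum>e\<in>edges G. f e * of_bool (e \<in> set \<gamma>)) = (\<Sum>e\<in>set \<gamma>. f e :: real)"
proof -
  have "edges G \<inter> set \<gamma> = set \<gamma>"
    using assms by auto
  then show ?thesis
    using sum.inter_restrict[OF finite_edges, of f "set \<gamma>"]
    by (simp add: of_bool_def if_distrib cong: if_cong)
qed

lemma flow_combination: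
  assumes "finite \<Gamma>" "\<And>\<gamma>. \<gamma> \<in> \<Gamma> \<Longrightarrow> 0 \<le> m \<gamma>"
    and paths: "\<And>\<gamma>. \<gamma> \<in> \<Gamma> \<Longrightarrow> m \<gamma> \<noteq> 0 \<Longrightarrow> \<exists>x\<in>A. \<exists>y\<in>B. dwalk x \<gamma> y"
    and r: "\<And>e. e \<in> edges G \<Longrightarrow> r e = (\<Sum>\<gamma>\<in>\<Gamma>. m \<gamma> * of_bool (e \<in> set \<gamma>))"
  shows "flow r"
  unfolding flow_def
proof (intro conjI ballI impI)
  fix e assume e: "e \<in> edges G"
  show "0 \<le> r e"
    using r[OF e] assms(2) by (auto intro: sum_nonneg)
  assume "r e \<noteq> 0"
  then obtain \<gamma> where "\<gamma> \<in> \<Gamma>" "m \<gamma> \<noteq> 0" "e \<in> set \<gamma>"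
    using r[OF e] sum.neutral[of \<Gamma> "\<lambda>\<gamma>. m \<gamma> * of_bool (e \<in> set \<gamma>)"] by force
  then show "\<exists>u v. directed e u v"
    using paths dwalk_directed by blast
next
  fix v assume v: "v \<in> verts G - A - B"
  have "(\<Sum>e\<in>edges G. r e * incidence e v) =
      (\<Sum>e\<in>edges G. \<Sum>\<gamma>\<in>\<Gamma>. m \<gamma> * (incidence e v * of_bool (e \<in> set \<gamma>)))"
    by (intro sum.cong) (auto simp: r sum_distrib_left mult_ac)
  also have "\<dots> = (\<Sum>\<gamma>\<in>\<Gamma>. m \<gamma> * (\<Sum>e\<in>edges G. incidence e v * of_bool (e \<in> set \<gamma>)))"
    by (subst sum.swap) (simp add: sum_distrib_left)
  also have "\<dots> = 0"
  proof (intro sum.neutral ballI)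
    fix \<gamma> assume "\<gamma> \<in> \<Gamma>"
    show "m \<gamma> * (\<Sum>e\<in>edges G. incidence e v * of_bool (e \<in> set \<gamma>)) = 0"
    proof (cases "m \<gamma> = 0")
      case False
      then obtain x y where xy: "x \<in> A" "y \<in> B" "dwalk x \<gamma> y"
        using paths \<open>\<gamma> \<in> \<Gamma>\<close> by blast
      then have "set \<gamma> \<subseteq> edges G"
        using dwalk_in_paths paths_between_edges by blast
      then show ?thesis
        using dwalk_conserved[OF xy(3,1,2) v] by (simp add: sum_edges_of_bool)
    qed simp
  qed
  finally show "(\<Sum>e\<in>edges G. r e * incidence e v) = 0" .
qed

lemma flow_diff_path:
  assumes "flow r" "dwalk x \<gamma> y" "x \<in> A" "y \<in> B"
    and c: "\<And>e. e \<in> set \<gamma> \<Longrightarrow> c \<le> r e \<and> r e \<noteq> 0"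
  shows "flow (\<lambda>e. if e \<in> set \<gamma> then r e - c else r e)"
  unfolding flow_def
proof (intro conjI ballI impI)
  fix e assume e: "e \<in> edges G"
  show "0 \<le> (if e \<in> set \<gamma> then r e - c else r e)"
    using assms(1) c[of e] e by (auto simp: flow_def)
  assume "(if e \<in> set \<gamma> then r e - c else r e) \<noteq> 0"
  then show "\<exists>u v. directed e u v"
    using assms(1) c[of e] e by (auto simp: flow_def split: if_splits)
next
  fix v assume v: "v \<in> verts G - A - B"
  have "set \<gamma> \<subseteq> edges G"
    using dwalk_in_paths[OF assms(2-4)] by (rule paths_between_edges)
  have "(\<Sum>e\<in>edges G. (if e \<in> set \<gamma> then r e - c else r e) * incidence e v) =
      (\<Sum>e\<in>edges G. r e * incidence e v - c * (incidence e v * of_bool (e \<in> set \<gamma>)))"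
    by (intro sum.cong) (auto simp: algebra_simps)
  also have "\<dots> = (\<Sum>e\<in>edges G. r e * incidence e v) - c * (\<Sum>e\<in>set \<gamma>. incidence e v)"
    using \<open>set \<gamma> \<subseteq> edges G\<close> by (simp add: sum_subtractf sum_edges_of_bool flip: sum_distrib_left)
  also have "\<dots> = 0"
    using assms(1) v dwalk_conserved[OF assms(2-4) v] by (simp add: flow_def)
  finally show "(\<Sum>e\<in>edges G. (if e \<in> set \<gamma> then r e - c else r e) * incidence e v) = 0" .
qed

text \<open>If nothing entered \<open>u\<close>, every term of the net outflow would be nonnegative
  and that of \<open>e\<close> positive. Conservation holds at \<open>u\<close> because its level is
  below 1, which keeps it out of \<open>B\<close>.\<close>

lemma flow_predecessor:
  assumes r: "flow r" and e: "e \<in> current_graph G r" "directed e u v" and "u \<notin> A"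
  shows "\<exists>e'\<in>current_graph G r. \<exists>w. directed e' w u"
proof (rule ccontr)
  assume none: "\<not> ?thesis"
  have "0 < level v" "level u < level v"
    using e(2) level_nonneg[of u] by (auto simp: directed_def)
  then have "u \<in> verts G - A - B"
    using directed_verts[OF e(2)] \<open>u \<notin> A\<close> level_B[of u] level_le_1[of v] by auto
  then have zero: "(\<Sum>f\<in>edges G. - (r f * incidence f u)) = 0"
    using r by (simp add: flow_def sum_negf)
  have nonneg: "0 \<le> - (r f * incidence f u)" if "f \<in> edges G" for f
  proof (cases "r f = 0")
    case False
    then have "\<not> (\<exists>w. directed f w u)" "0 \<le> r f"
      using none that r by (auto simp: current_graph_def flow_def)
    then show ?thesis
      by (simp add: incidence_def)
  qed simp
  have "e \<in> edges G" "0 < r e"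
    using e(1) r by (auto simp: current_graph_def flow_def less_le)
  moreover have "incidence e u = -1"
    using incidence_directed[OF e(2), of u] \<open>level u < level v\<close> by auto
  ultimately have "0 < (\<Sum>f\<in>edges G. - (r f * incidence f u))"
    using nonneg by (intro sum_pos2[OF finite_edges, of e]) auto
  with zero show False by simp
qed

text \<open>Mirror image of \<open>flow_predecessor\<close>: the level of \<open>v\<close> is above
  0, which keeps it out of \<open>A\<close>.\<close>

lemma flow_successor:
  assumes r: "flow r" and e: "e \<in> current_graph G r" "directed e u v" and "v \<notin> B"
  shows "\<exists>e'\<in>current_graph G r. \<exists>w. directed e' v w"
proof (rule ccontr)
  assume none: "\<not> ?thesis"
  have "0 < level v" "level u < level v"
    using e(2) level_nonneg[of u] by (auto simp: directed_def)
  then have "v \<in> verts G - A - B"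
    using directed_verts[OF e(2)] \<open>v \<notin> B\<close> level_A[of v] by auto
  then have zero: "(\<Sum>f\<in>edges G. r f * incidence f v) = 0"
    using r by (simp add: flow_def)
  have nonneg: "0 \<le> r f * incidence f v" if "f \<in> edges G" for f
  proof (cases "r f = 0")
    case False
    then have "\<not> (\<exists>w. directed f v w)" "0 \<le> r f"
      using none that r by (auto simp: current_graph_def flow_def)
    then show ?thesis
      by (simp add: incidence_def)
  qed simp
  have "e \<in> edges G" "0 < r e"
    using e(1) r by (auto simp: current_graph_def flow_def less_le)
  moreover have "incidence e v = 1"
    using incidence_directed[OF e(2), of v] \<open>level u < level v\<close> by auto
  ultimately have "0 < (\<Sum>f\<in>edges G. r f * incidence f v)"
    using nonneg by (intro sum_pos2[OF finite_edges, of e]) auto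
  with zero show False by simp
qed

end

section \<open>Paths ordered by their lower components\<close>

locale rectangle_network =
  fixes G :: "'e network" and C S1 S2 A B :: "complex set"
    and L :: real and F :: "complex \<Rightarrow> complex"
  assumes network: "finite_plane_network G"
    and encircled: "drawing G \<subseteq> inside C \<union> C"
    and arcs: "S1 \<subseteq> C" "S2 \<subseteq> C" "S1 \<inter> S2 = {}"
    and A_eq: "A = S1 \<inter> verts G" and B_eq: "B = S2 \<inter> verts G"
    and rectangle: "rectangle_map C S1 S2 L F"
    and contact: "\<forall>\<gamma>\<in>paths_between G A B. edge_trace G (set \<gamma>) \<inter> (S1 \<union> S2) \<subseteq> verts G"
begin

sublocale terminal_network G A B
  using network arcs by unfold_locales (auto simp: A_eq B_eq)

lemma L_pos: "0 < L"
  and F_cont: "continuous_on (inside C \<union> C) F"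
  and F_inj: "inj_on F (inside C \<union> C)"
  and F_image: "F ` (inside C \<union> C) = cbox 0 (Complex L 1)"
  and F_S1: "F ` S1 = {z. Re z = 0 \<and> 0 \<le> Im z \<and> Im z \<le> 1}"
  and F_S2: "F ` S2 = {z. Re z = L \<and> 0 \<le> Im z \<and> Im z \<le> 1}"
proof -
  obtain F' where F': "homeomorphism (inside C \<union> C) (cbox 0 (Complex L 1)) F F'"
    using rectangle by (auto simp: rectangle_map_def)
  then show "continuous_on (inside C \<union> C) F" "F ` (inside C \<union> C) = cbox 0 (Complex L 1)"
    by (simp_all add: homeomorphism_def)
  show "inj_on F (inside C \<union> C)"
    using F' by (metis homeomorphism_apply1 inj_on_inverseI)
  show "0 < L"
    using rectangle by (simp add: rectangle_map_def)
  show "F ` S1 = {z. Re z = 0 \<and> 0 \<le> Im z \<and> Im z \<le> 1}" "F ` S2 = {z. Re z = L \<and> 0 \<le> Im z \<and> Im z \<le> 1}"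
    using rectangle by (auto simp: rectangle_map_def closed_segment_same_Re closed_segment_eq_real_ivl)
qed

lemma edge_trace_encircled: "H \<subseteq> edges G \<Longrightarrow> edge_trace G H \<subseteq> inside C \<union> C"
  using encircled by (fastforce simp: drawing_def edge_trace_def)

abbreviation path_trace :: "'e list \<Rightarrow> complex set" where
  "path_trace \<gamma> \<equiv> F ` edge_trace G (set \<gamma>)"

lemma edge_trace_image_strip:
  assumes "H \<subseteq> edges G"
  shows "F ` edge_trace G H \<subseteq> cbox 0 (Complex L 1)" "F ` edge_trace G H \<subseteq> strip L"
proof -
  show *: "F ` edge_trace G H \<subseteq> cbox 0 (Complex L 1)"
    using image_mono[OF edge_trace_encircled[OF assms], of F] by (simp only: F_image)
  show "F ` edge_trace G H \<subseteq> strip L"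
    using * by (auto simp: strip_def in_cbox_complex_iff)
qed

text \<open>By \<open>contact\<close> a point of the path on \<open>S1\<close> or \<open>S2\<close>
  is a vertex of it, hence a terminal, and a path from \<open>A\<close> to \<open>B\<close> has no
  terminals but its ends. Injectivity of \<open>F\<close> carries this over to the vertical
  sides.\<close>

lemma path_crosscut:
  assumes "\<gamma> \<in> P"
  obtains g where "arc g" "path_image g = path_trace \<gamma>" "Re (pathstart g) = 0" "Re (pathfinish g) = L"
    "\<And>z. z \<in> path_image g \<Longrightarrow> Re z = 0 \<Longrightarrow> z = pathstart g"
    "\<And>z. z \<in> path_image g \<Longrightarrow> Re z = L \<Longrightarrow> z = pathfinish g"
proof -
  obtain xs where xs: "path_via G xs \<gamma>" "hd xs \<in> A" "last xs \<in> B" "set xs \<inter> (A \<union> B) = {hd xs, last xs}" "\<gamma> \<noteq> []"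
    using assms by (rule paths_betweenE)
  obtain h where h: "arc h" "path_image h = edge_trace G (set \<gamma>)" "pathstart h = hd xs" "pathfinish h = last xs"
    using path_arc[OF xs(1,5)] by blast
  have \<gamma>: "set \<gamma> \<subseteq> edges G"
    using assms by (rule paths_between_edges)
  note enc = edge_trace_encircled[OF \<gamma>]
  have h_enc: "h ` {0..1} \<subseteq> inside C \<union> C"
    using enc h(2) by (simp add: path_image_def)
  have "continuous_on {0..1} (F \<circ> h)"
    using h(1) continuous_on_compose2[OF F_cont _ h_enc] by (simp add: arc_def path_def o_def)
  moreover have "inj_on (F \<circ> h) {0..1}"
    using h(1) inj_on_subset[OF F_inj h_enc] by (intro comp_inj_on) (simp_all add: arc_def)
  ultimately have "arc (F \<circ> h)"
    by (simp add: arc_def path_def)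
  moreover have image: "path_image (F \<circ> h) = path_trace \<gamma>"
    using h(2) by (simp add: path_image_compose)
  moreover have "F (hd xs) \<in> F ` S1" "F (last xs) \<in> F ` S2"
    using xs(2,3) by (auto simp: A_eq B_eq)
  then have "Re (pathstart (F \<circ> h)) = 0" "Re (pathfinish (F \<circ> h)) = L"
    using F_S1 F_S2 h(3,4) by (auto simp: pathstart_compose pathfinish_compose)
  moreover have vertex: "z \<in> set xs" if "z \<in> edge_trace G (set \<gamma>)" "z \<in> S1 \<union> S2" for z
  proof -
    have "z \<in> edge_trace G (set \<gamma>) \<inter> verts G"
      using contact assms that by auto
    then show ?thesis
      using edge_trace_verts[OF \<gamma>] path_via_incident[OF xs(1,5)] by simp
  qed
  have preimage: "\<exists>w\<in>edge_trace G (set \<gamma>) \<inter> S. z = F w"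
    if z: "z \<in> path_trace \<gamma>" "z \<in> F ` S" "S \<subseteq> C" for z S
  proof -
    obtain w s where ws: "w \<in> edge_trace G (set \<gamma>)" "z = F w" "s \<in> S" "z = F s"
      using z(1,2) by blast
    then have "w = s"
      using inj_onD[OF F_inj, of w s] subsetD[OF enc, of w] subsetD[OF z(3), of s] by simp
    then show ?thesis
      using ws by blast
  qed
  have box: "0 \<le> Im z \<and> Im z \<le> 1" if "z \<in> path_trace \<gamma>" for z
    using edge_trace_image_strip(1)[OF \<gamma>] that by (auto simp: in_cbox_complex_iff)
  have "z = pathstart (F \<circ> h)" if z: "z \<in> path_image (F \<circ> h)" "Re z = 0" for z
  proof -
    have "z \<in> F ` S1"
      using z box[of z] by (simp add: F_S1 image)
    then obtain w where w: "w \<in> edge_trace G (set \<gamma>)" "w \<in> S1" "z = F w"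
      using preimage[of z S1] z arcs by (auto simp: image)
    then have "w \<in> set xs" "w \<in> verts G"
      using vertex[of w] xs(1) by (auto simp: path_via_def)
    then have "w = hd xs"
      using w(2) xs(3,4) terminals(3) by (auto simp: A_eq B_eq)
    then show ?thesis
      using w(3) h(3) by (simp add: pathstart_compose)
  qed
  moreover have "z = pathfinish (F \<circ> h)" if z: "z \<in> path_image (F \<circ> h)" "Re z = L" for z
  proof -
    have "z \<in> F ` S2"
      using z box[of z] by (simp add: F_S2 image)
    then obtain w where w: "w \<in> edge_trace G (set \<gamma>)" "w \<in> S2" "z = F w"
      using preimage[of z S2] z arcs by (auto simp: image)
    then have "w \<in> set xs" "w \<in> verts G"
      using vertex[of w] xs(1) by (auto simp: path_via_def)
    then have "w = last xs"
      using w(2) xs(2,4) terminals(3) by (auto simp: A_eq B_eq)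
    then show ?thesis
      using w(3) h(4) by (simp add: pathfinish_compose)
  qed
  ultimately show thesis
    using that by blast
qed

section \<open>The two sides of a path in the strip\<close>

abbreviation Low :: "'e list \<Rightarrow> complex set" where
  "Low \<gamma> \<equiv> lower_component G L F \<gamma>"

text \<open>The point 2i lies above the rectangle, hence on no path, just as -i lies below
  it.\<close>

definition Up :: "'e list \<Rightarrow> complex set" where
  "Up \<gamma> = connected_component_set (strip L - path_trace \<gamma>) (2 * \<i>)"

lemma sides:
  assumes "\<gamma> \<in> P"
  shows Low_Un_Up: "Low \<gamma> \<union> Up \<gamma> = strip L - path_trace \<gamma>" and Low_Int_Up: "Low \<gamma> \<inter> Up \<gamma> = {}"
    and Low_closure: "closure (Low \<gamma>) = Low \<gamma> \<union> path_trace \<gamma>" and Up_closure: "closure (Up \<gamma>) = Up \<gamma> \<union> path_trace \<gamma>"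
    and Low_mem: "- \<i> \<in> Low \<gamma>" and Up_mem: "2 * \<i> \<in> Up \<gamma>"
proof -
  obtain g where g: "arc g" "path_image g = path_trace \<gamma>" "Re (pathstart g) = 0" "Re (pathfinish g) = L"
    "\<And>z. z \<in> path_image g \<Longrightarrow> Re z = 0 \<Longrightarrow> z = pathstart g"
    "\<And>z. z \<in> path_image g \<Longrightarrow> Re z = L \<Longrightarrow> z = pathfinish g"
    by (rule path_crosscut[OF assms]) (rule that, assumption+)
  have "path_image g \<subseteq> cbox 0 (Complex L 1)"
    unfolding g(2) by (rule edge_trace_image_strip(1)[OF paths_between_edges[OF assms]])
  note J = crosscut_separates_strip[OF g(1) L_pos this g(3,5,4,6), unfolded g(2)]
  note defs = strip_def Up_def lower_component_def
  show "Low \<gamma> \<union> Up \<gamma> = strip L - path_trace \<gamma>"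
    unfolding defs by (rule J(1))
  show "Low \<gamma> \<inter> Up \<gamma> = {}"
    unfolding defs by (rule J(2))
  show "- \<i> \<in> Low \<gamma>" "2 * \<i> \<in> Up \<gamma>"
    unfolding defs using J(7,8) by blast+
  have closed: "closed (Low \<gamma> \<union> path_trace \<gamma>)" "closed (Up \<gamma> \<union> path_trace \<gamma>)"
    unfolding defs using J(3,4) by blast+
  have boundary: "path_trace \<gamma> \<subseteq> closure (Low \<gamma>)" "path_trace \<gamma> \<subseteq> closure (Up \<gamma>)"
    unfolding defs using J(5,6) by blast+
  have "closure (Low \<gamma>) \<subseteq> Low \<gamma> \<union> path_trace \<gamma>"
    using closed by (intro closure_minimal) auto
  then show "closure (Low \<gamma>) = Low \<gamma> \<union> path_trace \<gamma>"
    using boundary closure_subset[of "Low \<gamma>"] by (intro subset_antisym) auto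
  have "closure (Up \<gamma>) \<subseteq> Up \<gamma> \<union> path_trace \<gamma>"
    using closed by (intro closure_minimal) auto
  then show "closure (Up \<gamma>) = Up \<gamma> \<union> path_trace \<gamma>"
    using boundary closure_subset[of "Up \<gamma>"] by (intro subset_antisym) auto
qed

text \<open>\<open>Low \<gamma>\<close> is connected, contains -i and avoids the other path.\<close>

lemma Low_subset_if_disjoint:
  assumes "\<gamma> \<in> P" "\<delta> \<in> P" "path_trace \<delta> \<inter> Low \<gamma> = {}"
  shows "Low \<gamma> \<subseteq> Low \<delta>"
proof -
  have "Low \<gamma> \<subseteq> strip L"
    using Low_Un_Up[OF assms(1)] by auto
  then have "Low \<gamma> \<subseteq> strip L - path_trace \<delta>"
    using assms(3) by auto
  moreover have "connected (Low \<gamma>)"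
    unfolding lower_component_def by (rule connected_connected_component)
  ultimately show ?thesis
    unfolding lower_component_def[of G L F \<delta>] using Low_mem[OF assms(1)]
    by (intro connected_component_maximal)
qed

lemma Up_subset_if_disjoint:
  assumes "\<gamma> \<in> P" "\<delta> \<in> P" "path_trace \<delta> \<inter> Up \<gamma> = {}"
  shows "Up \<gamma> \<subseteq> Up \<delta>"
proof -
  have "Up \<gamma> \<subseteq> strip L"
    using Low_Un_Up[OF assms(1)] by auto
  then have "Up \<gamma> \<subseteq> strip L - path_trace \<delta>"
    using assms(3) by auto
  moreover have "connected (Up \<gamma>)"
    unfolding Up_def by (rule connected_connected_component)
  ultimately show ?thesis
    unfolding Up_def[of \<delta>] using Up_mem[OF assms(1)]
    by (intro connected_component_maximal)
qed

lemma trace_eq: "\<gamma> \<in> P \<Longrightarrow> path_trace \<gamma> = closure (Low \<gamma>) - Low \<gamma>"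
  using Low_closure[of \<gamma>] Low_Un_Up[of \<gamma>] by auto

text \<open>From left to right the argument passes through the upper sides. A path
  \<open>\<delta>\<close> in the closure of \<open>Low \<gamma>\<close> misses
  \<open>Up \<gamma>\<close>, so \<open>Up \<gamma> \<subseteq> Up \<delta>\<close>, and complements
  leave only points of \<open>\<gamma>\<close> itself to be excluded. These are limits of
  \<open>Up \<gamma>\<close>, so they lie in the closure of \<open>Up \<delta>\<close>, which misses
  \<open>Low \<delta>\<close>.\<close>

lemma below_iff:
  assumes "\<gamma> \<in> P" "\<delta> \<in> P"
  shows "path_trace \<delta> \<subseteq> closure (Low \<gamma>) \<longleftrightarrow> Low \<delta> \<subseteq> Low \<gamma>"
proof
  assume "Low \<delta> \<subseteq> Low \<gamma>"
  then have "closure (Low \<delta>) \<subseteq> closure (Low \<gamma>)"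
    by (rule closure_mono)
  then show "path_trace \<delta> \<subseteq> closure (Low \<gamma>)"
    using trace_eq[OF assms(2)] by auto
next
  assume *: "path_trace \<delta> \<subseteq> closure (Low \<gamma>)"
  have "Low \<gamma> \<union> path_trace \<gamma> \<subseteq> - Up \<gamma>"
    using Low_Un_Up[OF assms(1)] Low_Int_Up[OF assms(1)] by auto
  with * have "path_trace \<delta> \<subseteq> - Up \<gamma>"
    unfolding Low_closure[OF assms(1)] by (rule order_trans)
  then have "path_trace \<delta> \<inter> Up \<gamma> = {}"
    by auto
  then have Up: "Up \<gamma> \<subseteq> Up \<delta>"
    using assms by (intro Up_subset_if_disjoint)
  then have "Low \<delta> \<subseteq> strip L - Up \<gamma>"
    using Low_Un_Up[OF assms(2)] Low_Int_Up[OF assms(2)] by auto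
  then have "Low \<delta> \<subseteq> Low \<gamma> \<union> path_trace \<gamma>"
    using Low_Un_Up[OF assms(1)] by auto
  moreover have "path_trace \<gamma> \<subseteq> closure (Up \<delta>)"
    using Up_closure[OF assms(1)] closure_mono[OF Up] by auto
  moreover have "Up \<delta> \<union> path_trace \<delta> \<subseteq> - Low \<delta>"
    using Low_Int_Up[OF assms(2)] Low_Un_Up[OF assms(2)] by auto
  ultimately have "path_trace \<gamma> \<subseteq> - Low \<delta>" "Low \<delta> \<subseteq> Low \<gamma> \<union> path_trace \<gamma>"
    unfolding Up_closure[OF assms(2)] by (blast dest: order_trans)+
  then show "Low \<delta> \<subseteq> Low \<gamma>" by blast
qed

text \<open>The drawn path is recovered as the closure of its lower side minus that side. So
  inclusion of lower sides is antisymmetric on \<open>P\<close>.\<close>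

lemma Low_inj:
  assumes "\<gamma> \<in> P" "\<delta> \<in> P" "Low \<gamma> = Low \<delta>"
  shows "\<gamma> = \<delta>"
proof -
  have edges: "set \<gamma> \<subseteq> edges G" "set \<delta> \<subseteq> edges G"
    using assms(1,2) by (auto dest: paths_between_edges)
  have "path_trace \<gamma> = path_trace \<delta>"
    using trace_eq[OF assms(1)] trace_eq[OF assms(2)] assms(3) by simp
  then have "edge_trace G (set \<gamma>) = edge_trace G (set \<delta>)"
    using inj_on_image_eq_iff[OF F_inj edge_trace_encircled[OF edges(1)] edge_trace_encircled[OF edges(2)]]
    by simp
  then have "set \<gamma> = set \<delta>"
    using edge_trace_mono_iff[OF edges] edge_trace_mono_iff[OF edges(2,1)] by simp
  then show ?thesis
    using assms(1,2) by (rule paths_between_eq[rotated 2])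
qed

text \<open>A point on both outer paths lies in the closure of \<open>Low \<epsilon>\<close>, hence
  in that of \<open>Low \<delta>\<close>, but outside \<open>Low \<gamma>\<close>, hence outside
  \<open>Low \<delta>\<close>. That leaves the path \<open>\<delta>\<close>.\<close>

lemma edges_between:
  assumes "\<gamma> \<in> P" "\<delta> \<in> P" "\<epsilon> \<in> P" "Low \<epsilon> \<subseteq> Low \<delta>" "Low \<delta> \<subseteq> Low \<gamma>"
  shows "set \<gamma> \<inter> set \<epsilon> \<subseteq> set \<delta>"
proof -
  have edges: "set \<gamma> \<inter> set \<epsilon> \<subseteq> edges G" "set \<delta> \<subseteq> edges G"
    using assms(1,2) by (auto dest: paths_between_edges)
  have "path_trace \<gamma> \<inter> path_trace \<epsilon> \<subseteq> path_trace \<delta>"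
    using trace_eq[OF assms(1)] trace_eq[OF assms(2)] trace_eq[OF assms(3)]
      closure_mono[OF assms(4)] assms(5) by auto
  moreover have "F ` edge_trace G (set \<gamma> \<inter> set \<epsilon>) \<subseteq> path_trace \<gamma> \<inter> path_trace \<epsilon>"
    by (intro Int_greatest image_mono) (auto simp: edge_trace_def)
  ultimately have "F ` edge_trace G (set \<gamma> \<inter> set \<epsilon>) \<subseteq> path_trace \<delta>"
    by (rule order_trans[rotated])
  then have "edge_trace G (set \<gamma> \<inter> set \<epsilon>) \<subseteq> edge_trace G (set \<delta>)"
    using inj_on_image_subset_iff[OF F_inj edge_trace_encircled[OF edges(1)] edge_trace_encircled[OF edges(2)]]
    by simp
  then show ?thesis
    using edge_trace_mono_iff[OF edges] by simp
qed

lemma edge_trace_UN: "F ` edge_trace G (\<Union>\<gamma>\<in>\<Gamma>. set \<gamma>) = (\<Union>\<gamma>\<in>\<Gamma>. path_trace \<gamma>)"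
  by (auto simp: edge_trace_def)

section \<open>Top paths as greatest elements\<close>

lemma top_path_of_family:
  assumes "\<Gamma> \<subseteq> P" "\<gamma> \<in> \<Gamma>" "\<And>\<delta>. \<delta> \<in> \<Gamma> \<Longrightarrow> Low \<delta> \<subseteq> Low \<gamma>"
  shows "top_path G A B L F (\<Union>\<gamma>\<in>\<Gamma>. set \<gamma>) \<gamma>"
proof -
  have "path_trace \<delta> \<subseteq> closure (Low \<gamma>)" if "\<delta> \<in> \<Gamma>" for \<delta>
    using below_iff[of \<gamma> \<delta>] assms that by auto
  then show ?thesis
    using assms(1,2) unfolding top_path_def edge_trace_UN by blast
qed

lemma top_path_below:
  assumes "top_path G A B L F H \<gamma>" "\<delta> \<in> P" "set \<delta> \<subseteq> H"
  shows "Low \<delta> \<subseteq> Low \<gamma>"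
proof -
  have "path_trace \<delta> \<subseteq> F ` edge_trace G H"
    using assms(3) by (auto simp: edge_trace_def)
  then have "path_trace \<delta> \<subseteq> closure (Low \<gamma>)"
    using assms(1) by (auto simp: top_path_def)
  then show ?thesis
    using below_iff[of \<gamma> \<delta>] assms by (simp add: top_path_def)
qed

text \<open>Two top paths lie below each other. This makes the choice in \<open>nms_step\<close>
  well-defined.\<close>

lemma top_path_unique:
  assumes "top_path G A B L F H \<gamma>" "top_path G A B L F H \<delta>"
  shows "\<gamma> = \<delta>"
proof (rule Low_inj)
  show "\<gamma> \<in> P" "\<delta> \<in> P"
    using assms by (simp_all add: top_path_def)
  show "Low \<gamma> = Low \<delta>"
    using top_path_below[OF assms(1), of \<delta>] top_path_below[OF assms(2), of \<gamma>] assms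
    by (simp add: top_path_def)
qed

lemma non_crossing_iff:
  assumes "\<gamma> \<in> P" "\<delta> \<in> P"
  shows "non_crossing G A B L F \<gamma> \<delta> \<longleftrightarrow> Low \<gamma> \<subseteq> Low \<delta> \<or> Low \<delta> \<subseteq> Low \<gamma>"
proof -
  have "top_path G A B L F (set \<gamma> \<union> set \<delta>) \<epsilon> \<longleftrightarrow> Low \<gamma> \<subseteq> Low \<epsilon> \<and> Low \<delta> \<subseteq> Low \<epsilon>" if "\<epsilon> \<in> {\<gamma>, \<delta>}" for \<epsilon>
  proof
    assume "top_path G A B L F (set \<gamma> \<union> set \<delta>) \<epsilon>"
    then show "Low \<gamma> \<subseteq> Low \<epsilon> \<and> Low \<delta> \<subseteq> Low \<epsilon>"
      using top_path_below assms by blast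
  next
    assume "Low \<gamma> \<subseteq> Low \<epsilon> \<and> Low \<delta> \<subseteq> Low \<epsilon>"
    then show "top_path G A B L F (set \<gamma> \<union> set \<delta>) \<epsilon>"
      using top_path_of_family[of "{\<gamma>, \<delta>}" \<epsilon>] assms that by auto
  qed
  then show ?thesis
    unfolding non_crossing_def by blast
qed

text \<open>Planarity keeps the open edge off the path, so it is connected in the complement and
  lies on one side. Its end points may be vertices of the path, and they are added by taking
  closures.\<close>

lemma edge_on_one_side:
  assumes "\<gamma> \<in> P" "e \<in> edges G" "e \<notin> set \<gamma>"
  shows "F ` path_image (curve G e) \<subseteq> Low \<gamma> \<union> path_trace \<gamma> \<or> F ` path_image (curve G e) \<subseteq> Up \<gamma> \<union> path_trace \<gamma>"
proof -
  define g where "g = F \<circ> curve G e"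
  have edges: "set \<gamma> \<subseteq> edges G"
    using assms(1) by (rule paths_between_edges)
  have enc: "path_image (curve G e) \<subseteq> inside C \<union> C"
    using edge_trace_encircled[of "{e}"] assms(2) by (simp add: edge_trace_def)
  have arc: "arc (curve G e)"
    using assms(2) by (rule arc_curve)
  then have "continuous_on {0..1} (curve G e)"
    by (simp add: arc_def path_def)
  then have cont: "continuous_on {0..1} g"
    using continuous_on_compose2[OF F_cont, of "{0..1}" "curve G e"] enc
    by (simp add: g_def path_image_def o_def)
  have "g t \<notin> path_trace \<gamma>" if t: "t \<in> {0<..<1}" for t
  proof
    assume "g t \<in> path_trace \<gamma>"
    then obtain z where z: "z \<in> edge_trace G (set \<gamma>)" "F (curve G e t) = F z"
      by (auto simp: g_def)
    have on_curve: "curve G e t \<in> path_image (curve G e)"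
      using t by (auto simp: path_image_def)
    then have "curve G e t = z"
      using inj_onD[OF F_inj z(2)] subsetD[OF enc] subsetD[OF edge_trace_encircled[OF edges] z(1)] by blast
    with on_curve obtain f where "f \<in> set \<gamma>" "curve G e t \<in> path_image (curve G e) \<inter> path_image (curve G f)"
      using z(1) by (auto simp: edge_trace_def)
    then have "curve G e t \<in> verts G"
      using curves_meet[of e f] assms edges by auto
    then have "curve G e t \<in> ends G e"
      using curve_verts[OF assms(2)] \<open>curve G e t \<in> path_image (curve G e)\<close> by auto
    then have "curve G e t = curve G e 0 \<or> curve G e t = curve G e 1"
      by (auto simp: ends_def pathstart_def pathfinish_def)
    then have "t = 0 \<or> t = 1"
      using arc t by (auto simp: arc_def dest!: inj_onD)
    then show False
      using t by simp
  qed
  moreover have "g ` {0..1} \<subseteq> strip L"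
    using edge_trace_image_strip(2)[of "{e}"] assms(2)
    by (simp add: edge_trace_def g_def path_image_def image_comp)
  ultimately have "g ` {0<..<1} \<subseteq> strip L - path_trace \<gamma>"
    by fastforce
  define I where "I = g ` {0<..<1}"
  have sub: "I \<subseteq> Low \<gamma> \<union> Up \<gamma>"
    unfolding I_def Low_Un_Up[OF assms(1)] by fact
  have conn: "connected I"
    unfolding I_def by (intro connected_continuous_image continuous_on_subset[OF cont] connected_Ioo) auto
  have closed: "closed (Low \<gamma> \<union> path_trace \<gamma>)" "closed (Up \<gamma> \<union> path_trace \<gamma>)"
    unfolding Low_closure[OF assms(1), symmetric] Up_closure[OF assms(1), symmetric] by simp_all
  have "I \<inter> path_trace \<gamma> = {}"
    using sub Low_Un_Up[OF assms(1)] by auto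
  then have disj: "(Low \<gamma> \<union> path_trace \<gamma>) \<inter> (Up \<gamma> \<union> path_trace \<gamma>) \<inter> I = {}"
    using Low_Int_Up[OF assms(1)] by auto
  have "I \<subseteq> (Low \<gamma> \<union> path_trace \<gamma>) \<union> (Up \<gamma> \<union> path_trace \<gamma>)"
    using sub by auto
  with conn disj closed have "(Low \<gamma> \<union> path_trace \<gamma>) \<inter> I = {} \<or> (Up \<gamma> \<union> path_trace \<gamma>) \<inter> I = {}"
    by (intro connected_closedD)
  then have "I \<subseteq> Up \<gamma> \<union> path_trace \<gamma> \<or> I \<subseteq> Low \<gamma> \<union> path_trace \<gamma>"
    using sub by blast
  moreover have "continuous_on (closure {0<..<1}) g"
    using cont by simp
  ultimately have "g ` closure {0<..<1} \<subseteq> Up \<gamma> \<union> path_trace \<gamma> \<or> g ` closure {0<..<1} \<subseteq> Low \<gamma> \<union> path_trace \<gamma>"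
    using closed image_closure_subset[of "{0<..<1}" g] unfolding I_def by metis
  then show ?thesis
    by (auto simp: g_def path_image_def image_comp)
qed

end

section \<open>Top paths and the algorithm\<close>

locale flow_network = rectangle_network G C S1 S2 A B L F + level_network G A B \<rho>
  for G :: "'e network" and C S1 S2 A B L F \<rho>
begin

lemma flow_edge_on_path:
  assumes "flow r" "e \<in> current_graph G r"
  shows "\<exists>\<gamma>. \<exists>x\<in>A. \<exists>y\<in>B. dwalk x \<gamma> y \<and> e \<in> set \<gamma> \<and> set \<gamma> \<subseteq> current_graph G r"
proof -
  obtain u v where e: "directed e u v"
    using assms by (auto simp: flow_def current_graph_def)
  show ?thesis
    by (rule extend_to_path[OF assms(2) e])
      (rule flow_predecessor[OF assms(1)] flow_successor[OF assms(1)], assumption+)+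
qed

text \<open>The edges of \<open>\<gamma>\<close> belong to \<open>K\<close>, so a directed walk in
  \<open>K\<close> that meets \<open>\<gamma>\<close> can continue along it without any cutting and
  pasting. A walk within \<open>K\<close> cannot enter \<open>Low \<gamma>\<close>.\<close>

lemma higher_path:
  assumes r: "flow r" and \<gamma>: "dwalk a \<gamma> b" "a \<in> A" "b \<in> B" "set \<gamma> \<subseteq> current_graph G r"
    and not_top: "\<not> top_path G A B L F (current_graph G r) \<gamma>"
  shows "\<exists>\<delta>. \<exists>x\<in>A. \<exists>y\<in>B. dwalk x \<delta> y \<and> set \<delta> \<subseteq> current_graph G r \<and> Low \<gamma> \<subset> Low \<delta>"
proof -
  have P: "\<gamma> \<in> P"
    using \<gamma> by (intro dwalk_in_paths)
  define K where "K = {e \<in> current_graph G r. F ` path_image (curve G e) \<subseteq> Up \<gamma> \<union> path_trace \<gamma>}"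
  have current: "e \<in> edges G" if "e \<in> current_graph G r" for e
    using that by (simp add: current_graph_def)
  have \<gamma>_K: "set \<gamma> \<subseteq> K"
    using \<gamma>(4) by (auto simp: K_def edge_trace_def)
  have disjoint: "(Low \<gamma> \<union> path_trace \<gamma>) \<inter> Up \<gamma> = {}" "Low \<gamma> \<inter> path_trace \<gamma> = {}"
    using Low_Un_Up[OF P] Low_Int_Up[OF P] by auto
  \<comment> \<open>A flow edge with a single point above \<open>\<gamma>\<close> lies entirely on
    or above it, so continuations at vertices above \<open>\<gamma>\<close> stay in
    \<open>K\<close>.\<close>
  have K_if_above: "f \<in> K"
    if f: "f \<in> current_graph G r" "w \<in> path_image (curve G f)" "F w \<in> Up \<gamma>" for f w
  proof (cases "f \<in> set \<gamma>")
    case True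
    then show ?thesis
      using \<gamma>_K by auto
  next
    case False
    have "F w \<notin> Low \<gamma> \<union> path_trace \<gamma>"
      using f(3) disjoint(1) by auto
    then show ?thesis
      using edge_on_one_side[OF P current[OF f(1)] False] f(1,2) by (auto simp: K_def)
  qed
  have vertex: "\<exists>f\<in>set \<gamma>. w \<in> ends G f"
    if w: "F w \<in> path_trace \<gamma>" "w \<in> verts G" "w \<in> path_image (curve G e)" "e \<in> edges G" for w e
  proof -
    have \<gamma>_edges: "set \<gamma> \<subseteq> edges G"
      using P by (rule paths_between_edges)
    have "w \<in> inside C \<union> C"
      using edge_trace_encircled[of "{e}"] w(3,4) by (auto simp: edge_trace_def)
    then have "w \<in> edge_trace G (set \<gamma>)"
      using inj_on_image_mem_iff[OF F_inj _ edge_trace_encircled[OF \<gamma>_edges]] w(1) by blast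
    then show ?thesis
      using edge_trace_verts[OF \<gamma>_edges] w(2) by auto
  qed
  have ends_on_curve: "u \<in> path_image (curve G e) \<and> v \<in> path_image (curve G e)" if "directed e u v" for e u v
    using that curve_verts[of e] by (auto simp: directed_def)
  \<comment> \<open>At a vertex on \<open>\<gamma>\<close> the preceding edge of
    \<open>\<gamma>\<close> is used, which exists as \<open>u\<close> is not the start; at a vertex
    above, conservation of the flow provides one.\<close>
  have pred: "\<exists>f\<in>K. \<exists>w. directed f w u" if e: "e \<in> K" "directed e u v" "u \<notin> A" for e u v
  proof (cases "F u \<in> path_trace \<gamma>")
    case True
    have "e \<in> edges G" "u \<in> verts G" "u \<in> path_image (curve G e)"
      using e directed_verts ends_on_curve current by (auto simp: K_def)
    then obtain f where f: "f \<in> set \<gamma>" "u \<in> ends G f"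
      using vertex[OF True] by blast
    then obtain w z where wz: "directed f w z"
      using dwalk_directed[OF \<gamma>(1)] by blast
    show ?thesis
    proof (cases "u = z")
      case True
      then show ?thesis
        using f(1) wz \<gamma>_K by blast
    next
      case False
      then have "u = w"
        using f(2) wz by (auto simp: directed_def)
      then show ?thesis
        using dwalk_predecessor[OF \<gamma>(1) f(1) wz] e(3) \<gamma>(2) \<gamma>_K by blast
    qed
  next
    case False
    moreover have "F u \<in> Up \<gamma> \<union> path_trace \<gamma>"
      using e(1) ends_on_curve[OF e(2)] unfolding K_def by blast
    ultimately have "F u \<in> Up \<gamma>"
      by simp
    moreover obtain f w where "f \<in> current_graph G r" "directed f w u"
      using flow_predecessor[OF r, of e u v] e by (auto simp: K_def)
    ultimately show ?thesis
      using K_if_above ends_on_curve by blast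
  qed
  have succ: "\<exists>f\<in>K. \<exists>w. directed f v w" if e: "e \<in> K" "directed e u v" "v \<notin> B" for e u v
  proof (cases "F v \<in> path_trace \<gamma>")
    case True
    have "e \<in> edges G" "v \<in> verts G" "v \<in> path_image (curve G e)"
      using e directed_verts ends_on_curve current by (auto simp: K_def)
    then obtain f where f: "f \<in> set \<gamma>" "v \<in> ends G f"
      using vertex[OF True] by blast
    then obtain w z where wz: "directed f w z"
      using dwalk_directed[OF \<gamma>(1)] by blast
    show ?thesis
    proof (cases "v = w")
      case True
      then show ?thesis
        using f(1) wz \<gamma>_K by blast
    next
      case False
      then have "v = z"
        using f(2) wz by (auto simp: directed_def)
      then show ?thesis
        using dwalk_successor[OF \<gamma>(1) f(1) wz] e(3) \<gamma>(3) \<gamma>_K by blast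
    qed
  next
    case False
    moreover have "F v \<in> Up \<gamma> \<union> path_trace \<gamma>"
      using e(1) ends_on_curve[OF e(2)] unfolding K_def by blast
    ultimately have "F v \<in> Up \<gamma>"
      by simp
    moreover obtain f w where "f \<in> current_graph G r" "directed f v w"
      using flow_successor[OF r, of e u v] e by (auto simp: K_def)
    ultimately show ?thesis
      using K_if_above ends_on_curve by blast
  qed
  have "\<not> F ` edge_trace G (current_graph G r) \<subseteq> closure (Low \<gamma>)"
    using not_top P \<gamma>(4) by (simp add: top_path_def)
  then obtain e w where e: "e \<in> current_graph G r" "w \<in> path_image (curve G e)" "F w \<notin> Low \<gamma> \<union> path_trace \<gamma>"
    by (auto simp: edge_trace_def Low_closure[OF P])
  have "F w \<in> strip L"
    using edge_trace_image_strip(2)[of "{e}"] current[OF e(1)] e(2) by (auto simp: edge_trace_def)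
  then have w: "F w \<in> Up \<gamma>"
    using e(3) Low_Un_Up[OF P] by auto
  then have "e \<in> K"
    using K_if_above e by blast
  moreover obtain u v where "directed e u v"
    using r e(1) by (auto simp: flow_def current_graph_def)
  ultimately have "\<exists>\<delta>. \<exists>x\<in>A. \<exists>y\<in>B. dwalk x \<delta> y \<and> e \<in> set \<delta> \<and> set \<delta> \<subseteq> K"
    by (rule extend_to_path) (rule pred succ, assumption+)+
  then obtain \<delta> x y where \<delta>: "x \<in> A" "y \<in> B" "dwalk x \<delta> y" "e \<in> set \<delta>" "set \<delta> \<subseteq> K"
    by blast
  then have \<delta>P: "\<delta> \<in> P"
    by (intro dwalk_in_paths)
  have "path_trace \<delta> \<subseteq> Up \<gamma> \<union> path_trace \<gamma>"
    using \<delta>(5) by (auto simp: K_def edge_trace_def)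
  moreover have "(Up \<gamma> \<union> path_trace \<gamma>) \<inter> Low \<gamma> = {}"
    using disjoint by auto
  ultimately have "path_trace \<delta> \<inter> Low \<gamma> = {}"
    by blast
  then have "Low \<gamma> \<subseteq> Low \<delta>"
    by (rule Low_subset_if_disjoint[OF P \<delta>P])
  \<comment> \<open>Strictness: \<open>F w\<close> lies on the drawn path \<open>\<delta>\<close>
    but outside the closure of \<open>Low \<gamma>\<close>.\<close>
  moreover have "F w \<in> closure (Low \<delta>)"
    using \<delta>(4) e(2) by (auto simp: Low_closure[OF \<delta>P] edge_trace_def)
  then have "Low \<delta> \<noteq> Low \<gamma>"
    using e(3) Low_closure[OF P] by auto
  ultimately show ?thesis
    using \<delta> by (intro exI[of _ \<delta>]) (auto simp: K_def)
qed

lemma flow_top_path: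
  assumes r: "flow r" and "current_graph G r \<noteq> {}"
  shows "\<exists>\<gamma>. \<exists>x\<in>A. \<exists>y\<in>B. dwalk x \<gamma> y \<and> top_path G A B L F (current_graph G r) \<gamma>"
proof -
  define Q where "Q = {\<gamma>. \<exists>x\<in>A. \<exists>y\<in>B. dwalk x \<gamma> y \<and> set \<gamma> \<subseteq> current_graph G r}"
  have "Q \<subseteq> P"
    using dwalk_in_paths by (auto simp: Q_def)
  then have "finite (Low ` Q)"
    using finite_paths_between finite_subset by blast
  moreover obtain e where "e \<in> current_graph G r"
    using assms(2) by blast
  then have "Q \<noteq> {}"
    using flow_edge_on_path[OF r] unfolding Q_def by blast
  ultimately obtain X where "X \<in> Low ` Q" and max: "\<And>Y. Y \<in> Low ` Q \<Longrightarrow> X \<subseteq> Y \<Longrightarrow> X = Y"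
    using finite_has_maximal[of "Low ` Q"] by auto
  then obtain \<gamma> where \<gamma>: "\<gamma> \<in> Q" "X = Low \<gamma>"
    by blast
  then obtain x y where xy: "x \<in> A" "y \<in> B" "dwalk x \<gamma> y" "set \<gamma> \<subseteq> current_graph G r"
    by (auto simp: Q_def)
  have "top_path G A B L F (current_graph G r) \<gamma>"
  proof (rule ccontr)
    assume "\<not> ?thesis"
    then obtain \<delta> where "\<delta> \<in> Q" "Low \<gamma> \<subset> Low \<delta>"
      using higher_path[OF r xy(3,1,2,4)] unfolding Q_def by blast
    then show False
      using max[of "Low \<delta>"] \<gamma>(2) by auto
  qed
  then show ?thesis
    using xy by blast
qed

text \<open>Peeling off top paths: each step kills an edge of the residual flow.\<close>

lemma flow_decomposition:
  assumes "flow r"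
  shows "\<exists>\<Gamma> m. \<Gamma> \<subseteq> P \<and> (\<forall>\<gamma>\<in>\<Gamma>. 0 < m \<gamma> \<and> set \<gamma> \<subseteq> current_graph G r \<and> (\<Sum>e\<in>set \<gamma>. \<rho> e) = 1) \<and>
    (\<forall>\<gamma>\<in>\<Gamma>. \<forall>\<delta>\<in>\<Gamma>. Low \<gamma> \<subseteq> Low \<delta> \<or> Low \<delta> \<subseteq> Low \<gamma>) \<and>
    (\<forall>e\<in>edges G. r e = (\<Sum>\<gamma>\<in>\<Gamma>. m \<gamma> * of_bool (e \<in> set \<gamma>)))"
  using assms
proof (induction "card (current_graph G r)" arbitrary: r rule: less_induct)
  case less
  note r = less.prems
  show ?case
  proof (cases "current_graph G r = {}")
    case True
    then show ?thesis
      by (intro exI[of _ "{}"]) (auto simp: current_graph_def)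
  next
    case False
    obtain \<gamma> x y where \<gamma>: "x \<in> A" "y \<in> B" "dwalk x \<gamma> y" "top_path G A B L F (current_graph G r) \<gamma>"
      using flow_top_path[OF r False] by blast
    then have P: "\<gamma> \<in> P" and current: "set \<gamma> \<subseteq> current_graph G r"
      by (auto simp: top_path_def)
    have "\<gamma> \<noteq> []"
      using P by (rule paths_between_nonempty)
    define c where "c = Min (r ` set \<gamma>)"
    have c_le: "c \<le> r e" if "e \<in> set \<gamma>" for e
      using that by (simp add: c_def)
    have "c \<in> r ` set \<gamma>"
      unfolding c_def using \<open>\<gamma> \<noteq> []\<close> by (intro Min_in) auto
    then obtain e0 where e0: "e0 \<in> set \<gamma>" "r e0 = c"
      by auto
    have pos: "0 < r e" if "e \<in> set \<gamma>" for e
      using current that r by (auto simp: current_graph_def flow_def less_le)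
    define r' where "r' e = (if e \<in> set \<gamma> then r e - c else r e)" for e
    have r': "flow r'"
      unfolding r'_def using c_le pos by (intro flow_diff_path[OF r \<gamma>(3,1,2)]) fastforce
    have sub: "current_graph G r' \<subseteq> current_graph G r"
      using current by (auto simp: current_graph_def r'_def)
    moreover have e0': "e0 \<in> current_graph G r" "e0 \<notin> current_graph G r'"
      using current e0 by (auto simp: current_graph_def r'_def)
    ultimately have "current_graph G r' \<subset> current_graph G r"
      by blast
    then have "card (current_graph G r') < card (current_graph G r)"
      using finite_edges by (intro psubset_card_mono) (auto simp: current_graph_def)
    from less.hyps[OF this r'] obtain \<Gamma> m where \<Gamma>: "\<Gamma> \<subseteq> P"
      "\<forall>\<gamma>\<in>\<Gamma>. 0 < m \<gamma> \<and> set \<gamma> \<subseteq> current_graph G r' \<and> (\<Sum>e\<in>set \<gamma>. \<rho> e) = 1"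
      "\<forall>\<gamma>\<in>\<Gamma>. \<forall>\<delta>\<in>\<Gamma>. Low \<gamma> \<subseteq> Low \<delta> \<or> Low \<delta> \<subseteq> Low \<gamma>"
      "\<forall>e\<in>edges G. r' e = (\<Sum>\<gamma>\<in>\<Gamma>. m \<gamma> * of_bool (e \<in> set \<gamma>))"
      by blast
    have fin: "finite \<Gamma>"
      using \<Gamma>(1) finite_paths_between finite_subset by blast
    \<comment> \<open>The later paths avoid \<open>e0\<close>, whose residual has become 0.\<close>
    have new: "\<gamma> \<notin> \<Gamma>"
      using \<Gamma>(2) e0(1) e0'(2) by blast
    \<comment> \<open>The later paths use only edges still present, hence edges of the graph whose
      top path is \<open>\<gamma>\<close>; this extends the chain.\<close>
    have below: "Low \<delta> \<subseteq> Low \<gamma>" if "\<delta> \<in> \<Gamma>" for \<delta>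
      using top_path_below[OF \<gamma>(4), of \<delta>] \<Gamma>(1,2) sub that by blast
    define m' where "m' = m(\<gamma> := c)"
    have m': "m' \<gamma> = c" "\<And>\<delta>. \<delta> \<in> \<Gamma> \<Longrightarrow> m' \<delta> = m \<delta>"
      using new by (auto simp: m'_def)
    have "r e = (\<Sum>\<delta>\<in>insert \<gamma> \<Gamma>. m' \<delta> * of_bool (e \<in> set \<delta>))" if "e \<in> edges G" for e
    proof -
      have "(\<Sum>\<delta>\<in>insert \<gamma> \<Gamma>. m' \<delta> * of_bool (e \<in> set \<delta>)) = c * of_bool (e \<in> set \<gamma>) + r' e"
        using fin new m' \<Gamma>(4) that by simp
      then show ?thesis
        by (simp add: r'_def)
    qed
    moreover have "0 < c"
      using pos e0 by fastforce
    moreover have "\<forall>\<delta>\<in>\<Gamma>. set \<delta> \<subseteq> current_graph G r"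
      using \<Gamma>(2) sub by blast
    ultimately show ?thesis
      using \<Gamma> P current below m' dwalk_tight[OF \<gamma>(3,1,2)]
      by (intro exI[of _ "insert \<gamma> \<Gamma>"] exI[of _ m']) auto
  qed
qed

end

section \<open>The algorithm run on a decomposition over a chain\<close>

context rectangle_network
begin

text \<open>The accumulators are generalised for the induction, which removes the greatest path.
  Positive weights make the current graph the union of the remaining paths, so the greatest one is
  its top path; the residual after the step is again a combination of the others.\<close>

lemma algorithm_run:
  assumes "\<Gamma> \<subseteq> P" "\<forall>\<gamma>\<in>\<Gamma>. 0 < m \<gamma>"
    and "\<forall>\<gamma>\<in>\<Gamma>. \<forall>\<delta>\<in>\<Gamma>. Low \<gamma> \<subseteq> Low \<delta> \<or> Low \<delta> \<subseteq> Low \<gamma>"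
    and "\<forall>e\<in>edges G. r e = (\<Sum>\<gamma>\<in>\<Gamma>. m \<gamma> * of_bool (e \<in> set \<gamma>))"
  shows "\<exists>r'. while_option (nms_continue G A B L F) (nms_step G A B L F) (r, \<Gamma>0, m0) =
    Some (r', \<Gamma>0 \<union> \<Gamma>, \<lambda>\<gamma>. if \<gamma> \<in> \<Gamma> then m \<gamma> else m0 \<gamma>)"
  using assms
proof (induction "card \<Gamma>" arbitrary: \<Gamma> r \<Gamma>0 m0)
  case 0
  have "finite \<Gamma>"
    using 0(2) finite_paths_between finite_subset by blast
  then have "\<Gamma> = {}"
    using 0(1) by simp
  then have "current_graph G r = {}"
    using 0(5) by (simp add: current_graph_def)
  \<comment> \<open>A path between the disjoint terminal sets has an edge, so none fits into the
    empty graph and the loop stops.\<close>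
  then have "\<not> top_path G A B L F (current_graph G r) \<gamma>" for \<gamma>
    using paths_between_nonempty[of \<gamma>] by (auto simp: top_path_def)
  then have "\<not> nms_continue G A B L F (r, \<Gamma>0, m0)"
    by (simp add: nms_continue_def)
  then show ?case
    using \<open>\<Gamma> = {}\<close> by (simp add: while_option_unfold)
next
  case (Suc n)
  note \<Gamma> = Suc.prems
  have fin: "finite \<Gamma>"
    using \<Gamma>(1) finite_paths_between finite_subset by blast
  have graph: "current_graph G r = (\<Union>\<gamma>\<in>\<Gamma>. set \<gamma>)"
  proof -
    have "r e \<noteq> 0 \<longleftrightarrow> (\<exists>\<gamma>\<in>\<Gamma>. e \<in> set \<gamma>)" if "e \<in> edges G" for e
    proof -
      have "r e = 0 \<longleftrightarrow> (\<forall>\<gamma>\<in>\<Gamma>. m \<gamma> * of_bool (e \<in> set \<gamma>) = 0)"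
        using \<Gamma>(2,4) that sum_nonneg_eq_0_iff[OF fin, of "\<lambda>\<gamma>. m \<gamma> * of_bool (e \<in> set \<gamma>)"]
        by (simp add: less_imp_le)
      then show ?thesis
        using \<Gamma>(2) by fastforce
    qed
    then show ?thesis
      using \<Gamma>(1) paths_between_edges by (fastforce simp: current_graph_def)
  qed
  have "\<Gamma> \<noteq> {}"
    using Suc.hyps(2) by auto
  then obtain X where "X \<in> Low ` \<Gamma>" and max: "\<And>Y. Y \<in> Low ` \<Gamma> \<Longrightarrow> X \<subseteq> Y \<Longrightarrow> X = Y"
    using finite_has_maximal[of "Low ` \<Gamma>"] fin by auto
  then obtain \<gamma> where \<gamma>: "\<gamma> \<in> \<Gamma>" "X = Low \<gamma>"
    by blast
  have below: "Low \<delta> \<subseteq> Low \<gamma>" if "\<delta> \<in> \<Gamma>" for \<delta>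
    using \<Gamma>(3) max[of "Low \<delta>"] \<gamma> that by auto
  have P: "\<gamma> \<in> P"
    using \<gamma> \<Gamma>(1) by auto
  have top: "top_path G A B L F (current_graph G r) \<gamma>"
    unfolding graph using \<Gamma>(1) \<gamma>(1) below by (rule top_path_of_family)
  then have the: "(THE \<gamma>. top_path G A B L F (current_graph G r) \<gamma>) = \<gamma>"
    using top_path_unique by blast
  text \<open>The top path has an edge of its own: otherwise, by betweenness, it would be contained in
    the second path from the top.\<close>
  have own_edge: "\<exists>e\<in>set \<gamma>. \<forall>\<delta>\<in>\<Gamma> - {\<gamma>}. e \<notin> set \<delta>"
  proof (cases "\<Gamma> - {\<gamma>} = {}")
    case True
    then show ?thesis
      using paths_between_nonempty[OF P] by (cases \<gamma>) auto
  next
    case False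
    then obtain Y where "Y \<in> Low ` (\<Gamma> - {\<gamma>})" and max': "\<And>Z. Z \<in> Low ` (\<Gamma> - {\<gamma>}) \<Longrightarrow> Y \<subseteq> Z \<Longrightarrow> Y = Z"
      using finite_has_maximal[of "Low ` (\<Gamma> - {\<gamma>})"] fin by auto
    then obtain \<delta> where \<delta>: "\<delta> \<in> \<Gamma>" "\<delta> \<noteq> \<gamma>" "Y = Low \<delta>"
      by blast
    have \<delta>P: "\<delta> \<in> P"
      using \<delta> \<Gamma>(1) by auto
    have second: "set \<gamma> \<inter> set \<epsilon> \<subseteq> set \<delta>" if \<epsilon>: "\<epsilon> \<in> \<Gamma> - {\<gamma>}" for \<epsilon>
    proof (rule edges_between[OF P \<delta>P])
      show "\<epsilon> \<in> P" "Low \<delta> \<subseteq> Low \<gamma>"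
        using \<epsilon> \<Gamma>(1) below \<delta>(1) by auto
      show "Low \<epsilon> \<subseteq> Low \<delta>"
        using \<Gamma>(3) max'[of "Low \<epsilon>"] \<delta> \<epsilon> by auto
    qed
    show ?thesis
    proof (rule ccontr)
      assume "\<not> ?thesis"
      then have "set \<gamma> \<subseteq> set \<delta>"
        using second by blast
      then have "path_trace \<gamma> \<subseteq> path_trace \<delta>"
        by (auto simp: edge_trace_def)
      then have "path_trace \<gamma> \<subseteq> closure (Low \<delta>)"
        using Low_closure[OF \<delta>P] by auto
      then have "Low \<gamma> = Low \<delta>"
        using below_iff[OF \<delta>P P] below[OF \<delta>(1)] by auto
      then show False
        using Low_inj[OF P \<delta>P] \<delta>(2) by simp
    qed
  qed
  define \<Gamma>' where "\<Gamma>' = \<Gamma> - {\<gamma>}"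
  have split: "r e = m \<gamma> * of_bool (e \<in> set \<gamma>) + (\<Sum>\<delta>\<in>\<Gamma>'. m \<delta> * of_bool (e \<in> set \<delta>))" if "e \<in> edges G" for e
    using sum.remove[OF fin \<gamma>(1), of "\<lambda>\<delta>. m \<delta> * of_bool (e \<in> set \<delta>)"] \<Gamma>(4) that
    by (simp only: \<Gamma>'_def)
  have "Min (r ` set \<gamma>) = m \<gamma>"
  proof (rule Min_eqI)
    fix s assume "s \<in> r ` set \<gamma>"
    then obtain e where e: "e \<in> set \<gamma>" "s = r e" "e \<in> edges G"
      using paths_between_edges[OF P] by auto
    have "0 \<le> (\<Sum>\<delta>\<in>\<Gamma>'. m \<delta> * of_bool (e \<in> set \<delta>))"
      using \<Gamma>(2) by (intro sum_nonneg) (auto simp: \<Gamma>'_def less_imp_le)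
    then show "m \<gamma> \<le> s"
      using split[OF e(3)] e by simp
  next
    obtain e where e: "e \<in> set \<gamma>" "\<forall>\<delta>\<in>\<Gamma>'. e \<notin> set \<delta>"
      using own_edge by (auto simp: \<Gamma>'_def)
    then have "r e = m \<gamma>"
      using split[of e] paths_between_edges[OF P] by auto
    then show "m \<gamma> \<in> r ` set \<gamma>"
      using e(1) by (metis image_eqI)
  qed simp
  then have step: "nms_step G A B L F (r, \<Gamma>0, m0) =
      (\<lambda>e. if e \<in> set \<gamma> then r e - m \<gamma> else r e, insert \<gamma> \<Gamma>0, m0(\<gamma> := m \<gamma>))"
    by (simp add: nms_step_def the Let_def cong: if_cong)
  have continue: "nms_continue G A B L F (r, \<Gamma>0, m0)"
    using top by (auto simp: nms_continue_def)
  have "n = card \<Gamma>'"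
    using Suc.hyps(2) \<gamma>(1) by (simp add: \<Gamma>'_def)
  moreover have "\<forall>e\<in>edges G. (if e \<in> set \<gamma> then r e - m \<gamma> else r e) = (\<Sum>\<delta>\<in>\<Gamma>'. m \<delta> * of_bool (e \<in> set \<delta>))"
    using split by simp
  ultimately obtain r' where "while_option (nms_continue G A B L F) (nms_step G A B L F)
      (\<lambda>e. if e \<in> set \<gamma> then r e - m \<gamma> else r e, insert \<gamma> \<Gamma>0, m0(\<gamma> := m \<gamma>)) =
    Some (r', insert \<gamma> \<Gamma>0 \<union> \<Gamma>', \<lambda>\<delta>. if \<delta> \<in> \<Gamma>' then m \<delta> else (m0(\<gamma> := m \<gamma>)) \<delta>)"
    using Suc.hyps(1)[of \<Gamma>' "\<lambda>e. if e \<in> set \<gamma> then r e - m \<gamma> else r e" "insert \<gamma> \<Gamma>0" "m0(\<gamma> := m \<gamma>)"] \<Gamma>(1-3)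
    by (auto simp: \<Gamma>'_def)
  moreover have "insert \<gamma> \<Gamma>0 \<union> \<Gamma>' = \<Gamma>0 \<union> \<Gamma>"
    using \<gamma>(1) by (auto simp: \<Gamma>'_def)
  moreover have "(\<lambda>\<delta>. if \<delta> \<in> \<Gamma>' then m \<delta> else (m0(\<gamma> := m \<gamma>)) \<delta>) = (\<lambda>\<delta>. if \<delta> \<in> \<Gamma> then m \<delta> else m0 \<delta>)"
    using \<gamma>(1) by (auto simp: \<Gamma>'_def fun_eq_iff)
  ultimately show ?case
    using continue step by (simp add: while_option_unfold[of _ _ "(r, \<Gamma>0, m0)"])
qed

end

section \<open>Existence, minimality and full support\<close>

context rectangle_network
begin

sublocale family: path_family G P
  using finite_edges weight_pos finite_paths_between paths_between_edges paths_between_nonempty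
  by unfold_locales

lemma algorithm_output:
  assumes "\<Gamma> \<subseteq> P" "\<forall>\<gamma>\<in>\<Gamma>. 0 < m \<gamma>" "\<forall>\<gamma>. \<gamma> \<notin> \<Gamma> \<longrightarrow> m \<gamma> = 0"
    and "\<forall>\<gamma>\<in>\<Gamma>. \<forall>\<delta>\<in>\<Gamma>. Low \<gamma> \<subseteq> Low \<delta> \<or> Low \<delta> \<subseteq> Low \<gamma>"
    and "\<forall>e\<in>edges G. weight G e * \<rho> e = (\<Sum>\<gamma>\<in>\<Gamma>. m \<gamma> * of_bool (e \<in> set \<gamma>))"
  shows "nms_algorithm G A B L F \<rho> = Some (\<Gamma>, m)"
proof -
  have "(\<lambda>\<gamma>. if \<gamma> \<in> \<Gamma> then m \<gamma> else 0) = m"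
    using assms(3) by auto
  then show ?thesis
    using algorithm_run[of \<Gamma> m "\<lambda>e. weight G e * \<rho> e" "{}" "\<lambda>_. 0"] assms
    by (auto simp: nms_algorithm_def)
qed

text \<open>Full support makes all weights positive. The lemma serves both for a minimal subfamily
  and for the support of a competing pmf.\<close>

lemma algorithm_of_optimal_pmf:
  assumes "\<Gamma> \<subseteq> P" "\<mu> \<in> pmfs_on \<Gamma>" "optimal_pmf G P \<mu>" "\<Gamma> \<subseteq> set_pmf \<mu>"
    and chain: "\<forall>\<gamma>\<in>\<Gamma>. \<forall>\<delta>\<in>\<Gamma>. Low \<gamma> \<subseteq> Low \<delta> \<or> Low \<delta> \<subseteq> Low \<gamma>"
  shows "nms_algorithm G A B L F (extremal_density G P) = Some (\<Gamma>, \<lambda>\<gamma>. Mod2 G P * pmf \<mu> \<gamma>)"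
proof (rule algorithm_output[OF assms(1) _ _ chain])
  have "P \<noteq> {}"
    using assms(1,2) set_pmf_not_empty[of \<mu>] by (auto simp: pmfs_on_def)
  then show "\<forall>\<gamma>\<in>\<Gamma>. 0 < Mod2 G P * pmf \<mu> \<gamma>"
    using family.Mod2_pos assms(4) by (auto simp: pmf_positive)
  show "\<forall>\<gamma>. \<gamma> \<notin> \<Gamma> \<longrightarrow> Mod2 G P * pmf \<mu> \<gamma> = 0"
    using assms(2) by (auto simp: pmfs_on_def set_pmf_eq)
  show "\<forall>e\<in>edges G. weight G e * extremal_density G P e =
      (\<Sum>\<gamma>\<in>\<Gamma>. Mod2 G P * pmf \<mu> \<gamma> * of_bool (e \<in> set \<gamma>))"
    using family.optimal_pmf_flow[OF assms(3,1,2)] by blast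
qed

lemma exists_non_crossing_decomposition:
  assumes "P \<noteq> {}"
  shows "\<exists>\<Gamma> m. \<Gamma> \<subseteq> P \<and> (\<forall>\<gamma>\<in>\<Gamma>. 0 < m \<gamma> \<and> (\<Sum>e\<in>set \<gamma>. extremal_density G P e) = 1) \<and>
    (\<forall>\<gamma>\<in>\<Gamma>. \<forall>\<delta>\<in>\<Gamma>. Low \<gamma> \<subseteq> Low \<delta> \<or> Low \<delta> \<subseteq> Low \<gamma>) \<and>
    (\<forall>e\<in>edges G. weight G e * extremal_density G P e = (\<Sum>\<gamma>\<in>\<Gamma>. m \<gamma> * of_bool (e \<in> set \<gamma>)))"
proof -
  obtain \<mu> where \<mu>: "optimal_pmf G P \<mu>"
    using family.exists_optimal_pmf[OF assms] ..
  then have \<mu>P: "\<mu> \<in> pmfs_on P"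
    by (simp add: optimal_pmf_def)
  define \<rho> where "\<rho> = extremal_density G P"
  have "\<rho> \<in> admissible G P"
    using family.dual_density_admissible[OF \<mu>] family.Mod2_dual(2)[OF \<mu>] by (simp add: \<rho>_def)
  then interpret flow_network G C S1 S2 A B L F \<rho>
    by unfold_locales (auto simp: admissible_def)
  have pos: "0 < Mod2 G P"
    using family.Mod2_pos[OF assms] .
  have "flow (\<lambda>e. weight G e * \<rho> e)"
  proof (rule flow_combination[OF finite_paths_between])
    show "0 \<le> Mod2 G P * pmf \<mu> \<gamma>" for \<gamma>
      using pos by simp
    show "weight G e * \<rho> e = (\<Sum>\<gamma>\<in>P. Mod2 G P * pmf \<mu> \<gamma> * of_bool (e \<in> set \<gamma>))" if "e \<in> edges G" for e
      unfolding \<rho>_def by (rule family.optimal_pmf_flow[OF \<mu> subset_refl \<mu>P that])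
    \<comment> \<open>Paths in the support have positive usage on their edges, hence positive
      \<open>\<rho>\<close>; being tight, they run along increasing levels.\<close>
    show "\<exists>x\<in>A. \<exists>y\<in>B. dwalk x \<gamma> y" if \<gamma>: "\<gamma> \<in> P" "Mod2 G P * pmf \<mu> \<gamma> \<noteq> 0" for \<gamma>
    proof (rule tight_dwalk[OF \<gamma>(1)])
      have \<gamma>\<mu>: "\<gamma> \<in> set_pmf \<mu>"
        using \<gamma>(2) by (simp add: set_pmf_iff)
      show "(\<Sum>e\<in>set \<gamma>. \<rho> e) = 1"
        unfolding \<rho>_def by (rule family.optimal_pmf_tight[OF \<mu> \<gamma>\<mu>])
      show "\<forall>e\<in>set \<gamma>. 0 < \<rho> e"
      proof
        fix e assume e: "e \<in> set \<gamma>"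
        then have "e \<in> edges G"
          using paths_between_edges[OF \<gamma>(1)] by auto
        then have "weight G e * \<rho> e = Mod2 G P * usage \<mu> e" "0 < weight G e"
          using family.optimal_usage[OF \<mu>] weight_pos by (simp_all add: \<rho>_def)
        then show "0 < \<rho> e"
          using usage_pos[OF \<gamma>\<mu> e] pos by (metis mult_pos_pos zero_less_mult_pos)
      qed
    qed
  qed
  from flow_decomposition[OF this] obtain \<Gamma> m where
    "\<Gamma> \<subseteq> P \<and> (\<forall>\<gamma>\<in>\<Gamma>. 0 < m \<gamma> \<and> set \<gamma> \<subseteq> current_graph G (\<lambda>e. weight G e * \<rho> e) \<and> (\<Sum>e\<in>set \<gamma>. \<rho> e) = 1) \<and>
      (\<forall>\<gamma>\<in>\<Gamma>. \<forall>\<delta>\<in>\<Gamma>. Low \<gamma> \<subseteq> Low \<delta> \<or> Low \<delta> \<subseteq> Low \<gamma>) \<and>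
      (\<forall>e\<in>edges G. weight G e * \<rho> e = (\<Sum>\<gamma>\<in>\<Gamma>. m \<gamma> * of_bool (e \<in> set \<gamma>)))"
    by (elim exE)
  then show ?thesis
    unfolding \<rho>_def by (intro exI[of _ \<Gamma>] exI[of _ m]) simp
qed

lemma non_crossing_family_iff:
  assumes "\<Gamma> \<subseteq> P"
  shows "non_crossing_family G A B L F \<Gamma> \<longleftrightarrow> (\<forall>\<gamma>\<in>\<Gamma>. \<forall>\<delta>\<in>\<Gamma>. Low \<gamma> \<subseteq> Low \<delta> \<or> Low \<delta> \<subseteq> Low \<gamma>)"
  unfolding non_crossing_family_def using assms by (intro ball_cong refl non_crossing_iff) auto

lemma exists_non_crossing_minimal_subfamily:
  assumes "P \<noteq> {}"
  shows "\<exists>\<Gamma>. non_crossing_minimal_subfamily G A B L F \<Gamma>"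
proof -
  obtain \<Gamma> m where \<Gamma>: "\<Gamma> \<subseteq> P"
    and m: "\<forall>\<gamma>\<in>\<Gamma>. 0 < m \<gamma> \<and> (\<Sum>e\<in>set \<gamma>. extremal_density G P e) = 1"
    and chain: "\<forall>\<gamma>\<in>\<Gamma>. \<forall>\<delta>\<in>\<Gamma>. Low \<gamma> \<subseteq> Low \<delta> \<or> Low \<delta> \<subseteq> Low \<gamma>"
    and decomp: "\<forall>e\<in>edges G. weight G e * extremal_density G P e = (\<Sum>\<gamma>\<in>\<Gamma>. m \<gamma> * of_bool (e \<in> set \<gamma>))"
    using exists_non_crossing_decomposition[OF assms] by blast
  obtain \<mu> where \<mu>: "\<mu> \<in> pmfs_on \<Gamma>" "optimal_pmf G P \<mu>"
    using family.optimal_pmf_of_decomposition[OF \<Gamma> assms, of m] m decomp by (auto simp: less_imp_le)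
  define m' where "m' \<gamma> = (if \<gamma> \<in> \<Gamma> then m \<gamma> else 0)" for \<gamma>
  have run: "nms_algorithm G A B L F (extremal_density G P) = Some (\<Gamma>, m')"
    using m decomp by (intro algorithm_output[OF \<Gamma> _ _ chain]) (simp_all add: m'_def)
  \<comment> \<open>If the modulus survived the removal, the remaining paths would support an
    optimal pmf \<open>\<nu>\<close>. Its support is a chain as well, so one and the same run of the
    algorithm would return both \<open>\<Gamma>\<close> and a family without
    \<open>\<gamma>\<close>.\<close>
  have "Mod2 G (\<Gamma> - {\<gamma>}) < Mod2 G P" if "\<gamma> \<in> \<Gamma>" for \<gamma>
  proof (rule ccontr)
    have sub: "\<Gamma> - {\<gamma>} \<subseteq> P"
      using \<Gamma> by auto
    assume "\<not> ?thesis"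
    then obtain \<nu> where \<nu>: "\<nu> \<in> pmfs_on (\<Gamma> - {\<gamma>})" "optimal_pmf G P \<nu>"
      using family.Mod2_subfamily[OF sub assms] by force
    then have supp: "set_pmf \<nu> \<subseteq> \<Gamma> - {\<gamma>}" "\<nu> \<in> pmfs_on (set_pmf \<nu>)"
      by (auto simp: pmfs_on_def)
    have "set_pmf \<nu> \<subseteq> P" "\<forall>\<gamma>\<in>set_pmf \<nu>. \<forall>\<delta>\<in>set_pmf \<nu>. Low \<gamma> \<subseteq> Low \<delta> \<or> Low \<delta> \<subseteq> Low \<gamma>"
      using supp(1) sub chain by blast+
    then have "set_pmf \<nu> = \<Gamma>"
      using algorithm_of_optimal_pmf[of "set_pmf \<nu>" \<nu>] supp(2) \<nu>(2) run by simp
    then show False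
      using supp(1) that by blast
  qed
  then have "minimal_subfamily G P \<Gamma>"
    using \<Gamma> family.optimal_pmf_subfamily(2)[OF \<Gamma> \<mu>] by (simp add: minimal_subfamily_def)
  then show ?thesis
    using \<Gamma> \<mu> chain non_crossing_family_iff[OF \<Gamma>]
    by (auto simp: non_crossing_minimal_subfamily_def)
qed

text \<open>A path of probability 0 could be removed without loss of modulus.\<close>

lemma minimal_subfamily_support:
  assumes "minimal_subfamily G P \<Gamma>" "\<mu> \<in> pmfs_on \<Gamma>" "optimal_pmf G P \<mu>"
  shows "\<Gamma> \<subseteq> set_pmf \<mu>"
proof (rule ccontr)
  assume "\<not> ?thesis"
  then obtain \<gamma> where \<gamma>: "\<gamma> \<in> \<Gamma>" "\<gamma> \<notin> set_pmf \<mu>"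
    by blast
  then have "\<mu> \<in> pmfs_on (\<Gamma> - {\<gamma>})" "\<Gamma> - {\<gamma>} \<subseteq> P"
    using assms(1,2) by (auto simp: pmfs_on_def minimal_subfamily_def)
  then have "Mod2 G (\<Gamma> - {\<gamma>}) = Mod2 G P"
    using family.optimal_pmf_subfamily(2) assms(3) by blast
  then show False
    using assms(1) \<gamma>(1) by (force simp: minimal_subfamily_def)
qed

lemma algorithm_of_minimal_subfamily:
  assumes "non_crossing_minimal_subfamily G A B L F \<Gamma>" "\<mu> \<in> pmfs_on \<Gamma>" "optimal_pmf G P \<mu>"
  shows "nms_algorithm G A B L F (extremal_density G P) = Some (\<Gamma>, \<lambda>\<gamma>. Mod2 G P * pmf \<mu> \<gamma>)"
    and "\<Gamma> \<subseteq> set_pmf \<mu>"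
proof -
  show "\<Gamma> \<subseteq> set_pmf \<mu>"
    using assms minimal_subfamily_support by (simp add: non_crossing_minimal_subfamily_def)
  then show "nms_algorithm G A B L F (extremal_density G P) = Some (\<Gamma>, \<lambda>\<gamma>. Mod2 G P * pmf \<mu> \<gamma>)"
    using assms non_crossing_family_iff[of \<Gamma>]
    by (intro algorithm_of_optimal_pmf) (simp_all add: non_crossing_minimal_subfamily_def)
qed

end

theorem theorem1:
  fixes G :: "'e network" and C S1 S2 A B :: "complex set"
    and L :: real and F :: "complex \<Rightarrow> complex"
  assumes network: "finite_plane_network G"
    and curve: "jordan_curve C" "encircles C G"
    and arcs: "is_arc S1" "is_arc S2" "S1 \<subseteq> C" "S2 \<subseteq> C" "S1 \<inter> S2 = {}"
    and A: "A = S1 \<inter> verts G" "A \<noteq> {}"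
    and B: "B = S2 \<inter> verts G" "B \<noteq> {}"
    and nonempty: "paths_between G A B \<noteq> {}"
    and map: "rectangle_map C S1 S2 L F"
    and contact: "\<forall>\<gamma>\<in>paths_between G A B. edge_trace G (set \<gamma>) \<inter> (S1 \<union> S2) \<subseteq> verts G"
  shows "(\<exists>!\<Gamma>. non_crossing_minimal_subfamily G A B L F \<Gamma>) \<and>
    (\<forall>\<Gamma>. non_crossing_minimal_subfamily G A B L F \<Gamma> \<longrightarrow>
       (\<exists>!\<mu>. \<mu> \<in> pmfs_on \<Gamma> \<and> optimal_pmf G (paths_between G A B) \<mu>) \<and>
       (\<exists>m. nms_algorithm G A B L F (extremal_density G (paths_between G A B)) = Some (\<Gamma>, m) \<and>
            (\<forall>\<gamma>\<in>\<Gamma>. 0 < m \<gamma>) \<and>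
            (\<forall>\<mu>. \<mu> \<in> pmfs_on \<Gamma> \<and> optimal_pmf G (paths_between G A B) \<mu> \<longrightarrow>
                 (\<forall>\<gamma>\<in>\<Gamma>. pmf \<mu> \<gamma> = m \<gamma> / (\<Sum>\<gamma>'\<in>\<Gamma>. m \<gamma>')))))"
proof -
  interpret rectangle_network G C S1 S2 A B L F
    using network curve(2) arcs A(1) B(1) map contact by unfold_locales (auto simp: encircles_def)
  define M where "M = Mod2 G P"
  have M: "0 < M"
    using family.Mod2_pos[OF nonempty] by (simp add: M_def)
  have optimal: "\<exists>\<mu>. \<mu> \<in> pmfs_on \<Gamma> \<and> optimal_pmf G P \<mu>"
    if "non_crossing_minimal_subfamily G A B L F \<Gamma>" for \<Gamma>
    using that by (auto simp: non_crossing_minimal_subfamily_def)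
  have run: "nms_algorithm G A B L F (extremal_density G P) = Some (\<Gamma>, \<lambda>\<gamma>. M * pmf \<mu> \<gamma>)"
    if "non_crossing_minimal_subfamily G A B L F \<Gamma>" "\<mu> \<in> pmfs_on \<Gamma>" "optimal_pmf G P \<mu>" for \<Gamma> \<mu>
    using algorithm_of_minimal_subfamily(1)[OF that] by (simp add: M_def)
  \<comment> \<open>Both pmfs are read off from the same output by dividing by the positive constant
    \<open>M\<close>.\<close>
  have unique: "\<mu> = \<nu>"
    if "non_crossing_minimal_subfamily G A B L F \<Gamma>" "\<mu> \<in> pmfs_on \<Gamma>" "optimal_pmf G P \<mu>"
      "\<nu> \<in> pmfs_on \<Gamma>" "optimal_pmf G P \<nu>" for \<Gamma> \<mu> \<nu>
  proof (rule pmf_eqI)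
    have "(\<lambda>\<gamma>. M * pmf \<mu> \<gamma>) = (\<lambda>\<gamma>. M * pmf \<nu> \<gamma>)"
      using run[OF that(1-3)] run[OF that(1,4,5)] by simp
    then show "pmf \<mu> \<gamma> = pmf \<nu> \<gamma>" for \<gamma>
      using M by (auto dest: fun_cong[of _ _ \<gamma>])
  qed
  show ?thesis
  proof (intro conjI allI impI)
    obtain \<Gamma> where \<Gamma>: "non_crossing_minimal_subfamily G A B L F \<Gamma>"
      using exists_non_crossing_minimal_subfamily[OF nonempty] ..
    then show "\<exists>!\<Gamma>. non_crossing_minimal_subfamily G A B L F \<Gamma>"
    proof (rule ex1I)
      fix \<Gamma>' assume "non_crossing_minimal_subfamily G A B L F \<Gamma>'"
      \<comment> \<open>Each family carries an optimal pmf, so each is the first component of the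
        same output.\<close>
      then show "\<Gamma>' = \<Gamma>"
        using \<Gamma> optimal run by (metis option.inject prod.inject)
    qed
  next
    fix \<Gamma> assume \<Gamma>: "non_crossing_minimal_subfamily G A B L F \<Gamma>"
    obtain \<mu> where \<mu>: "\<mu> \<in> pmfs_on \<Gamma>" "optimal_pmf G P \<mu>"
      using optimal[OF \<Gamma>] by blast
    then show "\<exists>!\<mu>. \<mu> \<in> pmfs_on \<Gamma> \<and> optimal_pmf G P \<mu>"
      using unique[OF \<Gamma>] by blast
    have "\<Gamma> \<subseteq> P"
      using \<Gamma> by (simp add: non_crossing_minimal_subfamily_def)
    then have "finite \<Gamma>"
      using finite_paths_between finite_subset by blast
    \<comment> \<open>The weights add up to \<open>M\<close>, so dividing by their sum gives back
      \<open>\<mu>\<close>; by uniqueness this covers every optimal pmf on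
      \<open>\<Gamma>\<close>.\<close>
    then have "(\<Sum>\<gamma>\<in>\<Gamma>. M * pmf \<mu> \<gamma>) = M"
      using sum_pmf_eq_1[of \<Gamma> \<mu>] \<mu>(1) by (simp add: pmfs_on_def flip: sum_distrib_left)
    moreover have "0 < pmf \<mu> \<gamma>" if "\<gamma> \<in> \<Gamma>" for \<gamma>
      using algorithm_of_minimal_subfamily(2)[OF \<Gamma> \<mu>] that by (auto intro: pmf_positive)
    ultimately show "\<exists>m. nms_algorithm G A B L F (extremal_density G P) = Some (\<Gamma>, m) \<and>
            (\<forall>\<gamma>\<in>\<Gamma>. 0 < m \<gamma>) \<and>
            (\<forall>\<mu>. \<mu> \<in> pmfs_on \<Gamma> \<and> optimal_pmf G P \<mu> \<longrightarrow> (\<forall>\<gamma>\<in>\<Gamma>. pmf \<mu> \<gamma> = m \<gamma> / (\<Sum>\<gamma>'\<in>\<Gamma>. m \<gamma>')))"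
      using run[OF \<Gamma> \<mu>] unique[OF \<Gamma> _ _ \<mu>] M by (intro exI[of _ "\<lambda>\<gamma>. M * pmf \<mu> \<gamma>"]) auto
  qed
qed

end
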